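(* Let $G$ be a connected ribbon graph and let $T$ be any given spanning tree of $G$. Then $$\varepsilon(G)=\operatorname{rank}\bigl(\operatorname{adj}(SI(Aux(G,T)))\bigr),$$ where the rank is taken over $\mathbb{GF}(2)$.
   Context: A (finite) ribbon graph $G$ is a surface with boundary represented as the union of two sets of closed topological discs, vertex-discs $V(G)$ and edge-ribbons $E(G)$, such that: (1) vertex-discs and edge-ribbons intersect in disjoint line segments; (2) each such segment lies on the boundary of precisely one vertex-disc and one edge-ribbon; (3) every edge-ribbon contains exactly two such segments. Loops and parallel edges are allowed. Let $F(G)$ be the set of faces (boundary components) and $c(G)$ the number of connected components. The Euler characteristic is $\chi(G)=|V(G)|-|E(G)|+|F(G)|$ and the Euler genus is $\varepsilon(G)=2c(G)-\chi(G)$. Contraction: if $e$ is an edge-ribbon joining two distinct vertex-discs $u,v$, then $G/e$ is obtained by replacing $e,u,v$ with the single new vertex-disc $e\cup u\cup v$ and keeping all other edge-ribbons and vertex-discs unchanged. For a connected ribbon graph $G$ and a spanning tree $T$ of $G$, the auxiliary bouquet $Aux(G,T)$ is obtained from $G$ by contracting all edge-ribbons of $T$ (if $G$ has one vertex, $T$ has no edges and $Aux(G,T)=G$); its edge-ribbons are those of $E(G)\setminus E(T)$. A bouquet is a ribbon graph with exactly one vertex-disc. A loop of a bouquet is twisted if, together with the vertex-disc, it is homeomorphic to a Möbius band, and untwisted if it is homeomorphic to an annulus. Two loops of a bouquet are interlaced if their ends alternate in the cyclic order around the vertex-disc. The intersection graph $I(B)$ of a bouquet $B$ has the loops of $B$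 as vertices, two being adjacent iff they are interlaced. The signed intersection graph $SI(B)$ is $I(B)$ with each vertex given sign $+$ if the loop is untwisted and $-$ if it is twisted. The matrix $\operatorname{adj}(SI(B))$ over $\mathbb{GF}(2)$ is the adjacency matrix of $I(B)$ with the diagonal entries at vertices of sign $-$ set to $1$. *)

theory Defs
  imports
    "HOL-Analysis.Analysis"
    "HOL-Library.Z2"
    "Jordan_Normal_Form.DL_Rank"
begin

section \<open>Surfaces and discs\<close>

definition closed_disc :: "'a::t2_space set \<Rightarrow> bool" where
  "closed_disc D \<longleftrightarrow> D homeomorphic cball (0::complex) 1"

text \<open>The boundary of a surface \<open>X\<close> in the sense of manifolds (not the topological frontier
  in the ambient space): the points without a neighbourhood in \<open>X\<close> that is an open disc.\<close>

definition surface_boundary :: "'a::t2_space set \<Rightarrow> 'a set" where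
  "surface_boundary X =
     {x \<in> X. \<not> (\<exists>U. openin (top_of_set X) U \<and> x \<in> U \<and> U homeomorphic ball (0::complex) 1)}"

text \<open>The circle times \<open>[-1, 1]\<close> modulo \<open>(z, t) \<sim> (-z, -t)\<close>, embedded by \<open>(z, t) \<mapsto> (z\<^sup>2, t z)\<close>.\<close>

definition moebius_band :: "(complex \<times> complex) set" where
  "moebius_band = (\<lambda>(z, t). (z\<^sup>2, of_real t * z)) ` (sphere 0 1 \<times> {-1..1::real})"

section \<open>Ribbon graphs\<close>

record 'a ribbon_structure =
  vdiscs :: "'a set set"
  ribbons :: "'a set set"

definition surface :: "'a ribbon_structure \<Rightarrow> 'a set" where
  "surface G = \<Union>(vdiscs G) \<union> \<Union>(ribbons G)"

definition ribbon_ends :: "'a::t2_space ribbon_structure \<Rightarrow> 'a set \<Rightarrow> 'a set set" where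
  "ribbon_ends G e = (\<Union>v\<in>vdiscs G. components (v \<inter> e))"

text \<open>In a Hausdorff space a finite union of compact discs carries the quotient topology of the
  gluing, so the conditions below make \<open>surface G\<close> a compact surface with boundary. As the
  vertex-discs are pairwise disjoint, and so are the edge-ribbons, every segment lies on exactly
  one vertex-disc and exactly one edge-ribbon, and distinct segments are disjoint.\<close>

definition ribbon_graph :: "'a::t2_space ribbon_structure \<Rightarrow> bool" where
  "ribbon_graph G \<longleftrightarrow>
     finite (vdiscs G) \<and> finite (ribbons G) \<and>
     (\<forall>D \<in> vdiscs G \<union> ribbons G. closed_disc D) \<and>
     disjoint (vdiscs G) \<and> disjoint (ribbons G) \<and>
     (\<forall>v \<in> vdiscs G. \<forall>e \<in> ribbons G. \<forall>s \<in> components (v \<inter> e).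
        s homeomorphic {0..1::real} \<and> s \<subseteq> surface_boundary v \<inter> surface_boundary e) \<and>
     (\<forall>e \<in> ribbons G. card (ribbon_ends G e) = 2)"

definition num_components :: "'a::t2_space ribbon_structure \<Rightarrow> nat" where
  "num_components G = card (components (surface G))"

definition faces :: "'a::t2_space ribbon_structure \<Rightarrow> 'a set set" where
  "faces G = components (surface_boundary (surface G))"

definition euler_char :: "'a::t2_space ribbon_structure \<Rightarrow> int" where
  "euler_char G = int (card (vdiscs G)) - int (card (ribbons G)) + int (card (faces G))"

definition euler_genus :: "'a::t2_space ribbon_structure \<Rightarrow> int" where
  "euler_genus G = 2 * int (num_components G) - euler_char G"

definition connected_ribbon_graph :: "'a::t2_space ribbon_structure \<Rightarrow> bool" where
  "connected_ribbon_graph G \<longleftrightarrow> ribbon_graph G \<and> num_components G = 1"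

section \<open>Spanning trees and contraction\<close>

definition incident_vdiscs :: "'a ribbon_structure \<Rightarrow> 'a set \<Rightarrow> 'a set set" where
  "incident_vdiscs G e = {v \<in> vdiscs G. v \<inter> e \<noteq> {}}"

text \<open>A cycle of length \<open>k \<ge> 1\<close>; a loop is a cycle of length 1 and two parallel edges form a
  cycle of length 2.\<close>

definition is_cycle :: "'a ribbon_structure \<Rightarrow> 'a set list \<Rightarrow> 'a set list \<Rightarrow> bool" where
  "is_cycle G vs es \<longleftrightarrow>
     es \<noteq> [] \<and> length vs = length es \<and> distinct vs \<and> distinct es \<and>
     set vs \<subseteq> vdiscs G \<and> set es \<subseteq> ribbons G \<and>
     (\<forall>i < length es. incident_vdiscs G (es ! i) = {vs ! i, vs ! (Suc i mod length es)})"

definition spanning_subgraph :: "'a ribbon_structure \<Rightarrow> 'a set set \<Rightarrow> 'a ribbon_structure" where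
  "spanning_subgraph G T = \<lparr>vdiscs = vdiscs G, ribbons = T\<rparr>"

definition spanning_tree :: "'a::t2_space ribbon_structure \<Rightarrow> 'a set set \<Rightarrow> bool" where
  "spanning_tree G T \<longleftrightarrow>
     T \<subseteq> ribbons G \<and> connected_ribbon_graph (spanning_subgraph G T) \<and>
     \<not> (\<exists>vs es. is_cycle (spanning_subgraph G T) vs es)"

text \<open>Only meant for an edge-ribbon \<open>e\<close> joining two distinct vertex-discs \<open>u\<close> and \<open>v\<close>; the new
  vertex-disc is then \<open>e \<union> u \<union> v\<close>.\<close>

definition contract :: "'a set \<Rightarrow> 'a ribbon_structure \<Rightarrow> 'a ribbon_structure" where
  "contract e G =
     \<lparr>vdiscs = insert (e \<union> \<Union>(incident_vdiscs G e)) (vdiscs G - incident_vdiscs G e),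
      ribbons = ribbons G - {e}\<rparr>"

text \<open>\<open>aux_bouquet G ts\<close> contracts the edge-ribbons listed in \<open>ts\<close> one after the other, so
  \<open>Aux(G, T)\<close> is \<open>aux_bouquet G ts\<close> for any enumeration \<open>ts\<close> of \<open>T\<close>.\<close>

definition aux_bouquet :: "'a ribbon_structure \<Rightarrow> 'a set list \<Rightarrow> 'a ribbon_structure" where
  "aux_bouquet G ts = fold contract ts G"

section \<open>Bouquets and their signed intersection graphs\<close>

text \<open>Only meant for a bouquet, i.e. a ribbon graph with exactly one vertex-disc.\<close>

definition the_vdisc :: "'a ribbon_structure \<Rightarrow> 'a set" where
  "the_vdisc B = the_elem (vdiscs B)"

definition twisted :: "'a::t2_space ribbon_structure \<Rightarrow> 'a set \<Rightarrow> bool" where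
  "twisted B e \<longleftrightarrow> (the_vdisc B \<union> e) homeomorphic moebius_band"

text \<open>Going once around the boundary circle of the vertex-disc one meets \<open>e\<close>, \<open>f\<close>, \<open>e\<close>, \<open>f\<close> in
  this order. The two visits to \<open>e\<close> are then at different ends of \<open>e\<close>, because each end is an arc
  of the circle disjoint from \<open>f\<close>; likewise for \<open>f\<close>.\<close>

definition interlaced :: "'a::t2_space ribbon_structure \<Rightarrow> 'a set \<Rightarrow> 'a set \<Rightarrow> bool" where
  "interlaced B e f \<longleftrightarrow> e \<noteq> f \<and>
     (\<exists>g. simple_path g \<and> pathfinish g = pathstart g \<and>
          path_image g = surface_boundary (the_vdisc B) \<and>
          (\<exists>a b c d. 0 \<le> a \<and> a < b \<and> b < c \<and> c < d \<and> d < 1 \<and>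
             g a \<in> e \<and> g b \<in> f \<and> g c \<in> e \<and> g d \<in> f))"

text \<open>The matrix of the signed intersection graph with respect to an enumeration \<open>es\<close> of the loops:
  twisted loops have sign \<open>-\<close>, hence diagonal entry 1.\<close>

definition adj_SI :: "'a::t2_space ribbon_structure \<Rightarrow> 'a set list \<Rightarrow> bit Matrix.mat" where
  "adj_SI B es = Matrix.mat (length es) (length es)
     (\<lambda>(i, j). if i = j then of_bool (twisted B (es ! i))
               else of_bool (interlaced B (es ! i) (es ! j)))"

end

theory Submission
  imports Defs "HOL-Library.Transitive_Closure_Table"
begin

text \<open>Contracting an edge that joins two distinct vertex-discs only regroups the pieces from which the
surface is built: the set \<open>surface G\<close>, and with it the faces, stays the same, while there
is one vertex-disc and one ribbon less. As the tree has one edge less than \<open>G\<close> has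
vertex-discs, all of them get contracted (\<open>aux_bouquet_contracts\<close>), and for the resulting
bouquet with \<open>n\<close> loops, \<open>F\<close> faces and matrix \<open>A\<close> it remains to show
\<open>F + rank A = n + 1\<close> (\<open>bouquet_faces_rank\<close>).

The faces are counted through the colourings of the boundary of the surface with two colours that
are constant on every face; there are \<open>2\<^sup>F\<close> of them. The boundary consists of the gaps
that the ribbon ends leave on the boundary circle of the vertex-disc and of the two long sides of
every ribbon. Walk once around the circle. At an end of the ribbon \<open>e\<close> the colour changes
by some \<open>x\<^sub>e\<close> in GF(2), and this is the same at both ends of \<open>e\<close>, since the sides of
\<open>e\<close> carry the two colours on the left and on the right of one end to those next to the other
end. So a colouring is determined by the colour of the base point and by the vector \<open>x\<close>.
Conversely, such data colour the gaps, and this extends to the sides if and only if any two gaps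
joined by a side get equal colours. Between the two ends of \<open>e\<close> the colour changes by the sum
of the \<open>x\<^sub>f\<close> over the loops \<open>f\<close> interlaced with \<open>e\<close>, because any other loop has none
or both of its ends there; if \<open>e\<close> is twisted then its sides join the gaps in the opposite way,
which adds \<open>x\<^sub>e\<close> to the condition. Hence the condition at \<open>e\<close> is the row \<open>e\<close>
of \<open>A x = 0\<close>, and \<open>2\<^sup>F\<close> is twice the number of vectors in the kernel of \<open>A\<close>
(\<open>count_faces\<close>).

To carry this out for topological surfaces one needs to know their boundaries. Invariance of
domain gives the boundary of planar sets; Alexander's trick extends homeomorphisms between the
boundary circles of discs, so that any disc with two disjoint arcs on its boundary can be
replaced by a square with two opposite edges (\<open>disc_as_square\<close>). This yields the gluing of two
discs along an arc (\<open>glue_discs\<close>), the boundary of a disc with ribbons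
(\<open>surface_boundary_Surf\<close>), and the fact that a loop is twisted exactly if parallel segments from
one of its sides to the other run through both ends in the same direction of the boundary circle
(\<open>homeomorphic_moebius_iff\<close>): in that case the pieces are glued like the Moebius band, and
otherwise the boundary is disconnected, unlike that of the band.\<close>

section \<open>The boundary of a surface\<close>

lemma homeomorphism_image_subset:
  assumes "homeomorphism S T f g" "S' \<subseteq> S"
  shows "homeomorphism S' (f ` S') f g"
  by (rule homeomorphism_of_subsets[OF assms subset_refl refl])

lemma homeomorphic_image_subset:
  assumes "homeomorphism S T f g" "S' \<subseteq> S"
  shows "S' homeomorphic f ` S'"
  using homeomorphism_image_subset[OF assms] unfolding homeomorphic_def by blast

lemma surface_boundary_homeomorphism:
  assumes "homeomorphism X Y f g"
  shows "surface_boundary Y = f ` surface_boundary X"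
proof -
  have fX: "f ` X = Y" "g ` Y = X" and fg: "\<And>x. x \<in> X \<Longrightarrow> g (f x) = x" "\<And>y. y \<in> Y \<Longrightarrow> f (g y) = y"
    using assms by (auto simp: homeomorphism_def)
  have main: "(\<exists>U. openin (top_of_set Y) U \<and> f x \<in> U \<and> U homeomorphic ball (0::complex) 1) \<longleftrightarrow>
      (\<exists>U. openin (top_of_set X) U \<and> x \<in> U \<and> U homeomorphic ball (0::complex) 1)" if x: "x \<in> X" for x
  proof
    assume "\<exists>U. openin (top_of_set X) U \<and> x \<in> U \<and> U homeomorphic ball (0::complex) 1"
    then obtain U where U: "openin (top_of_set X) U" "x \<in> U" "U homeomorphic ball (0::complex) 1" by blast
    have UX: "U \<subseteq> X" using U(1) openin_imp_subset by blast
    have "openin (top_of_set Y) (f ` U)" using homeomorphism_imp_open_map[OF assms U(1)] .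
    moreover have "U homeomorphic f ` U" by (rule homeomorphic_image_subset[OF assms UX])
    ultimately show "\<exists>U. openin (top_of_set Y) U \<and> f x \<in> U \<and> U homeomorphic ball (0::complex) 1"
      using U(2) homeomorphic_trans[OF homeomorphic_sym[THEN iffD1] U(3)] by blast
  next
    assume "\<exists>U. openin (top_of_set Y) U \<and> f x \<in> U \<and> U homeomorphic ball (0::complex) 1"
    then obtain U where U: "openin (top_of_set Y) U" "f x \<in> U" "U homeomorphic ball (0::complex) 1" by blast
    have UX: "U \<subseteq> Y" using U(1) openin_imp_subset by blast
    have sym: "homeomorphism Y X g f" using assms homeomorphism_symD by blast
    have "openin (top_of_set X) (g ` U)" using homeomorphism_imp_open_map[OF sym U(1)] .
    moreover have "U homeomorphic g ` U" by (rule homeomorphic_image_subset[OF sym UX])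
    moreover have "x \<in> g ` U" using U(2) fg(1)[OF x] by force
    ultimately show "\<exists>U. openin (top_of_set X) U \<and> x \<in> U \<and> U homeomorphic ball (0::complex) 1"
      using U(3) homeomorphic_trans[OF homeomorphic_sym[THEN iffD1] U(3)] by blast
  qed
  show ?thesis
  proof (intro equalityI subsetI)
    fix y assume "y \<in> surface_boundary Y"
    then have y: "y \<in> Y" "\<not> (\<exists>U. openin (top_of_set Y) U \<and> y \<in> U \<and> U homeomorphic ball (0::complex) 1)"
      unfolding surface_boundary_def mem_Collect_eq by - (erule conjE, assumption)+
    have gy: "g y \<in> X" "f (g y) = y" using y(1) fX fg by auto
    have "g y \<in> surface_boundary X" unfolding surface_boundary_def mem_Collect_eq
      using gy(1) main[OF gy(1)] y(2) unfolding gy(2) by argo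
    then show "y \<in> f ` surface_boundary X" using gy(2) by force
  next
    fix y assume "y \<in> f ` surface_boundary X"
    then obtain x where x: "y = f x" "x \<in> surface_boundary X" by blast
    then have x': "x \<in> X" "\<not> (\<exists>U. openin (top_of_set X) U \<and> x \<in> U \<and> U homeomorphic ball (0::complex) 1)"
      unfolding surface_boundary_def mem_Collect_eq by - (erule conjE, assumption)+
    have "f x \<in> Y" using x'(1) fX by blast
    then show "y \<in> surface_boundary Y" unfolding surface_boundary_def mem_Collect_eq x(1)
      using main[OF x'(1)] x'(2) by argo
  qed
qed

text \<open>Being a boundary point is a local property, since every neighbourhood of a point of an open disc
contains a smaller open disc around it.\<close>

lemma surface_boundary_openin:
  assumes W: "openin (top_of_set X) W" and x: "x \<in> W"
  shows "x \<in> surface_boundary X \<longleftrightarrow> x \<in> surface_boundary W"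
proof -
  have WX: "W \<subseteq> X" using W openin_imp_subset by blast
  have "(\<exists>U. openin (top_of_set X) U \<and> x \<in> U \<and> U homeomorphic ball (0::complex) 1) \<longleftrightarrow>
      (\<exists>U. openin (top_of_set W) U \<and> x \<in> U \<and> U homeomorphic ball (0::complex) 1)" (is "?L \<longleftrightarrow> ?R")
  proof
    assume ?R then show ?L using W openin_trans by blast
  next
    assume ?L
    then obtain U f g where U: "openin (top_of_set X) U" "x \<in> U" 
      and h: "homeomorphism U (ball (0::complex) 1) f g" unfolding homeomorphic_def by blast
    have UW: "openin (top_of_set U) (U \<inter> W)" using W U(1) openin_imp_subset
      by (metis inf.absorb_iff2 inf_commute openin_subtopology_Int2 subtopology_subtopology)
    have "openin (top_of_set (ball 0 1)) (f ` (U \<inter> W))" using homeomorphism_imp_open_map[OF h UW] .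
    then have "open (f ` (U \<inter> W))" by (simp add: openin_open_eq)
    moreover have fx: "f x \<in> f ` (U \<inter> W)" using U x by blast
    ultimately obtain e where e: "e > 0" "ball (f x) e \<subseteq> f ` (U \<inter> W)" using open_contains_ball by blast
    have sub: "f ` (U \<inter> W) \<subseteq> ball 0 1" using h by (auto simp: homeomorphism_def)
    have sym: "homeomorphism (ball 0 1) U g f" using h homeomorphism_symD by blast
    let ?V = "g ` ball (f x) e"
    have gf: "g (f y) = y" if "y \<in> U" for y using h that by (auto simp: homeomorphism_def)
    have "openin (top_of_set (ball 0 1)) (ball (f x) e)" by (rule open_subset) (use e sub in auto)
    then have V: "openin (top_of_set U) ?V" using homeomorphism_imp_open_map[OF sym] by blast
    have VW: "?V \<subseteq> W" using e(2) gf by auto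
    have "openin (top_of_set X) ?V" using V U(1) openin_trans by blast
    then have "openin (top_of_set W) ?V" using VW WX by (meson openin_subset_trans)
    moreover have "x \<in> ?V" using gf[OF U(2)] e(1) by (metis centre_in_ball imageI)
    moreover have "ball (f x) e homeomorphic ?V"
      by (rule homeomorphic_image_subset[OF sym]) (use e sub in auto)
    moreover have "ball (f x) e homeomorphic ball (0::complex) 1" using e(1) homeomorphic_balls(1)[of e 1] by simp
    ultimately show ?R by (meson homeomorphic_sym homeomorphic_trans)
  qed
  then show ?thesis unfolding surface_boundary_def using x WX by blast
qed

lemma surface_boundary_local:
  assumes "openin (top_of_set X) W" "openin (top_of_set Y) W" "x \<in> W"
  shows "x \<in> surface_boundary X \<longleftrightarrow> x \<in> surface_boundary Y"
  using assms surface_boundary_openin by blast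

lemma surface_boundary_subset: "surface_boundary X \<subseteq> X"
  unfolding surface_boundary_def by blast

text \<open>By invariance of domain, an open disc inside a planar set is open in the plane.\<close>

lemma surface_boundary_planar:
  fixes K :: "complex set"
  shows "surface_boundary K = K - interior K"
proof -
  have "(\<exists>U. openin (top_of_set K) U \<and> x \<in> U \<and> U homeomorphic ball (0::complex) 1) \<longleftrightarrow> x \<in> interior K" for x
  proof
    assume "\<exists>U. openin (top_of_set K) U \<and> x \<in> U \<and> U homeomorphic ball (0::complex) 1"
    then obtain U where U: "openin (top_of_set K) U" "x \<in> U" "U homeomorphic ball (0::complex) 1" by blast
    then have "ball (0::complex) 1 homeomorphic U" using homeomorphic_sym by blast
    then obtain f g where "homeomorphism (ball (0::complex) 1) U f g" unfolding homeomorphic_def by blast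
    then have fg: "f ` ball 0 1 = U" "continuous_on (ball 0 1) f" "inj_on f (ball 0 1)"
      by (auto simp: homeomorphism_def intro: inj_on_inverseI[of _ g])
    have "open (f ` ball 0 1)" by (rule invariance_of_domain_gen[OF open_ball fg(2,3)]) simp
    then have "open U" using fg(1) by simp
    then show "x \<in> interior K" using U openin_imp_subset interiorI by metis
  next
    assume "x \<in> interior K"
    then obtain e where e: "e > 0" "ball x e \<subseteq> K" using mem_interior by blast
    have "ball x e homeomorphic ball (0::complex) 1" using e(1) homeomorphic_balls(1)[of e 1] by simp
    then show "\<exists>U. openin (top_of_set K) U \<and> x \<in> U \<and> U homeomorphic ball (0::complex) 1"
      using e open_subset by (metis centre_in_ball open_ball)
  qed
  then show ?thesis unfolding surface_boundary_def by blast
qed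

lemma surface_boundary_cball: "surface_boundary (cball (0::complex) 1) = sphere 0 1"
  by (auto simp: surface_boundary_planar)

section \<open>Closed discs and the extension of boundary homeomorphisms\<close>

lemma closed_disc_homeomorphic:
  assumes "closed_disc D" "D homeomorphic D'" shows "closed_disc D'"
  using assms unfolding closed_disc_def by (meson homeomorphic_sym homeomorphic_trans)

lemma closed_disc_compact: "closed_disc D \<Longrightarrow> compact D"
  unfolding closed_disc_def using homeomorphic_compactness[of D] compact_cball by blast

lemma closed_disc_closed: "closed_disc D \<Longrightarrow> closed D"
  using closed_disc_compact compact_imp_closed by blast

lemma closed_disc_nonempty: "closed_disc D \<Longrightarrow> D \<noteq> {}"
  unfolding closed_disc_def using homeomorphic_empty(1) by force

lemma closed_disc_connected: "closed_disc D \<Longrightarrow> connected D"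
  unfolding closed_disc_def using homeomorphic_connectedness connected_cball by blast

text \<open>Alexander's trick: after choosing coordinates, a homeomorphism \<open>\<psi>\<close> of the unit circle extends
to the cone map that sends \<open>z\<close> to \<open>|z| \<psi> (z / |z|)\<close>.\<close>

lemma closed_disc_extension:
  assumes D: "closed_disc D" "closed_disc D'"
    and \<phi>: "continuous_on (surface_boundary D) \<phi>" "inj_on \<phi> (surface_boundary D)" "\<phi> ` surface_boundary D = surface_boundary D'"
  shows "\<exists>\<Phi> \<Psi>. homeomorphism D D' \<Phi> \<Psi> \<and> (\<forall>x \<in> surface_boundary D. \<Phi> x = \<phi> x)"
proof -
  obtain f g where fg: "homeomorphism (cball (0::complex) 1) D f g" 
    using D homeomorphic_sym unfolding closed_disc_def homeomorphic_def by blast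
  obtain f' g' where fg': "homeomorphism (cball (0::complex) 1) D' f' g'" 
    using D homeomorphic_sym unfolding closed_disc_def homeomorphic_def by blast
  have bD: "surface_boundary D = f ` sphere 0 1" using surface_boundary_homeomorphism[OF fg] by (simp add: surface_boundary_cball)
  have bD': "surface_boundary D' = f' ` sphere 0 1" using surface_boundary_homeomorphism[OF fg'] by (simp add: surface_boundary_cball)
  define \<psi> where "\<psi> z = g' (\<phi> (f z))" for z
  have sc: "sphere (0::complex) 1 \<subseteq> cball 0 1" by auto
  have g'f': "g' (f' z) = z" if "z \<in> sphere 0 1" for z using fg' that by (auto simp: homeomorphism_def)
  have \<psi>s: "\<psi> ` sphere 0 1 = sphere 0 1"
  proof -
    have "\<psi> ` sphere 0 1 = g' ` \<phi> ` f ` sphere 0 1" by (auto simp: \<psi>_def image_image)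
    also have "\<dots> = g' ` f' ` sphere 0 1" using \<phi>(3) bD bD' by simp
    also have "\<dots> = sphere 0 1" using g'f' by force
    finally show ?thesis .
  qed
  have \<psi>n: "norm (\<psi> z) = 1" if "norm z = 1" for z using \<psi>s that by force
  have \<psi>c: "continuous_on (sphere 0 1) \<psi>"
  proof -
    have "continuous_on (sphere 0 1) f" using fg continuous_on_subset[OF _ sc] unfolding homeomorphism_def by blast
    then have "continuous_on (sphere 0 1) (\<lambda>z. \<phi> (f z))"
      using continuous_on_compose2[OF \<phi>(1), of "sphere 0 1" f] bD by auto
    moreover have "continuous_on D' g'" using fg' by (auto simp: homeomorphism_def)
    moreover have "(\<lambda>z. \<phi> (f z)) ` sphere 0 1 \<subseteq> D'" using \<phi>(3) bD surface_boundary_subset[of D'] by force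
    ultimately show ?thesis unfolding \<psi>_def using continuous_on_compose2 by blast
  qed
  have \<psi>i: "inj_on \<psi> (sphere 0 1)"
  proof (rule inj_onI)
    fix x y :: complex assume xy: "x \<in> sphere 0 1" "y \<in> sphere 0 1" "\<psi> x = \<psi> y"
    have "\<phi> (f x) \<in> D'" "\<phi> (f y) \<in> D'" using \<phi>(3) bD surface_boundary_subset[of D'] xy by blast+
    moreover have "\<And>u. u \<in> D' \<Longrightarrow> f' (g' u) = u" using fg' by (auto simp: homeomorphism_def)
    ultimately have "\<phi> (f x) = \<phi> (f y)" using xy(3) unfolding \<psi>_def by metis
    then have "f x = f y" using \<phi>(2) bD xy(1,2) by (auto dest!: inj_onD)
    moreover have "\<And>u. u \<in> cball 0 1 \<Longrightarrow> g (f u) = u" using fg by (auto simp: homeomorphism_def)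
    ultimately show "x = y" using xy sc by (metis subsetD)
  qed
  \<comment> \<open>At the origin, \<open>sgn 0 = 0\<close> does no harm, as the factor in front vanishes.\<close>
  define \<Theta> where "\<Theta> z = (of_real (norm z) * \<psi> (sgn z) :: complex)" for z
  have sg: "norm (sgn z) = 1" if "z \<noteq> 0" for z::complex using that by (simp add: norm_sgn)
  have n\<Theta>: "norm (\<Theta> z) = norm z" for z
    by (cases "z = 0") (auto simp: \<Theta>_def norm_mult \<psi>n sg)
  have c\<Theta>: "continuous_on (cball 0 1) \<Theta>"
    unfolding continuous_on_eq_continuous_within
  proof
    fix z :: complex assume z: "z \<in> cball 0 1"
    show "continuous (at z within cball 0 1) \<Theta>"
    proof (cases "z = 0")
      case True
      have "((\<lambda>w. norm (\<Theta> w)) \<longlongrightarrow> 0) (at 0 within cball 0 1)" unfolding n\<Theta>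
        by (rule tendsto_eq_intros | simp)+
      then have "(\<Theta> \<longlongrightarrow> 0) (at 0 within cball 0 1)" using tendsto_norm_zero_iff by blast
      moreover have "\<Theta> 0 = 0" by (simp add: \<Theta>_def)
      ultimately show ?thesis using True by (simp add: continuous_within)
    next
      case False
      have "continuous_on (- {0}) (\<lambda>z::complex. sgn z)" by (auto intro!: continuous_intros)
      then have "continuous_on (- {0}) (\<lambda>z. \<psi> (sgn z))"
        by (rule continuous_on_compose2[OF \<psi>c]) (auto simp: norm_sgn split: if_splits)
      then have "continuous_on (- {0}) \<Theta>" unfolding \<Theta>_def by (intro continuous_intros)
      then have "isCont \<Theta> z" using False continuous_on_eq_continuous_at[of "- {0}" \<Theta>] by auto
      then show ?thesis using continuous_at_imp_continuous_at_within by blast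
    qed
  qed
  have i\<Theta>: "inj_on \<Theta> (cball 0 1)"
  proof (rule inj_onI)
    fix x y :: complex assume xy: "x \<in> cball 0 1" "y \<in> cball 0 1" "\<Theta> x = \<Theta> y"
    have nn: "norm x = norm y" using xy(3) n\<Theta> by metis
    show "x = y"
    proof (cases "x = 0")
      case True then show ?thesis using nn by simp
    next
      case False
      then have y: "y \<noteq> 0" using nn by auto
      have "\<psi> (sgn x) = \<psi> (sgn y)" using xy(3) nn False y by (simp add: \<Theta>_def)
      then have "sgn x = sgn y" using \<psi>i sg False y by (auto dest!: inj_onD)
      then show ?thesis using nn y False by (metis sgn_div_norm scaleR_cancel_left inverse_nonzero_iff_nonzero norm_eq_zero)
    qed
  qed
  have s\<Theta>: "\<Theta> ` cball 0 1 = cball 0 1"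
  proof
    show "\<Theta> ` cball 0 1 \<subseteq> cball 0 1" using n\<Theta> by auto
    show "cball 0 1 \<subseteq> \<Theta> ` cball 0 1"
    proof
      fix w :: complex assume w: "w \<in> cball 0 1"
      show "w \<in> \<Theta> ` cball 0 1"
      proof (cases "w = 0")
        case True then show ?thesis using n\<Theta>[of 0] by (metis image_eqI norm_eq_zero centre_in_cball norm_zero zero_le_one)
      next
        case False
        then obtain u where u: "u \<in> sphere 0 1" "\<psi> u = sgn w" using \<psi>s sg[OF False] by (metis imageE mem_sphere_0)
        let ?z = "of_real (norm w) * u"
        have nz: "norm ?z = norm w" using u by (simp add: norm_mult)
            have "sgn ?z = u" using u(1) False by (simp add: sgn_div_norm norm_mult scaleR_conv_of_real)
        then have "\<Theta> ?z = of_real (norm w) * sgn w" using u nz by (simp add: \<Theta>_def)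
        also have "\<dots> = w" using False by (simp add: sgn_div_norm scaleR_conv_of_real)
        finally show ?thesis using nz w by (metis image_eqI mem_cball_0)
      qed
    qed
  qed
  define \<Phi> where "\<Phi> = f' \<circ> \<Theta> \<circ> g"
  have gD: "g ` D = cball 0 1" "continuous_on D g" "inj_on g D" using fg by (auto simp: homeomorphism_def intro!: inj_on_inverseI[of _ f])
  have f'D: "f' ` cball 0 1 = D'" "continuous_on (cball 0 1) f'" "inj_on f' (cball 0 1)" using fg' by (auto simp: homeomorphism_def intro!: inj_on_inverseI[of _ g'])
  have "continuous_on D \<Phi>" unfolding \<Phi>_def
    by (metis gD c\<Theta> s\<Theta> f'D continuous_on_compose)
  moreover have "inj_on \<Phi> D" unfolding \<Phi>_def
    by (metis gD i\<Theta> s\<Theta> f'D comp_inj_on image_comp)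
  moreover have "\<Phi> ` D = D'" unfolding \<Phi>_def by (metis gD(1) s\<Theta> f'D(1) image_comp)
  ultimately obtain \<Psi> where "homeomorphism D D' \<Phi> \<Psi>" using homeomorphism_compact[OF closed_disc_compact[OF D(1)]] by blast
  moreover have "\<Phi> x = \<phi> x" if x: "x \<in> surface_boundary D" for x
  proof -
    obtain u where u: "u \<in> sphere 0 1" "x = f u" using x bD by blast
    have gu: "g (f u) = u" using fg u sc by (auto simp: homeomorphism_def)
    have "sgn u = u" using u by (simp add: sgn_div_norm)
    then have "\<Theta> u = g' (\<phi> x)" using u by (simp add: \<Theta>_def \<psi>_def)
    moreover have "\<phi> x \<in> D'" using x \<phi>(3) surface_boundary_subset[of D'] by blast
    ultimately show ?thesis using gu u fg' by (auto simp: \<Phi>_def homeomorphism_def)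
  qed
  ultimately show ?thesis by blast
qed

section \<open>Loops and arcs on the boundary circle of a disc\<close>

text \<open>Parametrisations of a topological circle \<open>C\<close> that start and end at the same point.\<close>

definition simple_loop :: "(real \<Rightarrow> 'a::topological_space) \<Rightarrow> 'a set \<Rightarrow> bool" where
  "simple_loop g C \<longleftrightarrow> simple_path g \<and> pathfinish g = pathstart g \<and> path_image g = C"

text \<open>The part of the path \<open>g\<close> between the times \<open>a\<close> and \<open>b\<close>, in a space without linear
structure; it runs backwards if \<open>b < a\<close>.\<close>

definition segpath :: "(real \<Rightarrow> 'a) \<Rightarrow> real \<Rightarrow> real \<Rightarrow> real \<Rightarrow> 'a" where
  "segpath g a b x = g (a + (b - a) * x)"

lemma simple_loop_continuous: "simple_loop g C \<Longrightarrow> continuous_on {0..1} g"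
  unfolding simple_loop_def simple_path_def path_def by blast

lemma simple_loop_image: "simple_loop g C \<Longrightarrow> g ` {0..1} = C"
  unfolding simple_loop_def path_image_def by blast

lemma simple_loop_closed: "simple_loop g C \<Longrightarrow> g 1 = g 0"
  unfolding simple_loop_def pathstart_def pathfinish_def by blast

lemma simple_loop_eqD:
  "simple_loop g C \<Longrightarrow> g x = g y \<Longrightarrow> 0 \<le> x \<Longrightarrow> x \<le> 1 \<Longrightarrow> 0 \<le> y \<Longrightarrow> y \<le> 1 \<Longrightarrow> x = y \<or> x = 0 \<and> y = 1 \<or> x = 1 \<and> y = 0"
  unfolding simple_loop_def simple_path_def loop_free_def by auto

lemma simple_loop_shiftpath:
  assumes "simple_loop g C" "0 \<le> a" "a \<le> 1"
  shows "simple_loop (shiftpath a g) C"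
  using assms unfolding simple_loop_def 
  by (simp add: simple_path_shiftpath path_image_shiftpath endpoints_shiftpath)

lemma simple_loop_reversepath: "simple_loop g C \<Longrightarrow> simple_loop (reversepath g) C"
  unfolding simple_loop_def by (simp add: simple_path_reversepath)

lemma segpath_image:
  assumes "u \<le> v" shows "segpath g u v ` {0..1} = g ` {u..v}"
proof -
  have "(\<lambda>x. u + (v - u) * x) ` {0..1} = {u..v}" 
    using assms image_affinity_atLeastAtMost[of "v - u" u 0 1] by (auto simp: algebra_simps)
  then show ?thesis unfolding segpath_def by (metis (no_types, lifting) image_cong image_image)
qed

lemma segpath_0 [simp]: "segpath g u v 0 = g u" and segpath_1 [simp]: "segpath g u v 1 = g v"
  by (auto simp: segpath_def)

lemma arc_segpath:
  assumes "simple_loop g C" "0 \<le> u" "u < v" "v \<le> 1" "u \<noteq> 0 \<or> v \<noteq> 1"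
  shows "arc (segpath g u v)"
proof -
  have rng: "u \<le> u + (v - u) * x \<and> u + (v - u) * x \<le> v" if "x \<in> {0..1}" for x
  proof -
    have "(v - u) * x \<le> (v - u) * 1" "0 \<le> (v - u) * x" using assms that by (intro mult_left_mono mult_nonneg_nonneg; simp)+
    then show ?thesis by simp
  qed
  have "continuous_on {0..1} (segpath g u v)" unfolding segpath_def
    by (rule continuous_on_compose2[OF simple_loop_continuous[OF assms(1)]])
       (use rng assms in \<open>force intro!: continuous_intros\<close>)+
  moreover have "inj_on (segpath g u v) {0..1}"
  proof (rule inj_onI)
    fix x y :: real assume xy: "x \<in> {0..1}" "y \<in> {0..1}" "segpath g u v x = segpath g u v y"
    then have "u + (v - u) * x = u + (v - u) * y"
      using rng[OF xy(1)] rng[OF xy(2)] assms(2,4,5) simple_loop_eqD[OF assms(1), of "u + (v - u) * x" "u + (v - u) * y"]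
      unfolding segpath_def by (smt (verit))
    then show "x = y" using assms by simp
  qed
  ultimately show ?thesis unfolding arc_def path_def by blast
qed

lemma closed_disc_boundary_loop:
  assumes D: "closed_disc D" and p: "p \<in> surface_boundary D"
  shows "\<exists>g. simple_loop g (surface_boundary D) \<and> g 0 = p"
proof -
  obtain f k where fk: "homeomorphism (cball (0::complex) 1) D f k" 
    using D homeomorphic_sym unfolding closed_disc_def homeomorphic_def by blast
  have bD: "surface_boundary D = f ` sphere 0 1" using surface_boundary_homeomorphism[OF fk] by (simp add: surface_boundary_cball)
  obtain w where w: "norm w = 1" "f w = p" using p bD by auto
  have w0: "w \<noteq> 0" using w(1) by auto
  define e where "e t = w * exp (\<i> * of_real (2 * pi * t))" for t
  have ne: "norm (e t) = 1" for t using w by (simp add: e_def norm_mult)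
  have fi: "f x = f y \<Longrightarrow> norm x = 1 \<Longrightarrow> norm y = 1 \<Longrightarrow> x = y" for x y
    using fk by (auto simp: homeomorphism_def) (metis mem_cball_0 order_refl)
  have fc: "continuous_on (cball 0 1) f" using fk by (auto simp: homeomorphism_def)
  have ei: "x = 0 \<and> y = 1" if xy: "0 \<le> x" "x < y" "y \<le> 1" "e x = e y" for x y
  proof (rule ccontr)
    assume n: "\<not> ?thesis"
    have E: "exp (\<i> * of_real (2 * pi * x)) = exp (\<i> * of_real (2 * pi * y))" using xy w0 by (simp add: e_def)
    have A: "Arg2pi (exp (\<i> * of_real (2 * pi * t))) = 2 * pi * t" if "0 \<le> t" "t < 1" for t
      by (rule Arg2pi_unique[of 1]) (use that in auto)
    show False
    proof (cases "y = 1")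
      case False then show ?thesis using A[of x] A[of y] E xy by auto
    next
      case True
      have "exp (\<i> * of_real (2 * pi * y)) = 1" using True by (simp add: exp_eq_1)
      then have "Arg2pi (exp (\<i> * of_real (2 * pi * x))) = 0" using E A[of 0] by simp
      then show False using A[of x] xy n True by auto
    qed
  qed
  define g where "g = f \<circ> e"
  have "path g" unfolding path_def g_def
    by (intro continuous_on_compose continuous_on_subset[OF fc]) (auto simp: e_def norm_mult w intro!: continuous_intros)
  then have "simple_path g"
  proof (rule simple_pathI)
    fix x y :: real assume "0 \<le> x" "x < y" "y \<le> 1" "g x = g y"
    moreover have "e x = e y" by (rule fi[OF _ ne ne]) (use \<open>g x = g y\<close> in \<open>simp add: g_def\<close>)
    ultimately show "x = 0 \<and> y = 1" using ei by blast
  qed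
  moreover have "pathfinish g = pathstart g" 
  proof -
    have "exp (\<i> * of_real (2 * pi * 1)) = (1::complex)" by (simp add: exp_eq_1)
    then have "e 1 = e 0" unfolding e_def by simp
    then show ?thesis by (simp add: pathfinish_def pathstart_def g_def)
  qed
  moreover have "path_image g = surface_boundary D"
  proof
    show "path_image g \<subseteq> surface_boundary D" unfolding path_image_def bD g_def using ne by auto
    show "surface_boundary D \<subseteq> path_image g"
    proof
      fix z assume "z \<in> surface_boundary D"
      then obtain u where u: "norm u = 1" "z = f u" using bD by auto
      have "norm (u / w) = 1" using u w by (simp add: norm_divide)
      then have "u / w = exp (\<i> * of_real (Arg2pi (u / w)))" using Arg2pi_eq[of "u / w"] by simp
      then have "u = e (Arg2pi (u / w) / (2 * pi))" using w0 by (simp add: e_def field_simps)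
      moreover have "Arg2pi (u / w) / (2 * pi) \<in> {0..1}" using Arg2pi_ge_0[of "u/w"] Arg2pi_lt_2pi[of "u/w"] by (auto simp: field_simps)
      ultimately show "z \<in> path_image g" unfolding path_image_def g_def u by force
    qed
  qed
  moreover have "g 0 = p" using w by (simp add: g_def e_def)
  ultimately show ?thesis unfolding simple_loop_def by blast
qed

text \<open>An arc that avoids the base point of a loop pulls back to a compact connected set of times, on
which the loop is injective; a continuous injective function on an interval takes its extreme
values at the endpoints.\<close>

lemma arc_in_loop:
  fixes g :: "real \<Rightarrow> 'a::t2_space"
  assumes g: "simple_loop g C" and p: "arc p" "path_image p \<subseteq> C" "g 0 \<notin> path_image p"
  shows "\<exists>a b. 0 < a \<and> a < b \<and> b < 1 \<and> path_image p = g ` {a..b} \<and>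
    (p 0 = g a \<and> p 1 = g b \<or> p 0 = g b \<and> p 1 = g a)"
proof -
  define S where "S = {t \<in> {0..1}. g t \<in> path_image p}"
  have gc: "continuous_on {0..1} g" using simple_loop_continuous[OF g] .
  have cp: "closed (path_image p)" using p(1) by (simp add: arc_imp_path compact_imp_closed compact_path_image)
  have "closed S" unfolding S_def 
    using continuous_closed_preimage[OF gc closed_atLeastAtMost cp] by (simp add: vimage_def Int_def)
  moreover have "S = {0..1} \<inter> S" by (auto simp: S_def)
  ultimately have Sc: "compact S" using compact_Int_closed[of "{0..1}" S] by simp
  have S0: "0 \<notin> S" "1 \<notin> S" using p(3) simple_loop_closed[OF g] by (auto simp: S_def)
  have Si: "inj_on g S"
  proof (rule inj_onI)
    fix x y assume "x \<in> S" "y \<in> S" "g x = g y"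
    then show "x = y" using simple_loop_eqD[OF g, of x y] S0 by (auto simp: S_def)
  qed
  have gS: "g ` S = path_image p" using p(2) simple_loop_image[OF g] by (auto simp: S_def)
  have "continuous_on S g" by (rule continuous_on_subset[OF gc]) (auto simp: S_def)
  then obtain k where k: "homeomorphism S (path_image p) g k"
    using homeomorphism_compact[OF Sc _ gS Si] by blast
  define u where "u = k \<circ> p"
  have pc: "continuous_on {0..1} p" and pi: "inj_on p {0..1}" using p(1) by (auto simp: arc_def path_def)
  have kc: "continuous_on (path_image p) k" "inj_on k (path_image p)" "k ` path_image p = S"
    using k by (auto simp: homeomorphism_def intro!: inj_on_inverseI[of _ g])
  have uc: "continuous_on {0..1} u" unfolding u_def by (rule continuous_on_compose[OF pc kc(1)[unfolded path_image_def]])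
  have ui: "inj_on u {0..1}" unfolding u_def using pi kc(2) by (auto simp: path_image_def intro: comp_inj_on)
  have uS: "u ` {0..1} = S" unfolding u_def using kc(3) by (simp add: path_image_def image_image)
  have gu: "g (u t) = p t" if "t \<in> {0..1}" for t using k that by (auto simp: u_def homeomorphism_def path_image_def)
  have seg: "S = closed_segment (u 0) (u 1)"
    using continuous_injective_image_segment_1[of 0 1 u] uc ui uS by (simp add: closed_segment_eq_real_ivl)
  have ne: "u 0 \<noteq> u 1" using ui by (auto dest!: inj_onD)
  have u01: "u 0 \<in> S" "u 1 \<in> S" using uS by auto
  have pos: "t \<in> S \<Longrightarrow> 0 < t \<and> t < 1" for t using S0 by (cases "t = 0"; cases "t = 1") (auto simp: S_def)
  show ?thesis
  proof (cases "u 0 < u 1")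
    case True
    then show ?thesis using seg pos[OF u01(1)] pos[OF u01(2)] gS gu[of 0] gu[of 1]
      by (intro exI[of _ "u 0"] exI[of _ "u 1"]) (auto simp: closed_segment_eq_real_ivl)
  next
    case False
    then show ?thesis using seg pos[OF u01(1)] pos[OF u01(2)] gS gu[of 0] gu[of 1] ne
      by (intro exI[of _ "u 1"] exI[of _ "u 0"]) (auto simp: closed_segment_eq_real_ivl)
  qed
qed

text \<open>Removing an inner point disconnects an arc but not a circle.\<close>

lemma boundary_not_arc:
  assumes D: "closed_disc D" and s: "s homeomorphic {0..1::real}"
  shows "s \<noteq> surface_boundary D"
proof
  assume eq: "s = surface_boundary D"
  obtain f k where fk: "homeomorphism s {0..1::real} f k" using s unfolding homeomorphic_def by blast
  have fs: "f ` s = {0..1}" "continuous_on s f" "inj_on f s" using fk by (auto simp: homeomorphism_def intro!: inj_on_inverseI[of _ k])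
  have "1/2 \<in> f ` s" unfolding fs(1) by simp
  then obtain x where x: "x \<in> s" "f x = 1/2" by (metis imageE)
  then obtain g where g: "simple_loop g s" "g 0 = x" using closed_disc_boundary_loop[OF D] eq by blast
  have gs: "g ` {0<..<1} = s - {x}"
  proof
    show "g ` {0<..<1} \<subseteq> s - {x}" using simple_loop_image[OF g(1)] simple_loop_eqD[OF g(1), of _ 0] g(2) by force
    show "s - {x} \<subseteq> g ` {0<..<1}"
    proof
      fix y assume y: "y \<in> s - {x}"
      then obtain t where t: "t \<in> {0..1}" "g t = y" using simple_loop_image[OF g(1)] by (metis DiffD1 imageE)
      have "t \<noteq> 0" "t \<noteq> 1" using y t g(2) simple_loop_closed[OF g(1)] by auto
      then show "y \<in> g ` {0<..<1}" using t by force
    qed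
  qed
  have "connected (g ` {0<..<1})"
    by (intro connected_continuous_image continuous_on_subset[OF simple_loop_continuous[OF g(1)]]) auto
  then have "connected (f ` (s - {x}))" unfolding gs
    by (intro connected_continuous_image continuous_on_subset[OF fs(2)]) auto
  moreover have "f ` (s - {x}) = {0..1} - {1/2}" using inj_on_image_set_diff[OF fs(3), of s "{x}"] fs(1) x by simp
  ultimately have "connected ({0..1} - {1/2::real})" by simp
  then have "(1/2::real) \<in> {0..1} - {1/2}" 
    by (rule connectedD_interval[of _ 0 1]) auto
  then show False by simp
qed

text \<open>This provides a base point outside all ribbon ends, so that each of them becomes an interval of
times.\<close>

lemma arcs_not_cover_boundary:
  assumes D: "closed_disc D" and fin: "finite \<S>" and disj: "disjoint \<S>"
    and arcs: "\<And>s. s \<in> \<S> \<Longrightarrow> s homeomorphic {0..1::real}"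
  shows "surface_boundary D \<noteq> \<Union>\<S>"
proof
  assume eq: "surface_boundary D = \<Union>\<S>"
  have ne: "s \<noteq> {}" if "s \<in> \<S>" for s using arcs[OF that] homeomorphic_empty(1) by force
  have cl: "closed s" if "s \<in> \<S>" for s using arcs[OF that] homeomorphic_compactness[of s] by (auto intro: compact_imp_closed)
  have "surface_boundary D \<noteq> {}"
  proof -
    obtain f g where fg: "homeomorphism (cball (0::complex) 1) D f g" 
      using D homeomorphic_sym unfolding closed_disc_def homeomorphic_def by blast
    have "(1::complex) \<in> sphere 0 1" by simp
    then show ?thesis unfolding surface_boundary_homeomorphism[OF fg] surface_boundary_cball by blast
  qed
  then obtain x s where s: "s \<in> \<S>" "x \<in> s" and x: "x \<in> surface_boundary D" using eq by blast
  obtain g where g: "simple_loop g (surface_boundary D)" using closed_disc_boundary_loop[OF D x] by blast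
  have conn: "connected (surface_boundary D)" using g connected_path_image[of g] by (auto simp: simple_loop_def simple_path_def)
  show False
  proof (cases "\<S> = {s}")
    case True
    then show False using eq boundary_not_arc[OF D arcs[OF s(1)]] by auto
  next
    case False
    then obtain s' where s': "s' \<in> \<S>" "s' \<noteq> s" using s by blast
    have "closed (\<Union>(\<S> - {s}))" using fin cl by auto
    moreover have "s \<inter> \<Union>(\<S> - {s}) = {}" using disj s(1) unfolding disjoint_def by blast
    moreover have "surface_boundary D \<subseteq> s \<union> \<Union>(\<S> - {s})" using eq by blast
    ultimately have "s \<inter> surface_boundary D = {} \<or> \<Union>(\<S> - {s}) \<inter> surface_boundary D = {}"
      using connected_closedD[OF conn, of s "\<Union>(\<S> - {s})"] cl[OF s(1)] by blast
    then show False using s s' eq ne by blast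
  qed
qed

section \<open>Discs as squares\<close>

text \<open>Both circles are quotients of the unit interval by the identification of its endpoints; the
induced map is continuous because the first loop is a closed map.\<close>

lemma loop_transfer:
  fixes \<rho> :: "real \<Rightarrow> 'a::t2_space" and \<gamma> :: "real \<Rightarrow> 'b::t2_space"
  assumes \<rho>: "simple_loop \<rho> X" and \<gamma>: "simple_loop \<gamma> Y"
  shows "\<exists>f. continuous_on X f \<and> inj_on f X \<and> f ` X = Y \<and> (\<forall>t\<in>{0..1}. f (\<rho> t) = \<gamma> t)"
proof -
  define f where "f x = \<gamma> (SOME t. t \<in> {0..1} \<and> \<rho> t = x)" for x
  have f: "f (\<rho> t) = \<gamma> t" if t: "t \<in> {0..1}" for t
  proof -
    define t' where "t' = (SOME t'. t' \<in> {0..1} \<and> \<rho> t' = \<rho> t)"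
    have "t' \<in> {0..1} \<and> \<rho> t' = \<rho> t" unfolding t'_def by (rule someI[of _ t]) (use t in auto)
    then have "t' = t \<or> t' = 0 \<and> t = 1 \<or> t' = 1 \<and> t = 0" using simple_loop_eqD[OF \<rho>, of t' t] t by auto
    then have "\<gamma> t' = \<gamma> t" using simple_loop_closed[OF \<gamma>] by auto
    then show ?thesis by (simp add: f_def t'_def)
  qed
  have X: "X = \<rho> ` {0..1}" and Y: "Y = \<gamma> ` {0..1}" using simple_loop_image \<rho> \<gamma> by blast+
  have \<rho>c: "continuous_on {0..1} \<rho>" and \<gamma>c: "continuous_on {0..1} \<gamma>" using simple_loop_continuous \<rho> \<gamma> by blast+
  have clX: "closed X" unfolding X using \<rho>c by (intro compact_imp_closed compact_continuous_image) auto
  have "f ` X = Y" unfolding X Y using f by (simp add: image_image)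
  moreover have "inj_on f X"
  proof (rule inj_onI)
    fix x y assume "x \<in> X" "y \<in> X" "f x = f y"
    then obtain s t where st: "x = \<rho> s" "y = \<rho> t" "s \<in> {0..1}" "t \<in> {0..1}" unfolding X by blast
    then have "\<gamma> s = \<gamma> t" using \<open>f x = f y\<close> f by simp
    then have "s = t \<or> s = 0 \<and> t = 1 \<or> s = 1 \<and> t = 0" using simple_loop_eqD[OF \<gamma>, of s t] st by auto
    then show "x = y" using st simple_loop_closed[OF \<rho>] by auto
  qed
  moreover have "continuous_on X f"
    unfolding continuous_on_closed_vimage[OF clX]
  proof (intro allI impI)
    fix B :: "'b set" assume B: "closed B"
    have "f -` B \<inter> X = \<rho> ` ({0..1} \<inter> \<gamma> -` B)" unfolding X using f by auto
    moreover have "closed ({0..1} \<inter> \<gamma> -` B)" using continuous_closed_preimage[OF \<gamma>c _ B] by auto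
    then have "compact ({0..1} \<inter> \<gamma> -` B)" using compact_Int_closed[of "{0..1}" "{0..1} \<inter> \<gamma> -` B"] by (simp add: Int_assoc[symmetric])
    then have "closed (\<rho> ` ({0..1} \<inter> \<gamma> -` B))" by (intro compact_imp_closed compact_continuous_image continuous_on_subset[OF \<rho>c]) auto
    ultimately show "closed (f -` B \<inter> X)" by simp
  qed
  ultimately show ?thesis using f by blast
qed

definition unit_square :: "complex set" where "unit_square = cbox 0 (Complex 1 1)"

lemma mem_unit_square: "z \<in> unit_square \<longleftrightarrow> 0 \<le> Re z \<and> Re z \<le> 1 \<and> 0 \<le> Im z \<and> Im z \<le> 1"
  by (auto simp: unit_square_def in_cbox_complex_iff)

lemma closed_disc_unit_square: "closed_disc unit_square"
proof -
  have "Complex (1/2) (1/2) \<in> interior unit_square" unfolding unit_square_def interior_cbox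
    by (auto simp: in_box_complex_iff)
  then have "interior unit_square \<noteq> {}" by blast
  then show ?thesis unfolding closed_disc_def
    by (intro homeomorphic_convex_compact_cball) (auto simp: unit_square_def)
qed

lemma surface_boundary_unit_square: "surface_boundary unit_square = path_image (rectpath 0 (Complex 1 1))"
  unfolding surface_boundary_planar unit_square_def interior_cbox
  by (subst path_image_rectpath_cbox_minus_box) auto

text \<open>The times at which nested joins run through their four parts.\<close>

lemma join4_eval:
  assumes "a 1 = b 0" "b 1 = c 0" "c 1 = e 0" "0 \<le> x" "x \<le> (1::real)"
  shows "(a +++ b +++ c +++ e) (x / 2) = a x" "(a +++ b +++ c +++ e) (1/2 + x / 4) = b x"
    "(a +++ b +++ c +++ e) (3/4 + x / 8) = c x" "(a +++ b +++ c +++ e) (7/8 + x / 8) = e x"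
proof -
  show "(a +++ b +++ c +++ e) (x / 2) = a x" using assms by (auto simp: joinpaths_def)
  show "(a +++ b +++ c +++ e) (1/2 + x / 4) = b x"
    by (cases "x = 0") (use assms in \<open>auto simp: joinpaths_def field_simps\<close>)
  show "(a +++ b +++ c +++ e) (3/4 + x / 8) = c x"
    by (cases "x = 0") (use assms in \<open>auto simp: joinpaths_def field_simps\<close>)
  show "(a +++ b +++ c +++ e) (7/8 + x / 8) = e x"
    by (cases "x = 0") (use assms in \<open>auto simp: joinpaths_def field_simps\<close>)
qed

text \<open>The boundary of the square and that of the disc are traversed in parallel by two loops that consist
of four arcs each; the resulting homeomorphism between them extends to the interior.\<close>

lemma disc_as_square_based:
  assumes D: "closed_disc D" and g: "simple_loop g (surface_boundary D)"
    and abc: "0 < b" "b < c" "c < d" "d < 1"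
    and p: "arc p" "path_image p = g ` {0..b}" "p 0 = g 0" "p 1 = g b"
    and q: "arc q" "path_image q = g ` {c..d}" "q 0 = g d" "q 1 = g c"
  shows "\<exists>h k. homeomorphism unit_square D h k \<and> (\<forall>x\<in>{0..1}. h (Complex x 0) = p x \<and> h (Complex x 1) = q x)
    \<and> (\<lambda>y. h (Complex 0 y)) ` {0..1} = g ` {d..1} \<and> (\<lambda>y. h (Complex 1 y)) ` {0..1} = g ` {b..c}"
proof -
  define r where "r = segpath g b c"
  define l where "l = segpath g d 1"
  define q' where "q' = reversepath q"
  have r: "arc r" "path_image r = g ` {b..c}" "r 0 = g b" "r 1 = g c"
    using arc_segpath[OF g, of b c] segpath_image[of b c g] abc by (auto simp: r_def path_image_def)
  have l: "arc l" "path_image l = g ` {d..1}" "l 0 = g d" "l 1 = g 0"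
    using arc_segpath[OF g, of d 1] segpath_image[of d 1 g] abc simple_loop_closed[OF g] by (auto simp: l_def path_image_def)
  have q': "arc q'" "path_image q' = g ` {c..d}" "q' 0 = g c" "q' 1 = g d"
    using q by (auto simp: q'_def arc_reversepath) (auto simp: reversepath_def)
  have eq: "g x = g y \<Longrightarrow> 0 \<le> x \<Longrightarrow> x \<le> y \<Longrightarrow> y \<le> 1 \<Longrightarrow> x = y \<or> x = 0 \<and> y = 1" for x y
    using simple_loop_eqD[OF g, of x y] by auto
  have a1: "arc (q' +++ l)"
  proof (rule arc_join)
    show "path_image q' \<inter> path_image l \<subseteq> {pathstart l}"
    proof
      fix z assume "z \<in> path_image q' \<inter> path_image l"
      then obtain x y where "z = g x" "z = g y" "x \<in> {c..d}" "y \<in> {d..1}" unfolding q'(2) l(2) by blast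
      then show "z \<in> {pathstart l}" using eq[of x y] abc l(3) by (auto simp: pathstart_def)
    qed
  qed (use q' l in \<open>auto simp: pathstart_def pathfinish_def\<close>)
  have i1: "path_image (q' +++ l) = g ` {c..1}"
  proof -
    have "{c..1} = {c..d} \<union> {d..1}" using abc by auto
    then show ?thesis using q' l by (simp add: path_image_join pathstart_def pathfinish_def image_Un)
  qed
  have s1: "(q' +++ l) 0 = g c" "(q' +++ l) 1 = g 0" using q' l by (auto simp: joinpaths_def)
  have a2: "arc (r +++ q' +++ l)"
  proof (rule arc_join)
    show "path_image r \<inter> path_image (q' +++ l) \<subseteq> {pathstart (q' +++ l)}"
    proof
      fix z assume "z \<in> path_image r \<inter> path_image (q' +++ l)"
      then obtain x y where "z = g x" "z = g y" "x \<in> {b..c}" "y \<in> {c..1}" unfolding r(2) i1 by blast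
      then show "z \<in> {pathstart (q' +++ l)}" using eq[of x y] abc s1 by (auto simp: pathstart_def)
    qed
  qed (use r s1 a1 in \<open>auto simp: pathstart_def pathfinish_def\<close>)
  have i2: "path_image (r +++ q' +++ l) = g ` {b..1}"
  proof -
    have "{b..1} = {b..c} \<union> {c..1}" using abc by auto
    moreover have "path_image (r +++ q' +++ l) = path_image r \<union> path_image (q' +++ l)"
      by (rule path_image_join) (use r s1 in \<open>auto simp: pathstart_def pathfinish_def\<close>)
    ultimately show ?thesis using r i1 by (simp add: image_Un)
  qed
  have s2: "(r +++ q' +++ l) 0 = g b" "(r +++ q' +++ l) 1 = g 0" using r s1 by (auto simp: joinpaths_def)
  define \<gamma> where "\<gamma> = p +++ r +++ q' +++ l"
  have "simple_path \<gamma>" unfolding \<gamma>_def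
  proof (rule simple_path_join_loop)
    show "path_image p \<inter> path_image (r +++ q' +++ l) \<subseteq> {pathstart p, pathstart (r +++ q' +++ l)}"
    proof
      fix z assume "z \<in> path_image p \<inter> path_image (r +++ q' +++ l)"
      then obtain x y where "z = g x" "z = g y" "x \<in> {0..b}" "y \<in> {b..1}" unfolding p(2) i2 by blast
      then show "z \<in> {pathstart p, pathstart (r +++ q' +++ l)}" using eq[of x y] abc s2 p by (auto simp: pathstart_def)
    qed
  qed (use p s2 a2 in \<open>auto simp: pathstart_def pathfinish_def\<close>)
  moreover have "path_image \<gamma> = surface_boundary D"
  proof -
    have "{0..1} = {0..b} \<union> {b..1}" using abc by auto
    moreover have "path_image \<gamma> = path_image p \<union> path_image (r +++ q' +++ l)" unfolding \<gamma>_def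
      by (rule path_image_join) (use p s2 in \<open>auto simp: pathstart_def pathfinish_def\<close>)
    ultimately show ?thesis using p i2 simple_loop_image[OF g] by (metis image_Un)
  qed
  moreover have "pathfinish \<gamma> = pathstart \<gamma>" using p s2 by (auto simp: \<gamma>_def pathstart_def pathfinish_def joinpaths_def)
  ultimately have \<gamma>: "simple_loop \<gamma> (surface_boundary D)" unfolding simple_loop_def by blast
  \<comment> \<open>Counterclockwise along the square: bottom, right, top backwards, left backwards.\<close>
  define \<rho> where "\<rho> = rectpath 0 (Complex 1 1)"
  have \<rho>: "simple_loop \<rho> (surface_boundary unit_square)" unfolding simple_loop_def surface_boundary_unit_square \<rho>_def
    by simp
  have \<rho>': "\<rho> = linepath 0 (Complex 1 0) +++ linepath (Complex 1 0) (Complex 1 1) +++ linepath (Complex 1 1) (Complex 0 1) +++ linepath (Complex 0 1) 0"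
    unfolding \<rho>_def rectpath_def Let_def by simp
  obtain f where f: "continuous_on (surface_boundary unit_square) f" "inj_on f (surface_boundary unit_square)"
     "f ` surface_boundary unit_square = surface_boundary D" "\<And>t. t \<in> {0..1} \<Longrightarrow> f (\<rho> t) = \<gamma> t"
    using loop_transfer[OF \<rho> \<gamma>] by blast
  obtain h k where h: "homeomorphism unit_square D h k" "\<And>x. x \<in> surface_boundary unit_square \<Longrightarrow> h x = f x"
    using closed_disc_extension[OF closed_disc_unit_square D f(1-3)] by blast
  have hg: "h (\<rho> t) = \<gamma> t" if "t \<in> {0..1}" for t 
  proof -
    have "\<rho> t \<in> surface_boundary unit_square" using simple_loop_image[OF \<rho>] that by blast
    then show ?thesis using f(4)[OF that] h(2) by simp
  qed
  have e\<gamma>: "\<gamma> (x / 2) = p x" "\<gamma> (1/2 + x / 4) = r x" "\<gamma> (3/4 + x / 8) = q' x" "\<gamma> (7/8 + x / 8) = l x" if "0 \<le> x" "x \<le> 1" for x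
    unfolding \<gamma>_def using join4_eval[of p r q' l x] that p r q' l by auto
  have e\<rho>: "\<rho> (x / 2) = Complex x 0" "\<rho> (1/2 + x / 4) = Complex 1 x" "\<rho> (3/4 + x / 8) = Complex (1 - x) 1" "\<rho> (7/8 + x / 8) = Complex 0 (1 - x)"
    if "0 \<le> x" "x \<le> 1" for x
    unfolding \<rho>' using that by (subst join4_eval; (simp add: linepath_def complex_eq_iff)?)+
  have b: "h (Complex x 0) = p x" if "x \<in> {0..1}" for x
    using hg[of "x / 2"] e\<gamma>(1)[of x] e\<rho>(1)[of x] that by auto
  moreover have "h (Complex x 1) = q x" if "x \<in> {0..1}" for x
  proof -
    have "3/4 + (1 - x) / 8 \<in> {0..1}" using that by (simp add: field_simps)
    then show ?thesis
      using hg[of "3/4 + (1 - x) / 8"] e\<gamma>(3)[of "1 - x"] e\<rho>(3)[of "1 - x"] that by (simp add: q'_def reversepath_def)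
  qed
  moreover have "(\<lambda>y. h (Complex 1 y)) ` {0..1} = g ` {b..c}"
  proof -
    have "h (Complex 1 y) = r y" if "y \<in> {0..1}" for y
      using hg[of "1/2 + y / 4"] e\<gamma>(2)[of y] e\<rho>(2)[of y] that by auto
    then show ?thesis using r(2) unfolding path_image_def by (metis (no_types, lifting) image_cong)
  qed
  moreover have "(\<lambda>y. h (Complex 0 y)) ` {0..1} = g ` {d..1}"
  proof -
    have "h (Complex 0 y) = l (1 - y)" if "y \<in> {0..1}" for y
    proof -
      have "7/8 + (1 - y) / 8 \<in> {0..1}" using that by (simp add: field_simps)
      then show ?thesis using hg[of "7/8 + (1 - y) / 8"] e\<gamma>(4)[of "1 - y"] e\<rho>(4)[of "1 - y"] that by simp
    qed
    then have "(\<lambda>y. h (Complex 0 y)) ` {0..1} = (\<lambda>y. l (1 - y)) ` {0..1}" by (rule image_cong[OF refl])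
    also have "\<dots> = path_image (reversepath l)" by (simp add: path_image_def reversepath_def)
    finally show ?thesis using l(2) by simp
  qed
  ultimately show ?thesis using h(1) by blast
qed

text \<open>The reduction to the previous lemma moves the base point of the loop to the beginning of the first
arc. Both arcs are traversed from the left side of the square to its right side, hence the second
one against the direction of the loop.\<close>

lemma disc_as_square:
  assumes D: "closed_disc D" and g: "simple_loop g (surface_boundary D)"
    and abcd: "0 < a" "a < b" "b < c" "c < d" "d < 1"
    and p: "arc p" "path_image p = g ` {a..b}" "p 0 = g a" "p 1 = g b"
    and q: "arc q" "path_image q = g ` {c..d}" "q 0 = g d" "q 1 = g c"
  shows "\<exists>h k. homeomorphism unit_square D h k \<and> (\<forall>x\<in>{0..1}. h (Complex x 0) = p x \<and> h (Complex x 1) = q x)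
    \<and> (\<lambda>y. h (Complex 0 y)) ` {0..1} = g ` ({0..a} \<union> {d..1}) \<and> (\<lambda>y. h (Complex 1 y)) ` {0..1} = g ` {b..c}"
proof -
  \<comment> \<open>Now \<open>G\<close> meets the first arc during \<open>[0, b - a]\<close> and the second one during \<open>[c - a, d - a]\<close>.\<close>
  define G where "G = shiftpath a g"
  have G: "simple_loop G (surface_boundary D)" unfolding G_def by (rule simple_loop_shiftpath[OF g]) (use abcd in auto)
  have G1: "G t = g (a + t)" if "t \<le> 1 - a" for t using that by (auto simp: G_def shiftpath_def)
  have G2: "G t = g (a + t - 1)" if "t > 1 - a" for t using that by (auto simp: G_def shiftpath_def)
  have Gim: "G ` {u..v} = g ` {a + u..a + v}" if "v \<le> 1 - a" for u v
  proof -
    have "G ` {u..v} = (\<lambda>t. g (a + t)) ` {u..v}" by (rule image_cong[OF refl]) (use G1 that in auto)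
    also have "\<dots> = g ` (\<lambda>t. a + t) ` {u..v}" by (simp only: image_image)
    also have "(\<lambda>t. a + t) ` {u..v} = {a + u..a + v}" by (simp add: add.commute)
    finally show ?thesis .
  qed
  have last: "G ` {d - a..1} = g ` ({0..a} \<union> {d..1})"
  proof -
    have "{d - a..1} = {d - a..1 - a} \<union> {1 - a<..1}" using abcd by auto
    moreover have "G ` {1 - a<..1} = g ` {0<..a}"
    proof -
      have "G ` {1 - a<..1} = (\<lambda>t. g (a + t - 1)) ` {1 - a<..1}" by (rule image_cong[OF refl]) (use G2 in auto)
      also have "\<dots> = g ` (\<lambda>t. t + (a - 1)) ` {1 - a<..1}" by (simp add: image_image algebra_simps)
      also have "(\<lambda>t. t + (a - 1)) ` {1 - a<..1} = {0<..a}"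
      proof (intro equalityI subsetI)
        fix x :: real assume "x \<in> {0<..a}"
        then show "x \<in> (\<lambda>t. t + (a - 1)) ` {1 - a<..1}" by (intro image_eqI[of _ _ "x + 1 - a"]) auto
      qed auto
      finally show ?thesis .
    qed
    moreover have "G ` {d - a..1 - a} = g ` {d..1}" using Gim[of "1 - a" "d - a"] by simp
    ultimately have "G ` {d - a..1} = g ` {d..1} \<union> g ` {0<..a}" by (simp add: image_Un)
    also have "\<dots> = g ` {d..1} \<union> g ` {0..a}"
    proof -
      have "{0..a} = insert 0 {0<..a}" using abcd by auto
      moreover have "g 0 \<in> g ` {d..1}" using simple_loop_closed[OF g] abcd by (metis atLeastAtMost_iff image_eqI less_imp_le order_refl)
      ultimately show ?thesis by auto
    qed
    finally show ?thesis by blast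
  qed
  show ?thesis
    using disc_as_square_based[OF D G, of "b - a" "c - a" "d - a" p q] abcd p q last
      Gim[of "b - a" 0] Gim[of "c - a" "b - a"] Gim[of "d - a" "c - a"] G1[of 0] G1[of "b - a"] G1[of "c - a"] G1[of "d - a"]
    by simp
qed

lemma arc_homeomorphic_interval:
  fixes p :: "real \<Rightarrow> 'a::t2_space"
  assumes "arc p" shows "path_image p homeomorphic {0..1::real}"
  using homeomorphism_compact[of "{0..1}" p "path_image p"] assms
  unfolding arc_def path_def path_image_def by (metis compact_Icc homeomorphic_def homeomorphic_sym)

lemma homeomorphic_interval_arc:
  fixes s :: "'a::t2_space set"
  assumes "s homeomorphic {0..1::real}" shows "\<exists>p. arc p \<and> path_image p = s"
proof -
  obtain p k where "homeomorphism {0..1::real} s p k" using assms homeomorphic_sym unfolding homeomorphic_def by blast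
  then show ?thesis unfolding arc_def path_def path_image_def homeomorphism_def
    by (metis inj_on_inverseI)
qed

definition hflip :: "complex \<Rightarrow> complex" where "hflip z = Complex (1 - Re z) (Im z)"

lemma homeomorphism_hflip: "homeomorphism unit_square unit_square hflip hflip"
proof -
  have "continuous_on unit_square hflip"
    unfolding hflip_def Complex_eq by (intro continuous_intros)
  moreover have "hflip (hflip z) = z" for z by (simp add: hflip_def)
  moreover have "hflip z \<in> unit_square" if "z \<in> unit_square" for z using that by (auto simp: hflip_def mem_unit_square)
  ultimately show ?thesis by (intro homeomorphismI) auto
qed

lemma square_hflip:
  assumes "homeomorphism unit_square D h k"
  shows "homeomorphism unit_square D (h \<circ> hflip) (hflip \<circ> k)"
  using homeomorphism_compose[OF homeomorphism_hflip assms] .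

lemma disc_as_square_ordered:
  assumes D: "closed_disc D" and g: "simple_loop g (surface_boundary D)"
    and abcd: "0 < a" "a < b" "b < c" "c < d" "d < 1"
    and p: "arc p" "path_image p = g ` {a..b}" "p 0 = g a \<and> p 1 = g b \<or> p 0 = g b \<and> p 1 = g a"
    and q: "arc q" "path_image q = g ` {c..d}" "q 0 = g c \<and> q 1 = g d \<or> q 0 = g d \<and> q 1 = g c"
  shows "\<exists>h k. homeomorphism unit_square D h k \<and> (\<forall>x\<in>{0..1}. h (Complex x 0) = p x)
    \<and> ((\<forall>x\<in>{0..1}. h (Complex x 1) = q x) \<or> (\<forall>x\<in>{0..1}. h (Complex x 1) = q (1 - x)))"
proof -
  obtain p' where p': "arc p'" "path_image p' = g ` {a..b}" "p' 0 = g a" "p' 1 = g b" "p' = p \<or> p' = reversepath p"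
    using p by (metis arc_reversepath diff_0_right diff_self path_image_reversepath reversepath_def)
  obtain q' where q': "arc q'" "path_image q' = g ` {c..d}" "q' 0 = g d" "q' 1 = g c" "q' = q \<or> q' = reversepath q"
    using q by (metis arc_reversepath diff_0_right diff_self path_image_reversepath reversepath_def)
  obtain h k where h: "homeomorphism unit_square D h k"
      "\<forall>x\<in>{0..1}. h (Complex x 0) = p' x \<and> h (Complex x 1) = q' x"
    using disc_as_square[OF D g abcd p'(1-4) q'(1-4)] by (elim exE conjE) (rule that)
  have qq: "(\<forall>x\<in>{0..1}. q' x = q x) \<or> (\<forall>x\<in>{0..1}. q' x = q (1 - x))"
    using q'(5) by (auto simp: reversepath_def)
  show ?thesis
  proof (cases "p' = p")
    case True
    then have "\<forall>x\<in>{0..1}. h (Complex x 0) = p x" using h(2) by blast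
    moreover have "(\<forall>x\<in>{0..1}. h (Complex x 1) = q x) \<or> (\<forall>x\<in>{0..1}. h (Complex x 1) = q (1 - x))"
      using h(2) qq by metis
    ultimately show ?thesis using h(1) by blast
  next
    case False
    then have "p' = reversepath p" using p'(5) by blast
    then show ?thesis using h(2) q'(5) square_hflip[OF h(1)]
      by (intro exI[of _ "h \<circ> hflip"] exI[of _ "hflip \<circ> k"]) (auto simp: hflip_def reversepath_def)
  qed
qed

text \<open>The direction of the second arc cannot be prescribed: it depends on the orientation that the disc
induces on the two arcs. For a ribbon this alternative is the difference between twisted and
untwisted loops.\<close>

lemma disc_as_square_two_arcs:
  assumes D: "closed_disc D"
    and p: "arc p" "path_image p \<subseteq> surface_boundary D" and q: "arc q" "path_image q \<subseteq> surface_boundary D"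
    and disj: "path_image p \<inter> path_image q = {}"
  shows "\<exists>h k. homeomorphism unit_square D h k \<and> (\<forall>x\<in>{0..1}. h (Complex x 0) = p x)
    \<and> ((\<forall>x\<in>{0..1}. h (Complex x 1) = q x) \<or> (\<forall>x\<in>{0..1}. h (Complex x 1) = q (1 - x)))"
proof -
  have "surface_boundary D \<noteq> \<Union>{path_image p, path_image q}"
    by (rule arcs_not_cover_boundary[OF D]) (use disj arc_homeomorphic_interval p q in \<open>auto simp: disjoint_def\<close>)
  then obtain x where x: "x \<in> surface_boundary D" "x \<notin> path_image p" "x \<notin> path_image q" using p q by auto
  obtain g where g: "simple_loop g (surface_boundary D)" "g 0 = x" using closed_disc_boundary_loop[OF D x(1)] by blast
  obtain a b where ab: "0 < a" "a < b" "b < 1" "path_image p = g ` {a..b}" "p 0 = g a \<and> p 1 = g b \<or> p 0 = g b \<and> p 1 = g a"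
    using arc_in_loop[OF g(1) p] x g by blast
  obtain c d where cd: "0 < c" "c < d" "d < 1" "path_image q = g ` {c..d}" "q 0 = g c \<and> q 1 = g d \<or> q 0 = g d \<and> q 1 = g c"
    using arc_in_loop[OF g(1) q] x g by blast
  have "b < c \<or> d < a"
  proof (rule ccontr)
    assume "\<not> ?thesis"
    then have "max a c \<in> {a..b}" "max a c \<in> {c..d}" using ab cd by auto
    then show False using disj ab(4) cd(4) by blast
  qed
  then show ?thesis
  proof
    assume "b < c"
    then show ?thesis using disc_as_square_ordered[OF D g(1) ab(1,2) _ cd(2,3) p(1) ab(4,5) q(1) cd(4,5)] by blast
  next
    assume da: "d < a"
    \<comment> \<open>Reversing the loop exchanges the order in which it meets the two arcs.\<close>
    define g' where "g' = reversepath g"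
    have g': "simple_loop g' (surface_boundary D)" unfolding g'_def by (rule simple_loop_reversepath[OF g(1)])
    have im: "g' ` {1 - v..1 - u} = g ` {u..v}" for u v
    proof -
      have "g' ` {1 - v..1 - u} = g ` (\<lambda>x. 1 - x) ` {1 - v..1 - u}" by (simp only: g'_def reversepath_def image_image)
      moreover have "(\<lambda>x. 1 - x) ` {1 - v..1 - u} = {u..v}" by simp
      ultimately show ?thesis by simp
    qed
    have e: "g' (1 - t) = g t" for t by (simp add: g'_def reversepath_def)
    show ?thesis
      by (rule disc_as_square_ordered[OF D g', of "1 - b" "1 - a" "1 - d" "1 - c"])
        (use ab cd da p(1) q(1) im e in auto)
  qed
qed

text \<open>An auxiliary second arc is chosen in the rest of the circle.\<close>

lemma disc_as_square_one_arc:
  assumes D: "closed_disc D"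
    and p: "arc p" "path_image p \<subseteq> surface_boundary D"
  shows "\<exists>h k. homeomorphism unit_square D h k \<and> (\<forall>x\<in>{0..1}. h (Complex x 0) = p x)"
proof -
  have "surface_boundary D \<noteq> \<Union>{path_image p}"
    by (rule arcs_not_cover_boundary[OF D]) (use arc_homeomorphic_interval p in \<open>auto simp: disjoint_def\<close>)
  then obtain x where x: "x \<in> surface_boundary D" "x \<notin> path_image p" using p by auto
  obtain g where g: "simple_loop g (surface_boundary D)" "g 0 = x" using closed_disc_boundary_loop[OF D x(1)] by blast
  obtain a b where ab: "0 < a" "a < b" "b < 1" "path_image p = g ` {a..b}"
    using arc_in_loop[OF g(1) p] x g by blast
  define c where "c = (b + 1) / 2"
  define d where "d = (c + 1) / 2"
  have cd: "b < c" "c < d" "d < 1" using ab by (auto simp: c_def d_def)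
  define q where "q = segpath g c d"
  have q: "arc q" "path_image q = g ` {c..d}"
    using arc_segpath[OF g(1), of c d] segpath_image[of c d g] ab cd by (auto simp: q_def path_image_def)
  have "path_image p \<inter> path_image q = {}"
  proof -
    have "g u \<noteq> g v" if "u \<in> {a..b}" "v \<in> {c..d}" for u v
      using simple_loop_eqD[OF g(1), of u v] that ab cd by auto
    then show ?thesis unfolding ab(4) q(2) by blast
  qed
  moreover have "path_image q \<subseteq> surface_boundary D" unfolding q(2) simple_loop_image[OF g(1), symmetric] using ab cd by auto
  ultimately show ?thesis using disc_as_square_two_arcs[OF D p q(1)] by blast
qed

section \<open>Gluing two discs along an arc\<close>

text \<open>Both discs become squares whose common arc is one edge, one above and one below the real axis; so
their union is a rectangle, in which the common arc is the middle segment.\<close>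

lemma glue_discs:
  fixes A B :: "'a::t2_space set"
  assumes A: "closed_disc A" and B: "closed_disc B" and p: "arc p" and AB: "A \<inter> B = path_image p"
    and sub: "path_image p \<subseteq> surface_boundary A" "path_image p \<subseteq> surface_boundary B"
  shows "closed_disc (A \<union> B)" "\<And>t. t \<in> {0..1} \<Longrightarrow> p t \<in> surface_boundary (A \<union> B) \<longleftrightarrow> t = 0 \<or> t = 1"
proof -
  obtain f f' where f: "homeomorphism unit_square A f f'" "\<And>x. x \<in> {0..1} \<Longrightarrow> f (Complex x 0) = p x"
    using disc_as_square_one_arc[OF A p sub(1)] by blast
  obtain g g' where g: "homeomorphism unit_square B g g'" "\<And>x. x \<in> {0..1} \<Longrightarrow> g (Complex x 0) = p x"
    using disc_as_square_one_arc[OF B p sub(2)] by blast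
  define K where "K = cbox (Complex 0 (-1)) (Complex 1 1)"
  define L where "L = cbox (Complex 0 (-1)) (Complex 1 0)"
  have memK: "z \<in> K \<longleftrightarrow> 0 \<le> Re z \<and> Re z \<le> 1 \<and> -1 \<le> Im z \<and> Im z \<le> 1" for z by (auto simp: K_def in_cbox_complex_iff)
  have memL: "z \<in> L \<longleftrightarrow> 0 \<le> Re z \<and> Re z \<le> 1 \<and> -1 \<le> Im z \<and> Im z \<le> 0" for z by (auto simp: L_def in_cbox_complex_iff)
  have KL: "K = unit_square \<union> L" by (auto simp: memK memL mem_unit_square)
  have cL: "cnj z \<in> unit_square \<longleftrightarrow> z \<in> L" for z by (auto simp: memL mem_unit_square)
  define H where "H z = (if 0 \<le> Im z then f z else g (cnj z))" for z
  have fA: "f ` unit_square = A" "continuous_on unit_square f" "\<And>x. x \<in> unit_square \<Longrightarrow> f' (f x) = x" 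
    using f(1) by (auto simp: homeomorphism_def)
  have gB: "g ` unit_square = B" "continuous_on unit_square g" "\<And>x. x \<in> unit_square \<Longrightarrow> g' (g x) = x" 
    using g(1) by (auto simp: homeomorphism_def)
  have bd: "f z = p (Re z)" "g (cnj z) = p (Re z)" if "z \<in> K" "Im z = 0" for z
  proof -
    have "z = Complex (Re z) 0" "cnj z = Complex (Re z) 0" using that by (auto simp: complex_eq_iff)
    then show "f z = p (Re z)" "g (cnj z) = p (Re z)" using f(2)[of "Re z"] g(2)[of "Re z"] that memK[of z] by auto
  qed
  have Hc: "continuous_on K H" unfolding KL H_def
  proof (rule continuous_on_cases)
    show "continuous_on L (\<lambda>z. g (cnj z))"
      by (rule continuous_on_compose2[OF gB(2)]) (auto simp: cL intro!: continuous_intros)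
    show "\<forall>z. z \<in> unit_square \<and> \<not> 0 \<le> Im z \<or> z \<in> L \<and> 0 \<le> Im z \<longrightarrow> f z = g (cnj z)"
    proof (intro allI impI)
      fix z assume "z \<in> unit_square \<and> \<not> 0 \<le> Im z \<or> z \<in> L \<and> 0 \<le> Im z"
      then have "z \<in> K" "Im z = 0" by (auto simp: mem_unit_square memL memK)
      then show "f z = g (cnj z)" using bd by metis
    qed
  qed (use fA in \<open>auto simp: unit_square_def L_def\<close>)
  have lem: "False" if zw: "z \<in> unit_square" "w \<in> L" "Im w < 0" "f z = g (cnj w)" for z w
  proof -
    have "f z \<in> A" "g (cnj w) \<in> B" using zw cL fA(1) gB(1) by blast+
    then have "g (cnj w) \<in> path_image p" using zw(4) AB by auto
    then obtain t where t: "t \<in> {0..1}" "g (cnj w) = p t" unfolding path_image_def by blast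
    then have "g (cnj w) = g (Complex t 0)" using g(2) by simp
    moreover have "Complex t 0 \<in> unit_square" using t by (auto simp: mem_unit_square)
    ultimately have "cnj w = Complex t 0" using gB(3) zw(2) cL by metis
    then have "Im w = 0" by (metis complex.sel(2) complex_cnj_cnj cnj.sel(2) neg_0_equal_iff_equal)
    then show False using zw by simp
  qed
  have Hi: "inj_on H K"
  proof (rule inj_onI)
    fix z w assume zw: "z \<in> K" "w \<in> K" "H z = H w"
    have u: "x \<in> unit_square" if "x \<in> K" "0 \<le> Im x" for x using that by (auto simp: memK mem_unit_square)
    have l: "x \<in> L" if "x \<in> K" "\<not> 0 \<le> Im x" for x using that by (auto simp: memK memL)
    show "z = w"
    proof (cases "0 \<le> Im z"; cases "0 \<le> Im w")
      assume "0 \<le> Im z" "0 \<le> Im w"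
      then show ?thesis using zw u fA(3) unfolding H_def by metis
    next
      assume *: "0 \<le> Im z" "\<not> 0 \<le> Im w"
      then show ?thesis using lem[of z w] zw u l by (auto simp: H_def)
    next
      assume *: "\<not> 0 \<le> Im z" "0 \<le> Im w"
      then show ?thesis using lem[of w z] zw u l by (auto simp: H_def)
    next
      assume *: "\<not> 0 \<le> Im z" "\<not> 0 \<le> Im w"
      then have "g (cnj z) = g (cnj w)" using zw by (simp add: H_def)
      then have "cnj z = cnj w" using gB(3) cL l zw * by metis
      then show ?thesis by simp
    qed
  qed
  have HK: "H ` K = A \<union> B"
  proof -
    have "H ` unit_square = A" unfolding fA(1)[symmetric] by (rule image_cong) (auto simp: H_def mem_unit_square)
    moreover have "H ` L = B"
    proof -
      have "H ` L = (\<lambda>z. g (cnj z)) ` L" 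
        by (rule image_cong[OF refl]) (use bd memL memK in \<open>force simp: H_def\<close>)
      also have "\<dots> = g ` cnj ` L" by (simp add: image_image)
      also have "cnj ` L = unit_square" 
      proof (intro equalityI subsetI)
        fix z assume "z \<in> unit_square"
        then show "z \<in> cnj ` L" using cL[of "cnj z"] by (intro image_eqI[of _ _ "cnj z"]) auto
      qed (use cL in auto)
      finally show ?thesis using gB by simp
    qed
    ultimately show ?thesis unfolding KL image_Un by simp
  qed
  have "compact K" by (simp add: K_def)
  then obtain H' where H: "homeomorphism K (A \<union> B) H H'" using homeomorphism_compact[OF _ Hc HK Hi] by blast
  have "Complex (1/2) 0 \<in> interior K" unfolding K_def interior_cbox by (auto simp: in_box_complex_iff)
  then have "interior K \<noteq> {}" by blast
  then have "closed_disc K" unfolding closed_disc_def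
    by (intro homeomorphic_convex_compact_cball) (auto simp: K_def)
  then show "closed_disc (A \<union> B)" using closed_disc_homeomorphic H homeomorphic_def by blast
  fix t :: real assume t: "t \<in> {0..1}"
  have "H (Complex t 0) = p t" using f(2)[OF t] by (simp add: H_def)
  moreover have tK: "Complex t 0 \<in> K" using t by (simp add: memK)
  ultimately have "p t \<in> surface_boundary (A \<union> B) \<longleftrightarrow> Complex t 0 \<in> surface_boundary K"
    unfolding surface_boundary_homeomorphism[OF H] 
    using inj_on_image_mem_iff[OF Hi tK surface_boundary_subset] by simp
  also have "\<dots> \<longleftrightarrow> t = 0 \<or> t = 1"
    using t tK by (auto simp: surface_boundary_planar K_def interior_cbox in_box_complex_iff)
  finally show "p t \<in> surface_boundary (A \<union> B) \<longleftrightarrow> t = 0 \<or> t = 1" .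
qed

text \<open>Near the arc \<open>p\<close> the closed set \<open>F\<close> is invisible, so that the situation is that of two
discs glued along one arc. For a ribbon, \<open>e\<close> will be the half of it next to the end \<open>p\<close>
and \<open>F\<close> will contain the other half.\<close>

lemma attached_end_boundary:
  fixes v e F :: "'a::t2_space set"
  assumes "closed_disc v" "closed_disc e" "arc p" "v \<inter> e = path_image p"
    "path_image p \<subseteq> surface_boundary v" "path_image p \<subseteq> surface_boundary e"
    and F: "closed F" "path_image p \<inter> F = {}" and t: "t \<in> {0..1}"
  shows "p t \<in> surface_boundary (v \<union> e \<union> F) \<longleftrightarrow> t = 0 \<or> t = 1"
proof -
  define W where "W = (v \<union> e) - F"
  have "openin (top_of_set (v \<union> e \<union> F)) W"
    unfolding openin_open using F by (intro exI[of _ "- F"]) (auto simp: W_def)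
  moreover have "openin (top_of_set (v \<union> e)) W"
    unfolding openin_open using F by (intro exI[of _ "- F"]) (auto simp: W_def)
  moreover have "p t \<in> path_image p" using t by (auto simp: path_image_def)
  then have "p t \<in> W" using assms(4) F(2) unfolding W_def by blast
  ultimately have "p t \<in> surface_boundary (v \<union> e \<union> F) \<longleftrightarrow> p t \<in> surface_boundary (v \<union> e)"
    by (rule surface_boundary_local)
  then show ?thesis using glue_discs(2)[OF assms(1-6) t] by simp
qed

lemma surface_boundary_away:
  assumes "closed F" "x \<in> X" "x \<notin> F"
  shows "x \<in> surface_boundary (X \<union> F) \<longleftrightarrow> x \<in> surface_boundary X"
proof (rule surface_boundary_local)
  show "openin (top_of_set (X \<union> F)) (X - F)" unfolding openin_open using assms by (intro exI[of _ "- F"]) auto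
  show "openin (top_of_set X) (X - F)" unfolding openin_open using assms by (intro exI[of _ "- F"]) auto
qed (use assms in auto)

lemma mem_boundary_unit_square:
  "z \<in> surface_boundary unit_square \<longleftrightarrow> z \<in> unit_square \<and> (Re z = 0 \<or> Re z = 1 \<or> Im z = 0 \<or> Im z = 1)"
  unfolding surface_boundary_planar by (auto simp: unit_square_def interior_cbox in_cbox_complex_iff in_box_complex_iff)

section \<open>A disc with ribbons\<close>

lemma half_square:
  assumes "lo < (hi::real)"
  shows "closed_disc (cbox (Complex 0 lo) (Complex 1 hi))"
    "t \<in> {0..1} \<Longrightarrow> Complex t lo \<in> surface_boundary (cbox (Complex 0 lo) (Complex 1 hi))"
    "t \<in> {0..1} \<Longrightarrow> Complex t hi \<in> surface_boundary (cbox (Complex 0 lo) (Complex 1 hi))"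
proof -
  have "Complex (1/2) ((lo + hi) / 2) \<in> interior (cbox (Complex 0 lo) (Complex 1 hi))" 
    using assms unfolding interior_cbox by (auto simp: in_box_complex_iff)
  then have "interior (cbox (Complex 0 lo) (Complex 1 hi)) \<noteq> {}" by blast
  then show "closed_disc (cbox (Complex 0 lo) (Complex 1 hi))" unfolding closed_disc_def
    by (intro homeomorphic_convex_compact_cball) auto
qed (use assms in \<open>auto simp: surface_boundary_planar interior_cbox in_cbox_complex_iff in_box_complex_iff\<close>)

lemma segpath_rev: "segpath g v u x = segpath g u v (1 - x)"
  by (simp add: segpath_def algebra_simps)

lemma segpath_rev_image: "segpath g v u ` {0..1} = segpath g u v ` {0..1}"
proof -
  have "segpath g v u ` {0..1} = segpath g u v ` (\<lambda>x. 1 - x) ` {0..1}" 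
    unfolding image_image by (rule image_cong[OF refl segpath_rev])
  then show ?thesis by simp
qed

text \<open>The vertex-disc \<open>v\<close> has the boundary loop \<open>g\<close>, and the ribbon \<open>e\<close> is attached
along the two arcs that \<open>g\<close> traverses during \<open>[a e, b e]\<close> and \<open>[c e, d e]\<close>. The
homeomorphism \<open>h e\<close> from the square to \<open>e\<close>, with inverse \<open>k e\<close>, sends the bottom and
the top edge to these arcs. The bottom edge follows the direction of \<open>g\<close>; the top edge does so
if and only if \<open>tw e\<close> holds, which turns out to mean that the loop is twisted.\<close>

locale ribboned_disc =
  fixes v :: "'a::t2_space set" and R :: "'a set set" and g :: "real \<Rightarrow> 'a"
    and a b c d :: "'a set \<Rightarrow> real" and h :: "'a set \<Rightarrow> complex \<Rightarrow> 'a" and k :: "'a set \<Rightarrow> 'a \<Rightarrow> complex"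
    and tw :: "'a set \<Rightarrow> bool"
  assumes disc: "closed_disc v" and loop: "simple_loop g (surface_boundary v)"
    and finR: "finite R" and disjR: "disjoint R"
    and order: "e \<in> R \<Longrightarrow> 0 < a e \<and> a e < b e \<and> b e < c e \<and> c e < d e \<and> d e < 1"
    and hom: "e \<in> R \<Longrightarrow> homeomorphism unit_square e (h e) (k e)"
    and attach: "e \<in> R \<Longrightarrow> v \<inter> e = g ` {a e..b e} \<union> g ` {c e..d e}"
    and bottom: "e \<in> R \<Longrightarrow> x \<in> {0..1} \<Longrightarrow> h e (Complex x 0) = segpath g (a e) (b e) x"
    and top: "e \<in> R \<Longrightarrow> x \<in> {0..1} \<Longrightarrow>
      h e (Complex x 1) = (if tw e then segpath g (c e) (d e) x else segpath g (d e) (c e) x)"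
begin

definition Surf :: "'a set" where "Surf = v \<union> \<Union>R"

text \<open>The times at which \<open>g\<close> is not in the interior of a ribbon end.\<close>

definition gaps :: "real set" where
  "gaps = {t \<in> {0..1}. \<forall>e\<in>R. \<not> (a e < t \<and> t < b e) \<and> \<not> (c e < t \<and> t < d e)}"

text \<open>The left (\<open>x = 0\<close>) and the right (\<open>x = 1\<close>) side of the ribbon.\<close>

definition side :: "'a set \<Rightarrow> real \<Rightarrow> 'a set" where
  "side e x = (\<lambda>y. h e (Complex x y)) ` {0..1}"

lemma g_eqD: "g x = g y \<Longrightarrow> 0 \<le> x \<Longrightarrow> x \<le> 1 \<Longrightarrow> 0 < y \<Longrightarrow> y < 1 \<Longrightarrow> x = y"
  using simple_loop_eqD[OF loop, of x y] by auto

lemma h_eqD: "e \<in> R \<Longrightarrow> h e z = h e w \<Longrightarrow> z \<in> unit_square \<Longrightarrow> w \<in> unit_square \<Longrightarrow> z = w"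
  using hom[of e] unfolding homeomorphism_def by metis

lemma h_image: "e \<in> R \<Longrightarrow> h e ` unit_square = e"
  using hom[of e] by (simp add: homeomorphism_def)

lemma h_cont: "e \<in> R \<Longrightarrow> continuous_on unit_square (h e)"
  using hom[of e] by (simp add: homeomorphism_def)

lemma disc_ribbon: "e \<in> R \<Longrightarrow> closed_disc e"
  using hom closed_disc_homeomorphic closed_disc_unit_square homeomorphic_def by blast

lemma ribbons_disjoint: "e \<in> R \<Longrightarrow> f \<in> R \<Longrightarrow> e \<noteq> f \<Longrightarrow> e \<inter> f = {}"
  using disjR unfolding disjoint_def by blast

lemma closed_ribbons: "S \<subseteq> R \<Longrightarrow> closed (\<Union>S)"
  using finR disc_ribbon closed_disc_closed by (meson closed_Union finite_subset subsetD)

lemma bottom_image: "e \<in> R \<Longrightarrow> (\<lambda>x. h e (Complex x 0)) ` {0..1} = g ` {a e..b e}"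
  using segpath_image[of "a e" "b e" g] order[of e] bottom[of e] by (metis (no_types, lifting) image_cong less_imp_le)

lemma top_image: "e \<in> R \<Longrightarrow> (\<lambda>x. h e (Complex x 1)) ` {0..1} = g ` {c e..d e}"
proof -
  assume e: "e \<in> R"
  have "(\<lambda>x. h e (Complex x 1)) ` {0..1} = (\<lambda>x. if tw e then segpath g (c e) (d e) x else segpath g (d e) (c e) x) ` {0..1}"
    by (rule image_cong[OF refl top[OF e]])
  also have "\<dots> = segpath g (c e) (d e) ` {0..1}" using segpath_rev_image[of g "d e" "c e"] by simp
  finally show ?thesis using segpath_image[of "c e" "d e" g] order[OF e] by simp
qed

lemma h_mem_v: "e \<in> R \<Longrightarrow> w \<in> unit_square \<Longrightarrow> h e w \<in> v \<longleftrightarrow> Im w = 0 \<or> Im w = 1"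
proof
  assume e: "e \<in> R" and w: "w \<in> unit_square"
  { assume "h e w \<in> v"
    then have "h e w \<in> v \<inter> e" using h_image[OF e] w by blast
    then have "h e w \<in> (\<lambda>x. h e (Complex x 0)) ` {0..1} \<or> h e w \<in> (\<lambda>x. h e (Complex x 1)) ` {0..1}"
      using attach[OF e] bottom_image[OF e] top_image[OF e] by auto
    then obtain x where x: "x \<in> {0..1}" "h e w = h e (Complex x 0) \<or> h e w = h e (Complex x 1)" by blast
    then have "w = Complex x 0 \<or> w = Complex x 1" using h_eqD[OF e _ w, of "Complex x 0"] h_eqD[OF e _ w, of "Complex x 1"]
      by (auto simp: mem_unit_square)
    then show "Im w = 0 \<or> Im w = 1" by auto }
  assume "Im w = 0 \<or> Im w = 1"
  then have "h e w = h e (Complex (Re w) 0) \<or> h e w = h e (Complex (Re w) 1)" by (metis complex.collapse)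
  moreover have "Re w \<in> {0..1}" using w by (auto simp: mem_unit_square)
  ultimately have "h e w \<in> (\<lambda>x. h e (Complex x 0)) ` {0..1} \<or> h e w \<in> (\<lambda>x. h e (Complex x 1)) ` {0..1}"
    by blast
  then show "h e w \<in> v" using attach[OF e] bottom_image[OF e] top_image[OF e] by auto
qed

lemma corners:
  assumes "e \<in> R"
  shows "h e (Complex 0 0) = g (a e)" "h e (Complex 1 0) = g (b e)"
    "h e (Complex 0 1) = (if tw e then g (c e) else g (d e))"
    "h e (Complex 1 1) = (if tw e then g (d e) else g (c e))"
  using bottom[OF assms, of 0] bottom[OF assms, of 1] top[OF assms, of 0] top[OF assms, of 1] by auto

text \<open>Only the two endpoints of a ribbon end remain on the boundary of the surface: cut the ribbon into
halves and apply \<open>attached_end_boundary\<close> to the half next to the end.\<close>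

lemma end_boundary:
  assumes e: "e \<in> R" and t: "t \<in> {0..1}" and s: "s = 0 \<or> s = 1"
  shows "h e (Complex t s) \<in> surface_boundary Surf \<longleftrightarrow> t = 0 \<or> t = 1"
proof -
  define p where "p x = h e (Complex x s)" for x
  \<comment> \<open>The halves of the square, with the edge in question on \<open>K\<close>.\<close>
  have "\<exists>K L. K \<union> L = unit_square \<and> closed_disc K \<and> closed L \<and> (\<forall>t\<in>{0..1}. Complex t s \<in> surface_boundary K \<and> Complex t s \<notin> L)
     \<and> (\<forall>w\<in>K. (Im w = 0 \<or> Im w = 1) \<longrightarrow> Im w = s)"
  proof (cases "s = 0")
    case True
    then show ?thesis using half_square[of 0 "1/2"]
      by (intro exI[of _ "cbox (Complex 0 0) (Complex 1 (1/2))"] exI[of _ "cbox (Complex 0 (1/2)) (Complex 1 1)"])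
        (auto simp: unit_square_def in_cbox_complex_iff complex_eq_iff)
  next
    case False
    then show ?thesis using half_square[of "1/2" 1] s
      by (intro exI[of _ "cbox (Complex 0 (1/2)) (Complex 1 1)"] exI[of _ "cbox (Complex 0 0) (Complex 1 (1/2))"])
        (auto simp: unit_square_def in_cbox_complex_iff complex_eq_iff)
  qed
  then obtain K L where KL: "K \<union> L = unit_square" "closed_disc K" "closed L" 
    "\<And>t. t\<in>{0..1} \<Longrightarrow> Complex t s \<in> surface_boundary K" "\<And>t. t\<in>{0..1} \<Longrightarrow> Complex t s \<notin> L"
    "\<And>w. w \<in> K \<Longrightarrow> Im w = 0 \<or> Im w = 1 \<Longrightarrow> Im w = s" by blast
  have sub: "K \<subseteq> unit_square" "L \<subseteq> unit_square" using KL(1) by auto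
  have sq: "Complex x s \<in> unit_square" if "x \<in> {0..1}" for x using that s by (auto simp: mem_unit_square)
  have hK: "homeomorphism K (h e ` K) (h e) (k e)" by (rule homeomorphism_image_subset[OF hom[OF e] sub(1)])
  have pim: "path_image p = (if s = 0 then g ` {a e..b e} else g ` {c e..d e})"
    using s bottom_image[OF e] top_image[OF e] by (auto simp: p_def path_image_def)
  have "continuous_on {0..1} p" unfolding p_def
    by (rule continuous_on_compose2[OF h_cont[OF e]]) (use sq in \<open>auto simp: Complex_eq intro!: continuous_intros\<close>)
  moreover have "inj_on p {0..1}" 
  proof (rule inj_onI)
    fix x y :: real assume "x \<in> {0..1}" "y \<in> {0..1}" "p x = p y"
    then have "Complex x s = Complex y s" unfolding p_def using h_eqD[OF e _ sq sq] by blast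
    then show "x = y" by simp
  qed
  ultimately have arc: "arc p" by (simp add: arc_def path_def)
  define F where "F = h e ` L \<union> \<Union>(R - {e})"
  have "p t \<in> surface_boundary (v \<union> h e ` K \<union> F) \<longleftrightarrow> t = 0 \<or> t = 1"
  proof (rule attached_end_boundary[OF disc _ arc])
    show "closed_disc (h e ` K)" using closed_disc_homeomorphic[OF KL(2)] hK homeomorphic_def by blast
    show "v \<inter> h e ` K = path_image p"
    proof (intro equalityI subsetI)
      fix z assume "z \<in> v \<inter> h e ` K"
      then obtain w where w: "w \<in> K" "z = h e w" "h e w \<in> v" by blast
      then have "Im w = 0 \<or> Im w = 1" using h_mem_v[OF e, of w] sub by blast
      then have "Im w = s" using KL(6) w by blast
      then have "w = Complex (Re w) s" by (auto simp: complex_eq_iff)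
      then have "z = p (Re w)" using w by (simp add: p_def)
      moreover have "Re w \<in> {0..1}" using w sub by (auto simp: mem_unit_square)
      ultimately show "z \<in> path_image p" unfolding path_image_def by blast
    next
      fix z assume "z \<in> path_image p"
      then obtain x where x: "x \<in> {0..1}" "z = h e (Complex x s)" unfolding path_image_def p_def by blast
      moreover have "Complex x s \<in> K" using KL(4)[OF x(1)] surface_boundary_subset by blast
      moreover have "h e (Complex x s) \<in> v" using h_mem_v[OF e sq[OF x(1)]] s by simp
      ultimately show "z \<in> v \<inter> h e ` K" by blast
    qed
    show "path_image p \<subseteq> surface_boundary v"
      unfolding pim simple_loop_image[OF loop, symmetric] using order[OF e] by auto
    show "path_image p \<subseteq> surface_boundary (h e ` K)"
      unfolding surface_boundary_homeomorphism[OF hK] path_image_def p_def using KL(4) by blast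
    have "compact L" using KL(3) sub(2) compact_Int_closed[of unit_square L] by (simp add: unit_square_def Int_absorb1)
    then have "closed (h e ` L)" 
      by (intro compact_imp_closed compact_continuous_image continuous_on_subset[OF h_cont[OF e] sub(2)])
    then show "closed F" unfolding F_def using closed_ribbons[of "R - {e}"] by auto
    show "path_image p \<inter> F = {}"
    proof -
      have "p x \<notin> F" if x: "x \<in> {0..1}" for x
      proof -
        have "p x \<in> e" using h_image[OF e] sq[OF x] by (auto simp: p_def)
        moreover have "p x \<notin> h e ` L" 
        proof
          assume "p x \<in> h e ` L"
          then obtain w where "w \<in> L" "h e (Complex x s) = h e w" unfolding p_def by blast
          then show False using h_eqD[OF e _ sq[OF x], of w] sub(2) KL(5)[OF x] by auto
        qed
        ultimately show ?thesis unfolding F_def using ribbons_disjoint[OF e] by blast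
      qed
      then show ?thesis by (auto simp: path_image_def)
    qed
  qed (use t in auto)
  moreover have "v \<union> h e ` K \<union> F = Surf"
  proof -
    have "h e ` K \<union> h e ` L = e" using h_image[OF e] KL(1) by (simp add: image_Un[symmetric])
    then show ?thesis unfolding F_def Surf_def using e by blast
  qed
  ultimately show ?thesis by (simp add: p_def)
qed

lemma gap_mem_ribbon:
  assumes e: "e \<in> R" and t: "t \<in> gaps" and m: "g t \<in> e"
  shows "t = a e \<or> t = b e \<or> t = c e \<or> t = d e"
proof -
  have t01: "0 \<le> t" "t \<le> 1" using t by (auto simp: gaps_def)
  have "g t \<in> v \<inter> e" using m t01 simple_loop_image[OF loop] surface_boundary_subset[of v] by auto
  then obtain s where s: "s \<in> {a e..b e} \<union> {c e..d e}" "g t = g s" using attach[OF e] by blast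
  then have "t = s" using g_eqD[of t s] t01 order[OF e] by auto
  then show ?thesis using s(1) t e by (force simp: gaps_def)
qed

lemma side_subset: "e \<in> R \<Longrightarrow> x = 0 \<or> x = 1 \<Longrightarrow> side e x \<subseteq> e"
proof
  fix z assume e: "e \<in> R" and x: "x = 0 \<or> x = 1" and "z \<in> side e x"
  then obtain y where y: "y \<in> {0..1}" "z = h e (Complex x y)" unfolding side_def by blast
  then have "Complex x y \<in> unit_square" using x by (auto simp: mem_unit_square)
  then show "z \<in> e" using h_image[OF e] y by blast
qed

text \<open>Outside the ribbon ends the surface is locally a vertex-disc or a ribbon, and at the ribbon ends
the previous lemmas apply.\<close>

theorem surface_boundary_Surf:
  "surface_boundary Surf = g ` gaps \<union> (\<Union>e\<in>R. side e 0 \<union> side e 1)"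
proof (rule Set.set_eqI)
  fix z
  have cv: "closed v" using closed_disc_closed disc by blast
  have gv: "g t \<in> v" if "t \<in> {0..1}" for t using that simple_loop_image[OF loop] surface_boundary_subset[of v] by blast
  have RHSsub: "g ` gaps \<union> (\<Union>e\<in>R. side e 0 \<union> side e 1) \<subseteq> Surf"
    unfolding Surf_def using side_subset gv by (fastforce simp: gaps_def)
  consider (out) "z \<notin> Surf" | (disc) "z \<in> v" "z \<notin> \<Union>R" | (rib) e where "e \<in> R" "z \<in> e" "z \<notin> v" | (both) e where "e \<in> R" "z \<in> e" "z \<in> v"
    unfolding Surf_def by blast
  then show "z \<in> surface_boundary Surf \<longleftrightarrow> z \<in> g ` gaps \<union> (\<Union>e\<in>R. side e 0 \<union> side e 1)"
  proof cases
    case out then show ?thesis using RHSsub surface_boundary_subset[of Surf] by blast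
  next
    case disc
    have "z \<in> surface_boundary Surf \<longleftrightarrow> z \<in> surface_boundary v"
      unfolding Surf_def using surface_boundary_away[OF closed_ribbons[OF subset_refl] disc] .
    also have "\<dots> \<longleftrightarrow> z \<in> g ` gaps"
    proof
      assume "z \<in> surface_boundary v"
      then obtain t where t: "t \<in> {0..1}" "z = g t" using simple_loop_image[OF loop] by blast
      have "t \<in> gaps"
      proof (rule ccontr)
        assume "t \<notin> gaps"
        then obtain e where e: "e \<in> R" "t \<in> {a e..b e} \<union> {c e..d e}" using t(1) by (auto simp: gaps_def)
        then have "g t \<in> e" using attach[OF e(1)] by blast
        then show False using disc(2) t(2) e(1) by blast
      qed
      then show "z \<in> g ` gaps" using t by blast
    next
      assume "z \<in> g ` gaps" then show "z \<in> surface_boundary v" using simple_loop_image[OF loop] by (auto simp: gaps_def)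
    qed
    finally show ?thesis using disc(2) side_subset by blast
  next
    case (rib e)
    have eq: "Surf = e \<union> (v \<union> \<Union>(R - {e}))" unfolding Surf_def using rib(1) by blast
    have nz: "z \<notin> v \<union> \<Union>(R - {e})" using rib ribbons_disjoint[OF rib(1)] by blast
    have "z \<in> surface_boundary Surf \<longleftrightarrow> z \<in> surface_boundary e"
      unfolding eq by (rule surface_boundary_away[OF _ rib(2) nz]) (use cv closed_ribbons[of "R - {e}"] in auto)
    also have "\<dots> \<longleftrightarrow> z \<in> side e 0 \<union> side e 1"
    proof
      assume "z \<in> surface_boundary e"
      then obtain w where w: "w \<in> surface_boundary unit_square" "z = h e w"
        unfolding surface_boundary_homeomorphism[OF hom[OF rib(1)]] by blast
      then have wsq: "w \<in> unit_square" using mem_boundary_unit_square by blast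
      then have "Re w = 0 \<or> Re w = 1" using w mem_boundary_unit_square h_mem_v[OF rib(1) wsq] rib(3) by blast
      then have "z = h e (Complex 0 (Im w)) \<or> z = h e (Complex 1 (Im w))" using w(2) by (metis complex.collapse)
      then show "z \<in> side e 0 \<union> side e 1" unfolding side_def using wsq by (auto simp: mem_unit_square)
    next
      assume "z \<in> side e 0 \<union> side e 1"
      then obtain y where "y \<in> {0..1}" "z = h e (Complex 0 y) \<or> z = h e (Complex 1 y)" unfolding side_def by blast
      then show "z \<in> surface_boundary e" unfolding surface_boundary_homeomorphism[OF hom[OF rib(1)]]
        by (auto simp: mem_boundary_unit_square mem_unit_square)
    qed
    also have "\<dots> \<longleftrightarrow> z \<in> g ` gaps \<union> (\<Union>e\<in>R. side e 0 \<union> side e 1)"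
    proof -
      have "z \<notin> g ` gaps" using rib(3) gv by (auto simp: gaps_def)
      moreover have "f = e" if "f \<in> R" "z \<in> side f 0 \<union> side f 1" for f
      proof -
        have "z \<in> f" using side_subset[of f] that by blast
        then show ?thesis using ribbons_disjoint[OF that(1) rib(1)] rib(2) by blast
      qed
      ultimately show ?thesis using rib(1) by blast
    qed
    finally show ?thesis .
  next
    case (both e)
    obtain w where w: "w \<in> unit_square" "z = h e w" using both h_image by blast
    then have Imw: "Im w = 0 \<or> Im w = 1" using h_mem_v[OF both(1)] both by blast
    define t where "t = Re w"
    define s where "s = Im w"
    have zts: "z = h e (Complex t s)" using w by (simp add: t_def s_def)
    have t: "t \<in> {0..1}" using w by (auto simp: t_def mem_unit_square)
    have s: "s = 0 \<or> s = 1" using Imw s_def by simp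
    have sq: "Complex t s \<in> unit_square" using w by (simp add: t_def s_def)
    have "z \<in> surface_boundary Surf \<longleftrightarrow> t = 0 \<or> t = 1" unfolding zts by (rule end_boundary[OF both(1) t s])
    also have "\<dots> \<longleftrightarrow> z \<in> g ` gaps \<union> (\<Union>e\<in>R. side e 0 \<union> side e 1)"
    proof
      assume "t = 0 \<or> t = 1"
      then have "z \<in> side e 0 \<union> side e 1" unfolding side_def zts using s by auto
      then show "z \<in> g ` gaps \<union> (\<Union>e\<in>R. side e 0 \<union> side e 1)" using both(1) by blast
    next
      assume "z \<in> g ` gaps \<union> (\<Union>e\<in>R. side e 0 \<union> side e 1)"
      then consider u where "u \<in> gaps" "z = g u" | f x where "f \<in> R" "x = 0 \<or> x = 1" "z \<in> side f x" by blast
      then show "t = 0 \<or> t = 1"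
      proof cases
        case 1
        then have "g u \<in> e" using both by blast
        then have "u = a e \<or> u = b e \<or> u = c e \<or> u = d e" using gap_mem_ribbon[OF both(1) 1(1)] by blast
        then have "g u \<in> {h e (Complex 0 0), h e (Complex 1 0), h e (Complex 0 1), h e (Complex 1 1)}"
          unfolding corners[OF both(1)] by auto
        then have "h e (Complex t s) \<in> {h e (Complex 0 0), h e (Complex 1 0), h e (Complex 0 1), h e (Complex 1 1)}"
          using 1(2) zts by simp
        then have "\<exists>x\<in>{0,1}. \<exists>y\<in>{0,1}. h e (Complex t s) = h e (Complex x y)" by auto
        then show ?thesis
        proof (elim bexE)
          fix x y :: real
          assume xy: "x \<in> {0,1}" "y \<in> {0,1}" "h e (Complex t s) = h e (Complex x y)"
          have "Complex x y \<in> unit_square" using xy(1,2) by (auto simp: mem_unit_square)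
          then have "Complex t s = Complex x y" using h_eqD[OF both(1) xy(3) sq] by blast
          then show ?thesis using xy(1) by simp
        qed
      next
        case 2
        have "z \<in> f" using side_subset 2 by blast
        then have "f = e" using ribbons_disjoint[OF 2(1) both(1)] both(2) by blast
        then have "h e (Complex t s) \<in> side e x" using 2(3) zts by simp
        then obtain y where y: "y \<in> {0..1}" "h e (Complex t s) = h e (Complex x y)" by (auto simp only: side_def)
        then have "Complex t s = Complex x y" using h_eqD[OF both(1) y(2) sq] 2(2) by (auto simp: mem_unit_square)
        then show ?thesis using 2(2) by simp
      qed
    qed
    finally show ?thesis .
  qed
qed

end

section \<open>Twisted ribbons and the Moebius band\<close>

text \<open>The point of \<open>moebius_band\<close> with core angle \<open>\<theta>\<close> and height \<open>t\<close>.\<close>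

definition moebius_point :: "real \<Rightarrow> real \<Rightarrow> complex \<times> complex" where
  "moebius_point \<theta> t = (cis (2 * \<theta>), of_real t * cis \<theta>)"

text \<open>Two squares are glued along their bottom edges directly and along their top edges with a flip; the
result is a Moebius band.\<close>

definition twist_glue :: "complex \<Rightarrow> complex \<Rightarrow> bool" where
  "twist_glue z w \<longleftrightarrow> Im z = 0 \<and> w = z \<or> Im z = 1 \<and> w = hflip z"

text \<open>The homeomorphism type of two glued squares only depends on the points that get identified.\<close>

lemma glued_squares_homeomorphic:
  fixes P Q :: "complex \<Rightarrow> 'a::t2_space" and P' Q' :: "complex \<Rightarrow> 'b::t2_space"
  assumes c: "continuous_on unit_square P" "continuous_on unit_square Q" "continuous_on unit_square P'" "continuous_on unit_square Q'"
    and i: "inj_on P unit_square" "inj_on Q unit_square" "inj_on P' unit_square" "inj_on Q' unit_square"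
    and E: "\<And>z w. z \<in> unit_square \<Longrightarrow> w \<in> unit_square \<Longrightarrow> P z = Q w \<longleftrightarrow> E z w"
    and E': "\<And>z w. z \<in> unit_square \<Longrightarrow> w \<in> unit_square \<Longrightarrow> P' z = Q' w \<longleftrightarrow> E z w"
  shows "(P ` unit_square \<union> Q ` unit_square) homeomorphic (P' ` unit_square \<union> Q' ` unit_square)"
proof -
  have sqc: "compact unit_square" by (simp add: unit_square_def)
  obtain kP where kP: "homeomorphism unit_square (P ` unit_square) P kP" using homeomorphism_compact[OF sqc c(1) refl i(1)] by blast
  obtain kQ where kQ: "homeomorphism unit_square (Q ` unit_square) Q kQ" using homeomorphism_compact[OF sqc c(2) refl i(2)] by blast
  define F where "F y = (if y \<in> P ` unit_square then P' (kP y) else Q' (kQ y))" for y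
  have FP: "F (P z) = P' z" if "z \<in> unit_square" for z using kP that by (simp add: F_def homeomorphism_def)
  have FQ: "F (Q w) = Q' w" if w: "w \<in> unit_square" for w
  proof (cases "Q w \<in> P ` unit_square")
    case True
    then obtain z where z: "z \<in> unit_square" "P z = Q w" by (metis imageE)
    then have "P' z = Q' w" using E E' w by blast
    then show ?thesis using FP[OF z(1)] z(2) by simp
  next
    case False
    then show ?thesis using kQ w by (simp add: F_def homeomorphism_def)
  qed
  have cl: "closed (P ` unit_square)" "closed (Q ` unit_square)" 
    using c sqc by (auto intro: compact_imp_closed compact_continuous_image)
  have "continuous_on (P ` unit_square) (\<lambda>y. P' (kP y))" 
    by (rule continuous_on_compose2[OF c(3)]) (use kP in \<open>auto simp: homeomorphism_def\<close>)
  moreover have "continuous_on (Q ` unit_square) (\<lambda>y. Q' (kQ y))" 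
    by (rule continuous_on_compose2[OF c(4)]) (use kQ in \<open>auto simp: homeomorphism_def\<close>)
  moreover have "\<forall>y. y \<in> P ` unit_square \<and> y \<notin> P ` unit_square \<or> y \<in> Q ` unit_square \<and> y \<in> P ` unit_square \<longrightarrow> P' (kP y) = Q' (kQ y)"
  proof (intro allI impI)
    fix y assume "y \<in> P ` unit_square \<and> y \<notin> P ` unit_square \<or> y \<in> Q ` unit_square \<and> y \<in> P ` unit_square"
    then obtain w where w: "w \<in> unit_square" "y = Q w" and yP: "y \<in> P ` unit_square" by blast
    have "kQ y = w" using kQ w by (simp add: homeomorphism_def)
    moreover have "F y = P' (kP y)" using yP by (simp add: F_def)
    ultimately show "P' (kP y) = Q' (kQ y)" using FQ[OF w(1)] w(2) by simp
  qed
  ultimately have Fc: "continuous_on (P ` unit_square \<union> Q ` unit_square) F" unfolding F_def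
    using cl by (intro continuous_on_cases)
  have Fim: "F ` (P ` unit_square \<union> Q ` unit_square) = P' ` unit_square \<union> Q' ` unit_square"
    using FP FQ by (simp add: image_Un image_image)
  have "inj_on F (P ` unit_square \<union> Q ` unit_square)"
  proof (rule inj_onI)
    fix x y assume xy: "x \<in> P ` unit_square \<union> Q ` unit_square" "y \<in> P ` unit_square \<union> Q ` unit_square" "F x = F y"
    then obtain z w where zw: "z \<in> unit_square" "w \<in> unit_square" "x = P z \<or> x = Q z" "y = P w \<or> y = Q w" by blast
    from zw(3) show "x = y"
    proof
      assume x: "x = P z"
      from zw(4) show ?thesis
      proof
        assume y: "y = P w"
        then have "P' z = P' w" using xy(3) x FP zw by simp
        then show ?thesis using inj_onD[OF i(3) _ zw(1,2)] x y by simp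
      next
        assume y: "y = Q w"
        then have "P' z = Q' w" using xy(3) x FP FQ zw by simp
        then show ?thesis using E[OF zw(1,2)] E'[OF zw(1,2)] x y by simp
      qed
    next
      assume x: "x = Q z"
      from zw(4) show ?thesis
      proof
        assume y: "y = P w"
        then have "P' w = Q' z" using xy(3) x FP FQ zw by simp
        then have "P w = Q z" using E[OF zw(2,1)] E'[OF zw(2,1)] by simp
        then show ?thesis using x y by simp
      next
        assume y: "y = Q w"
        then have "Q' z = Q' w" using xy(3) x FQ zw by simp
        then show ?thesis using inj_onD[OF i(4) _ zw(1,2)] x y by simp
      qed
    qed
  qed
  moreover have "compact (P ` unit_square \<union> Q ` unit_square)"
    using c sqc by (auto intro: compact_continuous_image)
  ultimately show ?thesis using homeomorphic_compact[OF _ Fc Fim] by blast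
qed

lemma moebius_point_shift: "moebius_point (\<theta> + pi) t = moebius_point \<theta> (- t)"
proof -
  have "cis (2 * (\<theta> + pi)) = cis (2 * \<theta>)" by (simp add: complex_eq_iff algebra_simps cos_add sin_add)
  then show ?thesis by (simp add: moebius_point_def complex_eq_iff)
qed

lemma moebius_band_eq: "moebius_band = {moebius_point \<theta> t | \<theta> t. - pi / 2 \<le> \<theta> \<and> \<theta> \<le> pi / 2 \<and> -1 \<le> t \<and> t \<le> 1}"
proof (intro equalityI subsetI)
  fix y assume "y \<in> moebius_band"
  then obtain z t where zt: "norm z = 1" "-1 \<le> t" "t \<le> 1" "y = (z\<^sup>2, of_real t * z)" unfolding moebius_band_def by auto
  define \<phi> where "\<phi> = Arg (z\<^sup>2)"
  have z0: "z \<noteq> 0" using zt(1) by auto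
  have "z\<^sup>2 = cis \<phi>" unfolding \<phi>_def using cis_Arg[of "z\<^sup>2"] z0 zt(1) by (simp add: sgn_div_norm norm_power)
  moreover have "cis (\<phi> / 2) ^ 2 = cis \<phi>" by (simp add: power2_eq_square cis_mult)
  ultimately have "z\<^sup>2 = (cis (\<phi> / 2))\<^sup>2" by simp
  then have "z = cis (\<phi> / 2) \<or> z = - cis (\<phi> / 2)" by (simp add: power2_eq_iff)
  then have "y = moebius_point (\<phi> / 2) t \<or> y = moebius_point (\<phi> / 2) (- t)"
    using zt(4) \<open>z\<^sup>2 = cis \<phi>\<close> by (auto simp: moebius_point_def)
  moreover have "- pi < \<phi>" "\<phi> \<le> pi" unfolding \<phi>_def using Arg_bounded[of "z\<^sup>2"] by auto
  ultimately show "y \<in> {moebius_point \<theta> t | \<theta> t. - pi / 2 \<le> \<theta> \<and> \<theta> \<le> pi / 2 \<and> -1 \<le> t \<and> t \<le> 1}"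
    using zt by (elim disjE) (intro CollectI exI[of _ "\<phi> / 2"] exI[of _ t] exI[of _ "-t"]; force)+
next
  fix y assume "y \<in> {moebius_point \<theta> t | \<theta> t. - pi / 2 \<le> \<theta> \<and> \<theta> \<le> pi / 2 \<and> -1 \<le> t \<and> t \<le> 1}"
  then obtain \<theta> t where y: "-1 \<le> t" "t \<le> 1" "y = moebius_point \<theta> t" by blast
  have "(cis \<theta>)\<^sup>2 = cis (2 * \<theta>)" by (simp add: power2_eq_square cis_mult)
  then have "y = (\<lambda>(z, t). (z\<^sup>2, of_real t * z)) (cis \<theta>, t)" using y by (simp add: moebius_point_def)
  then show "y \<in> moebius_band" unfolding moebius_band_def using y by (intro image_eqI[of _ _ "(cis \<theta>, t)"]) auto
qed

lemma moebius_point_in_band: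
  assumes "-1 \<le> t" "t \<le> 1" shows "moebius_point \<theta> t \<in> moebius_band"
proof -
  have "(cis \<theta>)\<^sup>2 = cis (2 * \<theta>)" by (simp add: power2_eq_square cis_mult)
  then have "moebius_point \<theta> t = (\<lambda>(z, t). (z\<^sup>2, of_real t * z)) (cis \<theta>, t)" by (simp add: moebius_point_def)
  then show ?thesis unfolding moebius_band_def using assms by (intro image_eqI[of _ _ "(cis \<theta>, t)"]) auto
qed

text \<open>The halves of the band with core angle in \<open>[0, \<pi>/2]\<close> (\<open>s = 1\<close>) and in
\<open>[- \<pi>/2, 0]\<close> (\<open>s = - 1\<close>).\<close>

definition moebius_half :: "real \<Rightarrow> complex \<Rightarrow> complex \<times> complex" where
  "moebius_half s z = moebius_point (s * (pi / 2 * Im z)) (2 * Re z - 1)"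

lemma moebius_half_continuous: "continuous_on A (moebius_half s)"
  unfolding moebius_half_def moebius_point_def cis_conv_exp by (intro continuous_intros)

lemma moebius_half_union: "moebius_half 1 ` unit_square \<union> moebius_half (-1) ` unit_square = moebius_band"
proof (intro equalityI subsetI)
  fix y assume "y \<in> moebius_half 1 ` unit_square \<union> moebius_half (-1) ` unit_square"
  then obtain s z where "y = moebius_half s z" "z \<in> unit_square" by blast
  then show "y \<in> moebius_band" unfolding moebius_half_def by (auto intro!: moebius_point_in_band simp: mem_unit_square)
next
  fix y assume "y \<in> moebius_band"
  then obtain \<theta> t where y: "- pi / 2 \<le> \<theta>" "\<theta> \<le> pi / 2" "-1 \<le> t" "t \<le> 1" "y = moebius_point \<theta> t" unfolding moebius_band_eq by blast
  have t2: "2 * ((t + 1) / 2) - 1 = t" by (simp add: field_simps)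
  show "y \<in> moebius_half 1 ` unit_square \<union> moebius_half (-1) ` unit_square"
  proof (cases "0 \<le> \<theta>")
    case True
    have "y = moebius_half 1 (Complex ((t + 1) / 2) (\<theta> * 2 / pi))" 
      unfolding moebius_half_def complex.sel t2 using y by simp
    moreover have "Complex ((t + 1) / 2) (\<theta> * 2 / pi) \<in> unit_square" using y True by (auto simp: mem_unit_square field_simps)
    ultimately show ?thesis by blast
  next
    case False
    have "y = moebius_half (-1) (Complex ((t + 1) / 2) (- \<theta> * 2 / pi))" 
      unfolding moebius_half_def complex.sel t2 using y by simp
    moreover have "Complex ((t + 1) / 2) (- \<theta> * 2 / pi) \<in> unit_square" using y False by (auto simp: mem_unit_square field_simps)
    ultimately show ?thesis by blast
  qed
qed

lemma moebius_half_inj: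
  assumes s: "s = 1 \<or> s = -1" shows "inj_on (moebius_half s) unit_square"
proof (rule inj_onI)
  fix z w assume zw: "z \<in> unit_square" "w \<in> unit_square" "moebius_half s z = moebius_half s w"
  have "cos (pi * Im z) = cos (pi * Im w)"
    using zw(3) s by (auto simp: moebius_half_def moebius_point_def complex_eq_iff)
  then have "pi * Im z = pi * Im w" using cos_inj_pi[of "pi * Im z" "pi * Im w"] zw(1,2) by (auto simp: mem_unit_square)
  then have I: "Im z = Im w" by simp
  then have "of_real (2 * Re z - 1) = (of_real (2 * Re w - 1) :: complex)"
    using zw(3) by (simp add: moebius_half_def moebius_point_def)
  then have "Re z = Re w" by (simp only: of_real_eq_iff)
  then show "z = w" using I by (simp add: complex_eq_iff)
qed

lemma moebius_half_glue:
  assumes zw: "z \<in> unit_square" "w \<in> unit_square"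
  shows "moebius_half 1 z = moebius_half (-1) w \<longleftrightarrow> twist_glue z w"
proof
  assume "twist_glue z w"
  then consider "Im z = 0" "w = z" | "Im z = 1" "w = hflip z" unfolding twist_glue_def by blast
  then show "moebius_half 1 z = moebius_half (-1) w"
    by cases (auto simp: moebius_half_def moebius_point_def hflip_def complex_eq_iff)
next
  assume eq: "moebius_half 1 z = moebius_half (-1) w"
  have cs: "cos (pi * Im z) = cos (pi * Im w)" "sin (pi * Im z) = - sin (pi * Im w)"
    using eq by (auto simp: moebius_half_def moebius_point_def complex_eq_iff)
  then have "pi * Im z = pi * Im w" using cos_inj_pi[of "pi * Im z" "pi * Im w"] zw by (auto simp: mem_unit_square)
  then have I: "Im z = Im w" by simp
  then have "sin (pi * Im z) = 0" using cs by simp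
  then have "\<not> (0 < Im z \<and> Im z < 1)" using sin_gt_zero[of "pi * Im z"] by auto
  then have "Im z = 0 \<or> Im z = 1" using zw by (auto simp: mem_unit_square)
  then show "twist_glue z w"
  proof
    assume 0: "Im z = 0"
    then have "Re z = Re w" using eq I by (auto simp: moebius_half_def moebius_point_def complex_eq_iff)
    then show ?thesis using 0 I by (simp add: twist_glue_def complex_eq_iff)
  next
    assume 1: "Im z = 1"
    then have "2 * Re z - 1 = - (2 * Re w - 1)" using eq I by (auto simp: moebius_half_def moebius_point_def complex_eq_iff)
    then show ?thesis using 1 I by (simp add: twist_glue_def hflip_def complex_eq_iff)
  qed
qed

lemma surface_boundary_homeomorphism_iff:
  assumes "homeomorphism X Y f f'" "x \<in> X"
  shows "f x \<in> surface_boundary Y \<longleftrightarrow> x \<in> surface_boundary X"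
proof -
  have "inj_on f X" using assms(1) by (auto simp: homeomorphism_def intro: inj_on_inverseI[of _ f'])
  then show ?thesis unfolding surface_boundary_homeomorphism[OF assms(1)]
    using inj_on_image_mem_iff[OF _ assms(2) surface_boundary_subset] by blast
qed

text \<open>On the segment with core angle \<open>\<pi>/4\<close> the band locally coincides with one of its halves, which
is a square; the rotations of the band carry this segment to all others.\<close>

lemma surface_boundary_moebius_band: "surface_boundary moebius_band = range (\<lambda>\<theta>. moebius_point \<theta> 1)"
proof -
  let ?A = "moebius_half 1 ` unit_square" and ?B = "moebius_half (-1) ` unit_square"
  have sqc: "compact unit_square" by (simp add: unit_square_def)
  have clB: "closed ?B" by (intro compact_imp_closed compact_continuous_image moebius_half_continuous sqc)
  obtain k where k: "homeomorphism unit_square ?A (moebius_half 1) k"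
    using homeomorphism_compact[OF sqc moebius_half_continuous refl moebius_half_inj] by blast
  have base: "moebius_point (pi / 4) t \<in> surface_boundary moebius_band \<longleftrightarrow> t = 1 \<or> t = -1" if t: "-1 \<le> t" "t \<le> 1" for t
  proof -
    define z where "z = Complex ((t + 1) / 2) (1/2)"
    have z: "z \<in> unit_square" using t by (auto simp: z_def mem_unit_square)
    have "2 * ((t + 1) / 2) - 1 = t" by (simp add: field_simps)
    then have eq: "moebius_point (pi / 4) t = moebius_half 1 z" unfolding moebius_half_def z_def complex.sel by simp
    have "moebius_half 1 z \<notin> ?B" using moebius_half_glue[OF z] by (auto simp: twist_glue_def z_def)
    then have "moebius_half 1 z \<in> surface_boundary (?A \<union> ?B) \<longleftrightarrow> moebius_half 1 z \<in> surface_boundary ?A"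
      using surface_boundary_away[OF clB, of "moebius_half 1 z" ?A] z by blast
    also have "\<dots> \<longleftrightarrow> z \<in> surface_boundary unit_square" by (rule surface_boundary_homeomorphism_iff[OF k z])
    also have "\<dots> \<longleftrightarrow> t = 1 \<or> t = -1" using z by (auto simp: mem_boundary_unit_square z_def)
    finally show ?thesis unfolding moebius_half_union eq .
  qed
  \<comment> \<open>Rotation of the band by the core angle \<open>\<alpha>\<close>.\<close>
  define rot where "rot \<alpha> = (\<lambda>(w, u). (cis (2 * \<alpha>) * w, cis \<alpha> * u))" for \<alpha>
  have rot: "rot \<alpha> (moebius_point \<theta> t) = moebius_point (\<theta> + \<alpha>) t" for \<alpha> \<theta> t
    by (simp add: rot_def moebius_point_def cis_mult algebra_simps)
  have hom: "homeomorphism moebius_band moebius_band (rot \<alpha>) (rot (- \<alpha>))" for \<alpha>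
  proof (rule homeomorphismI)
    have c: "continuous_on moebius_band (rot \<beta>)" for \<beta> unfolding rot_def case_prod_beta by (intro continuous_intros)
    then show "continuous_on moebius_band (rot \<alpha>)" "continuous_on moebius_band (rot (- \<alpha>))" by auto
    have "rot \<beta> ` moebius_band \<subseteq> moebius_band" for \<beta>
      using rot moebius_point_in_band unfolding moebius_band_eq by (auto simp: moebius_band_eq[symmetric])
    then show "rot \<alpha> ` moebius_band \<subseteq> moebius_band" "rot (- \<alpha>) ` moebius_band \<subseteq> moebius_band" by auto
    have "rot (- \<beta>) (rot \<beta> x) = x" for \<beta> x
    proof -
      have "cis (- (2 * \<beta>)) * cis (2 * \<beta>) = 1" "cis (- \<beta>) * cis \<beta> = 1" by (simp_all add: cis_mult)
      then show ?thesis by (cases x) (simp add: rot_def mult.assoc[symmetric])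
    qed
    from this[of \<alpha>] this[of "- \<alpha>"] show "rot (- \<alpha>) (rot \<alpha> x) = x" "rot \<alpha> (rot (- \<alpha>) x) = x" for x by auto
  qed
  have all: "moebius_point \<theta> t \<in> surface_boundary moebius_band \<longleftrightarrow> t = 1 \<or> t = -1" if t: "-1 \<le> t" "t \<le> 1" for \<theta> t
    using surface_boundary_homeomorphism_iff[OF hom[of "\<theta> - pi / 4"] moebius_point_in_band[OF t, of "pi / 4"]] base[OF t]
    by (simp add: rot)
  show ?thesis
  proof (intro equalityI subsetI)
    fix y assume y: "y \<in> surface_boundary moebius_band"
    then have "y \<in> moebius_band" using surface_boundary_subset by blast
    then obtain \<theta> t where "-1 \<le> t" "t \<le> 1" "y = moebius_point \<theta> t" unfolding moebius_band_eq by blast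
    then have "y = moebius_point \<theta> 1 \<or> y = moebius_point (\<theta> + pi) 1" using all y by (auto simp: moebius_point_shift)
    then show "y \<in> range (\<lambda>\<theta>. moebius_point \<theta> 1)" by blast
  qed (use all in auto)
qed

lemma connected_boundary_moebius_band: "connected (surface_boundary moebius_band)"
  unfolding surface_boundary_moebius_band moebius_point_def cis_conv_exp
  by (intro connected_continuous_image continuous_intros) auto

context ribboned_disc begin

text \<open>Whatever the twist of the ribbon, in these coordinates of the vertex-disc the top edge runs against
the direction of the loop; the comparison with the coordinates of the ribbon shows the gluing.\<close>

lemma disc_square:
  assumes e: "e \<in> R"
  shows "\<exists>hv kv. homeomorphism unit_square v hv kv \<and>
    (\<forall>x\<in>{0..1}. hv (Complex x 0) = segpath g (a e) (b e) x \<and> hv (Complex x 1) = segpath g (d e) (c e) x)"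
proof -
  have o: "0 < a e" "a e < b e" "b e < c e" "c e < d e" "d e < 1" using order[OF e] by auto
  have p: "arc (segpath g (a e) (b e))" "path_image (segpath g (a e) (b e)) = g ` {a e..b e}"
    using arc_segpath[OF loop, of "a e" "b e"] segpath_image[of "a e" "b e" g] o by (auto simp: path_image_def)
  have q: "arc (segpath g (c e) (d e))" "path_image (segpath g (c e) (d e)) = g ` {c e..d e}"
    using arc_segpath[OF loop, of "c e" "d e"] segpath_image[of "c e" "d e" g] o by (auto simp: path_image_def)
  have r: "segpath g (d e) (c e) = reversepath (segpath g (c e) (d e))"
    unfolding reversepath_def by (rule ext) (rule segpath_rev)
  have q': "arc (segpath g (d e) (c e))" "path_image (segpath g (d e) (c e)) = g ` {c e..d e}"
    unfolding r using q by (auto simp: arc_reversepath)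
  show ?thesis using disc_as_square[OF disc loop o p segpath_0 segpath_1 q' segpath_0 segpath_1] by blast
qed

lemma twisted_homeomorphic_moebius:
  assumes e: "e \<in> R" and tw: "tw e"
  shows "(v \<union> e) homeomorphic moebius_band"
proof -
  obtain hv kv where hv: "homeomorphism unit_square v hv kv" 
     "\<And>x. x\<in>{0..1} \<Longrightarrow> hv (Complex x 0) = segpath g (a e) (b e) x"
     "\<And>x. x\<in>{0..1} \<Longrightarrow> hv (Complex x 1) = segpath g (d e) (c e) x"
    using disc_square[OF e] by metis
  have hvi: "inj_on hv unit_square" and hvim: "hv ` unit_square = v" and hvc: "continuous_on unit_square hv"
    using hv(1) by (auto simp: homeomorphism_def intro: inj_on_inverseI[of _ kv])
  have hi: "inj_on (h e) unit_square" using h_eqD[OF e] by (intro inj_onI) 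
  have j0: "h e (Complex x 0) = hv (Complex x 0)" if "x \<in> {0..1}" for x using bottom[OF e that] hv(2)[OF that] by simp
  have j1: "h e (Complex x 1) = hv (Complex (1 - x) 1)" if "x \<in> {0..1}" for x
    using top[OF e that] hv(3)[of "1 - x"] that tw segpath_rev[of g "d e" "c e" "1 - x"] by simp
  have E: "hv z = h e w \<longleftrightarrow> twist_glue z w" if zw: "z \<in> unit_square" "w \<in> unit_square" for z w
  proof
    assume eq: "hv z = h e w"
    then have "h e w \<in> v" using hvim zw by (metis imageI)
    then have "Im w = 0 \<or> Im w = 1" using h_mem_v[OF e zw(2)] by blast
    moreover have Rw: "Re w \<in> {0..1}" using zw by (auto simp: mem_unit_square)
    ultimately have "h e w = hv (Complex (Re w) 0) \<and> Im w = 0 \<or> h e w = hv (Complex (1 - Re w) 1) \<and> Im w = 1"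
      using j0[OF Rw] j1[OF Rw] by (metis complex.collapse)
    then show "twist_glue z w"
    proof
      assume *: "h e w = hv (Complex (Re w) 0) \<and> Im w = 0"
      have "Complex (Re w) 0 \<in> unit_square" using Rw by (auto simp: mem_unit_square)
      then have "z = Complex (Re w) 0" using inj_onD[OF hvi _ zw(1)] * eq by simp
      then show ?thesis using * by (simp add: twist_glue_def complex_eq_iff)
    next
      assume *: "h e w = hv (Complex (1 - Re w) 1) \<and> Im w = 1"
      have "Complex (1 - Re w) 1 \<in> unit_square" using Rw by (auto simp: mem_unit_square)
      then have "z = Complex (1 - Re w) 1" using inj_onD[OF hvi _ zw(1)] * eq by simp
      then show ?thesis using * by (simp add: twist_glue_def hflip_def complex_eq_iff)
    qed
  next
    have Rz: "Re z \<in> {0..1}" using zw by (auto simp: mem_unit_square)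
    assume "twist_glue z w"
    then consider "Im z = 0" "w = z" | "Im z = 1" "w = hflip z" unfolding twist_glue_def by blast
    then show "hv z = h e w"
    proof cases
      case 1
      then show ?thesis using j0[OF Rz] by (metis complex.collapse)
    next
      case 2
      then have "z = Complex (Re z) 1" by (simp add: complex_eq_iff)
      moreover have "w = Complex (1 - Re z) 1" using 2 by (simp add: hflip_def)
      ultimately show ?thesis using j1[of "1 - Re z"] Rz by simp
    qed
  qed
  have "(hv ` unit_square \<union> h e ` unit_square) homeomorphic (moebius_half 1 ` unit_square \<union> moebius_half (-1) ` unit_square)"
    by (rule glued_squares_homeomorphic[where E = twist_glue])
      (use hvc hvi hi h_cont[OF e] E moebius_half_continuous moebius_half_inj moebius_half_glue in auto)
  then show ?thesis unfolding hvim h_image[OF e] moebius_half_union .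
qed

lemma single_ribbon: "e \<in> R \<Longrightarrow> ribboned_disc v {e} g a b c d h k tw"
  using disc loop order hom attach bottom top by unfold_locales auto

text \<open>Without a twist each side of the ribbon closes up with one of the two arcs that the ends leave on
the circle, so the boundary falls into two parts; the boundary of the Moebius band is connected.\<close>

lemma untwisted_not_homeomorphic_moebius:
  assumes e: "e \<in> R" and tw: "\<not> tw e"
  shows "\<not> (v \<union> e) homeomorphic moebius_band"
proof
  assume "(v \<union> e) homeomorphic moebius_band"
  then obtain f f' where ff: "homeomorphism moebius_band (v \<union> e) f f'" using homeomorphic_sym unfolding homeomorphic_def by blast
  have "continuous_on (surface_boundary moebius_band) f"
    by (rule continuous_on_subset[OF homeomorphism_cont1[OF ff] surface_boundary_subset])
  then have conn: "connected (surface_boundary (v \<union> e))"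
    unfolding surface_boundary_homeomorphism[OF ff]
    by (rule connected_continuous_image[OF _ connected_boundary_moebius_band])
  interpret S: ribboned_disc v "{e}" g a b c d h k tw by (rule single_ribbon[OF e])
  have o: "0 < a e" "a e < b e" "b e < c e" "c e < d e" "d e < 1" using order[OF e] by auto
  have gc: "continuous_on {0..1} g" using simple_loop_continuous[OF loop] .
  define A where "A = g ` ({0..a e} \<union> {d e..1}) \<union> side e 0"
  define B where "B = g ` {b e..c e} \<union> side e 1"
  have "S.gaps = ({0..a e} \<union> {d e..1}) \<union> {b e..c e}" unfolding S.gaps_def using o by auto
  then have bd: "surface_boundary (v \<union> e) = A \<union> B"
    using S.surface_boundary_Surf unfolding S.Surf_def A_def B_def S.side_def side_def by (auto simp: image_Un)
  have cs: "compact (side e x)" if "x = 0 \<or> x = 1" for x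
    unfolding side_def using that
    by (intro compact_continuous_image continuous_on_compose2[OF h_cont[OF e]])
       (auto simp: Complex_eq mem_unit_square intro!: continuous_intros)
  have cg: "compact (g ` X)" if "closed X" "X \<subseteq> {0..1}" for X
  proof -
    have "X = {0..1} \<inter> X" using that by auto
    then have "compact X" using compact_Int_closed[of "{0..1}" X] that by simp
    then show ?thesis using that by (intro compact_continuous_image continuous_on_subset[OF gc])
  qed
  have clA: "closed A" unfolding A_def using o by (intro closed_Un compact_imp_closed cs cg) auto
  have clB: "closed B" unfolding B_def using o by (intro closed_Un compact_imp_closed cs cg) auto
  have sv: "z = g (a e) \<or> z = g (d e)" if zs: "z \<in> side e 0" "z \<in> v" for z
  proof -
    obtain y where y: "y \<in> {0..1}" "z = h e (Complex 0 y)" using zs(1) unfolding side_def by blast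
    then have "y = 0 \<or> y = 1" using h_mem_v[OF e, of "Complex 0 y"] zs(2) by (auto simp: mem_unit_square)
    then show ?thesis using y corners[OF e] tw by auto
  qed
  have sv1: "z = g (b e) \<or> z = g (c e)" if zs: "z \<in> side e 1" "z \<in> v" for z
  proof -
    obtain y where y: "y \<in> {0..1}" "z = h e (Complex 1 y)" using zs(1) unfolding side_def by blast
    then have "y = 0 \<or> y = 1" using h_mem_v[OF e, of "Complex 1 y"] zs(2) by (auto simp: mem_unit_square)
    then show ?thesis using y corners[OF e] tw by auto
  qed
  have gv: "g t \<in> v" if "t \<in> {0..1}" for t using that simple_loop_image[OF loop] surface_boundary_subset[of v] by blast
  have AB: "A \<inter> B = {}"
  proof -
    have 1: "z \<notin> g ` {b e..c e}" if "z \<in> A" for z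
    proof
      assume "z \<in> g ` {b e..c e}"
      then obtain t where t: "t \<in> {b e..c e}" "z = g t" by blast
      then have "z \<in> v" using gv[of t] o by auto
      then have "z \<in> g ` ({0..a e} \<union> {d e..1})" using sv that o unfolding A_def by fastforce
      then obtain s where s: "s \<in> {0..a e} \<union> {d e..1}" "z = g s" by blast
      then have "g s = g t" using t(2) by simp
      then have "s = t" using s(1) g_eqD[of s t] t o by auto
      then show False using s t o by auto
    qed
    have 2: "z \<notin> side e 1" if z: "z \<in> A" for z
    proof
      assume s1: "z \<in> side e 1"
      show False
      proof (cases "z \<in> side e 0")
        case True
        then obtain y y' where "y \<in> {0..1}" "y' \<in> {0..1}" "h e (Complex 0 y) = h e (Complex 1 y')" using s1 unfolding side_def by auto
        then have "Complex 0 y = Complex 1 y'" using h_eqD[OF e, of "Complex 0 y" "Complex 1 y'"] by (simp add: mem_unit_square)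
        then show False by simp
      next
        case False
        then obtain s where s: "s \<in> {0..a e} \<union> {d e..1}" "z = g s" using z unfolding A_def by blast
        then have "z \<in> v" using gv[of s] o by auto
        then have "z \<in> g ` {b e..c e}" using sv1[OF s1] o by auto
        then show False using 1[OF z] by blast
      qed
    qed
    show ?thesis using 1 2 unfolding B_def by blast
  qed
  have "A \<noteq> {}" "B \<noteq> {}" unfolding A_def B_def using o by auto
  then show False using connected_closedD[OF conn _ _ clA clB] bd AB by blast
qed

theorem homeomorphic_moebius_iff:
  "e \<in> R \<Longrightarrow> (v \<union> e) homeomorphic moebius_band \<longleftrightarrow> tw e"
  using twisted_homeomorphic_moebius untwisted_not_homeomorphic_moebius by blast

end

section \<open>Clopen sets and locally constant functions\<close>

text \<open>If there are only finitely many clopen sets then the component of a point is the intersection of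
those that contain it, so it is clopen itself and every clopen set is a union of components.\<close>

lemma clopen_card:
  fixes S :: "'a::topological_space set"
  defines "\<U> \<equiv> {U. openin (top_of_set S) U \<and> closedin (top_of_set S) U}"
  assumes fin: "finite \<U>"
  shows "card \<U> = 2 ^ card (components S)"
proof -
  have sub: "U \<subseteq> S" if "U \<in> \<U>" for U using that openin_imp_subset unfolding \<U>_def by blast
  have comp_clopen: "C \<subseteq> U" if C: "C \<in> components S" and U: "U \<in> \<U>" and m: "C \<inter> U \<noteq> {}" for C U
  proof -
    have CS: "C \<subseteq> S" using C in_components_subset by blast
    have "openin (top_of_set C) (C \<inter> U)" "closedin (top_of_set C) (C \<inter> U)"
      using U CS unfolding \<U>_def openin_open closedin_closed by blast+
    then have "C \<inter> U = {} \<or> C \<inter> U = C" using in_components_connected[OF C] connected_clopen by blast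
    then show ?thesis using m by blast
  qed
  have comps: "components S \<subseteq> \<U>"
  proof
    fix C assume C: "C \<in> components S"
    then obtain x where x: "x \<in> C" using in_components_nonempty by blast
    have CS: "C \<subseteq> S" using C in_components_subset by blast
    define F where "F = {U \<in> \<U>. x \<in> U}"
    define A where "A = \<Inter>F"
    have SF: "S \<in> F" using x CS unfolding F_def \<U>_def by auto
    have finF: "finite F" using fin by (simp add: F_def)
    have oA: "openin (top_of_set S) A" unfolding A_def
      by (rule openin_Inter) (use finF SF in \<open>auto simp: F_def \<U>_def\<close>)
    have cA: "closedin (top_of_set S) A" unfolding A_def
      by (rule closedin_Inter) (use SF in \<open>auto simp: F_def \<U>_def\<close>)
    have "connected A" unfolding connected_clopen
    proof (intro allI impI)
      fix T assume T: "openin (top_of_set A) T \<and> closedin (top_of_set A) T"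
      have TA: "T \<subseteq> A" using T openin_imp_subset by blast
      show "T = {} \<or> T = A"
      proof (cases "x \<in> T")
        case True
        have "T \<in> F" using T oA cA True openin_trans closedin_trans unfolding F_def \<U>_def by blast
        then show ?thesis using TA unfolding A_def by blast
      next
        case False
        have "openin (top_of_set A) (A - T)" "closedin (top_of_set A) (A - T)"
          using T openin_diff[of "top_of_set A" A T] closedin_diff[of "top_of_set A" A T] by auto
        moreover have "x \<in> A - T" using False unfolding A_def F_def by blast
        ultimately have "A - T \<in> F" using oA cA openin_trans closedin_trans unfolding F_def \<U>_def by blast
        then have "A \<subseteq> A - T" unfolding A_def by blast
        then show ?thesis using TA by blast
      qed
    qed
    moreover have "x \<in> A" unfolding A_def F_def by blast
    moreover have "A \<subseteq> S" using SF unfolding A_def by blast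
    ultimately have "A \<subseteq> C" using components_maximal[OF C] x by blast
    moreover have "C \<subseteq> A" unfolding A_def F_def using comp_clopen[OF C] x by blast
    ultimately have "C = A" by blast
    then show "C \<in> \<U>" using oA cA unfolding \<U>_def by blast
  qed
  have finC: "finite (components S)" using comps fin finite_subset by blast
  have ex: "\<exists>C\<in>components S. x \<in> C" if "x \<in> S" for x using that Union_components[of S] by blast
  have "bij_betw (\<lambda>U. {C \<in> components S. C \<subseteq> U}) \<U> (Pow (components S))"
  proof (rule bij_betw_byWitness[where f' = Union])
    show "\<forall>U\<in>\<U>. \<Union>{C \<in> components S. C \<subseteq> U} = U"
    proof (intro ballI equalityI subsetI)
      fix U x assume U: "U \<in> \<U>" and x: "x \<in> U"
      then obtain C where "C \<in> components S" "x \<in> C" using ex sub by blast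
      then show "x \<in> \<Union>{C \<in> components S. C \<subseteq> U}" using comp_clopen[OF _ U] x by blast
    qed auto
    show "\<forall>\<C>\<in>Pow (components S). {C \<in> components S. C \<subseteq> \<Union>\<C>} = \<C>"
    proof (intro ballI equalityI subsetI)
      fix \<C> C assume \<C>: "\<C> \<in> Pow (components S)" and C: "C \<in> {C \<in> components S. C \<subseteq> \<Union>\<C>}"
      then obtain x where x: "x \<in> C" using in_components_nonempty by blast
      then obtain C' where "C' \<in> \<C>" "x \<in> C'" using C by blast
      moreover then have "C' = C" using \<C> C x components_nonoverlap[of C S C'] by blast
      ultimately show "C \<in> \<C>" by simp
    qed auto
    show "(\<lambda>U. {C \<in> components S. C \<subseteq> U}) ` \<U> \<subseteq> Pow (components S)" by blast
    show "Union ` Pow (components S) \<subseteq> \<U>"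
    proof (intro image_subsetI)
      fix \<C> assume \<C>: "\<C> \<in> Pow (components S)"
      have "openin (top_of_set S) (\<Union>\<C>)" by (rule openin_Union) (use \<C> comps in \<open>auto simp: \<U>_def\<close>)
      moreover have "closedin (top_of_set S) (\<Union>\<C>)"
        by (rule closedin_Union) (use \<C> comps finC finite_subset in \<open>auto simp: \<U>_def\<close>)
      ultimately show "\<Union>\<C> \<in> \<U>" unfolding \<U>_def by blast
    qed
  qed
  then have "card \<U> = card (Pow (components S))" by (rule bij_betw_same_card)
  then show ?thesis using card_Pow[OF finC] by simp
qed

text \<open>The times spent in the ribbon ends form finitely many disjoint closed intervals; here they are
represented by the pairs of their endpoints.\<close>

locale interval_family =
  fixes EE :: "(real \<times> real) set"
  assumes fin: "finite EE"
    and bounds: "p \<in> EE \<Longrightarrow> 0 < fst p \<and> fst p < snd p \<and> snd p < 1"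
    and apart: "p \<in> EE \<Longrightarrow> q \<in> EE \<Longrightarrow> p \<noteq> q \<Longrightarrow> snd p < fst q \<or> snd q < fst p"
begin

definition rest :: "real set" where "rest = {t \<in> {0..1}. \<forall>p\<in>EE. \<not> (fst p < t \<and> t < snd p)}"

definition before :: "real \<Rightarrow> (real \<times> real) set" where "before t = {p \<in> EE. fst p < t}"

lemma closed_rest: "closed rest"
proof -
  have "t \<in> rest \<longleftrightarrow> t \<in> {0..1} \<and> (\<forall>p\<in>EE. t \<in> - {fst p<..<snd p})" for t by (simp add: rest_def)
  then have "rest = {0..1} \<inter> (\<Inter>p\<in>EE. - {fst p<..<snd p})" by blast
  moreover have "closed ({0..1} \<inter> (\<Inter>p\<in>EE. - {fst p<..<snd p}))" by (intro closed_Int closed_INT ballI) auto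
  ultimately show ?thesis by simp
qed

text \<open>On the complement of the intervals, the set of the intervals that have already been passed is
locally constant.\<close>

lemma closed_before: "closed {t \<in> rest. Q (before t)}"
proof -
  have eq: "before t = J \<longleftrightarrow> (\<forall>p\<in>J. snd p \<le> t) \<and> (\<forall>p\<in>EE - J. t \<le> fst p)" if "t \<in> rest" "J \<subseteq> EE" for t J
  proof -
    have "fst p < t \<longleftrightarrow> snd p \<le> t" if "p \<in> EE" for p
      using bounds[OF that] \<open>t \<in> rest\<close> that unfolding rest_def by force
    then have "before t = {p \<in> EE. snd p \<le> t}" "\<forall>p\<in>EE. t \<le> fst p \<longleftrightarrow> \<not> snd p \<le> t"
      unfolding before_def using not_less by blast+
    then show ?thesis using \<open>J \<subseteq> EE\<close> by blast
  qed
  have "{t \<in> rest. Q (before t)} = (\<Union>J\<in>{J \<in> Pow EE. Q J}. rest \<inter> (\<Inter>p\<in>J. {snd p..}) \<inter> (\<Inter>p\<in>EE - J. {..fst p}))" (is "?L = ?R")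
  proof (intro equalityI subsetI)
    fix t assume t: "t \<in> ?L"
    have "before t \<subseteq> EE" unfolding before_def by blast
    then show "t \<in> ?R" using t eq[of t "before t"] by (intro UN_I[of "before t"]) auto
  next
    fix t assume "t \<in> ?R"
    then obtain J where J: "J \<subseteq> EE" "Q J" "t \<in> rest" "\<forall>p\<in>J. snd p \<le> t" "\<forall>p\<in>EE - J. t \<le> fst p" by auto
    then have "before t = J" using eq by blast
    then show "t \<in> ?L" using J by blast
  qed
  moreover have "closed ?R"
    by (intro closed_UN closed_Int closed_INT ballI closed_rest) (use fin in auto)
  ultimately show ?thesis by simp
qed

text \<open>A locally constant function on the complement of the open intervals that agrees at both endpoints
of each interval extends to a locally constant function on the connected set \<open>[0, 1]\<close>.\<close>

lemma rest_constant:
  assumes c1: "closed {t \<in> rest. P t}" and c2: "closed {t \<in> rest. \<not> P t}"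
    and ends: "\<And>p. p \<in> EE \<Longrightarrow> P (fst p) = P (snd p)" and t: "t \<in> rest"
  shows "P t = P 0"
proof -
  \<comment> \<open>The times at which the extended function has the value \<open>b\<close>.\<close>
  define A where "A b = {t \<in> rest. P t = b} \<union> (\<Union>p\<in>{p \<in> EE. P (fst p) = b}. {fst p..snd p})" for b
  have "closed {t \<in> rest. P t = b}" for b using c1 c2 by (cases b) auto
  then have clA: "closed (A b)" for b unfolding A_def
    by (intro closed_Un closed_UN) (use fin in auto)
  have cov: "{0..1} \<subseteq> A True \<union> A False"
  proof
    fix x :: real assume x: "x \<in> {0..1}"
    show "x \<in> A True \<union> A False"
    proof (cases "x \<in> rest")
      case True then show ?thesis unfolding A_def by blast
    next
      case False
      then obtain p where "p \<in> EE" "x \<in> {fst p..snd p}" using x unfolding rest_def by force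
      then show ?thesis unfolding A_def by blast
    qed
  qed
  have A1: "P x = b" if "x \<in> rest" "x \<in> A b" for x b
  proof -
    from that(2) consider "P x = b" | p where "p \<in> EE" "P (fst p) = b" "x \<in> {fst p..snd p}" unfolding A_def by blast
    then show ?thesis
    proof cases
      case 2
      then have "x = fst p \<or> x = snd p" using that(1) unfolding rest_def by force
      then show ?thesis using 2 ends by metis
    qed
  qed
  have A2: "P (fst p) = b" if px: "p \<in> EE" "fst p < x" "x < snd p" "x \<in> A b" for x b p
  proof -
    have "x \<notin> rest" using px unfolding rest_def by blast
    then obtain q where q: "q \<in> EE" "P (fst q) = b" "x \<in> {fst q..snd q}" using px(4) unfolding A_def by blast
    then have "q = p" using apart[OF q(1) px(1)] px by force
    then show ?thesis using q by simp
  qed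
  have disj: "A True \<inter> A False \<inter> {0..1} = {}"
  proof (rule ccontr)
    assume "\<not> ?thesis"
    then obtain x where x: "x \<in> A True" "x \<in> A False" "x \<in> {0..1}" by blast
    show False
    proof (cases "x \<in> rest")
      case True then show ?thesis using A1 x by metis
    next
      case False
      then obtain p where "p \<in> EE" "fst p < x" "x < snd p" using x(3) unfolding rest_def by blast
      then show ?thesis using A2[of p x True] A2[of p x False] x by simp
    qed
  qed
  have "A True \<inter> {0..1} = {} \<or> A False \<inter> {0..1} = {}"
    using connected_closedD[OF _ disj cov clA clA] by simp
  moreover have r: "x \<in> {0..1}" if "x \<in> rest" for x using that unfolding rest_def by blast
  moreover have "0 \<in> rest" unfolding rest_def using bounds by force
  ultimately show ?thesis using t unfolding A_def by (cases "P t"; cases "P 0") blast+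
qed

lemma before_snd:
  assumes "p \<in> EE" shows "before (snd p) = insert p (before (fst p))" "p \<notin> before (fst p)"
proof -
  show "before (snd p) = insert p (before (fst p))"
  proof (intro equalityI subsetI)
    fix q assume q: "q \<in> before (snd p)"
    show "q \<in> insert p (before (fst p))"
    proof (cases "q = p")
      case False
      then show ?thesis using q apart[of p q] bounds[of q] assms unfolding before_def by auto
    qed simp
  next
    fix q assume "q \<in> insert p (before (fst p))"
    then show "q \<in> before (snd p)" using bounds[OF assms] assms unfolding before_def by auto
  qed
qed (simp add: before_def)

lemma fst_snd_rest:
  assumes "p \<in> EE" shows "fst p \<in> rest" "snd p \<in> rest"
proof -
  have *: "\<not> (fst q < fst p \<and> fst p < snd q)" "\<not> (fst q < snd p \<and> snd p < snd q)" if "q \<in> EE" for q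
    using apart[OF that assms] bounds[OF that] bounds[OF assms] by (cases "q = p"; force)+
  then show "fst p \<in> rest" "snd p \<in> rest" using bounds[OF assms] unfolding rest_def by auto
qed

end

section \<open>Counting the faces of a disc with ribbons\<close>

lemma odd_card_add:
  assumes "finite A" "finite B"
  shows "odd (card A + card B) = odd (card ((A - B) \<union> (B - A)))"
proof -
  have "card A = card (A - B) + card (A \<inter> B)" "card B = card (B - A) + card (A \<inter> B)"
    using assms card_Diff_subset_Int[of A B] card_mono[of A "A \<inter> B"] card_Diff_subset_Int[of B A] card_mono[of B "A \<inter> B"]
    by (auto simp: Int_commute)
  moreover have "card ((A - B) \<union> (B - A)) = card (A - B) + card (B - A)"
    using assms by (intro card_Un_disjoint) auto
  ultimately show ?thesis by presburger
qed

context ribboned_disc begin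

definition ends :: "'a set set \<Rightarrow> (real \<times> real) set" where
  "ends S = (\<lambda>e. (a e, b e)) ` S \<union> (\<lambda>e. (c e, d e)) ` S"

text \<open>The ends of \<open>e\<close> and \<open>f\<close> alternate along the loop \<open>g\<close>.\<close>

definition crossing :: "'a set \<Rightarrow> 'a set \<Rightarrow> bool" where
  "crossing e f \<longleftrightarrow> a e < a f \<and> a f < c e \<and> c e < c f \<or> a f < a e \<and> a e < c f \<and> c f < c e"

lemma ends_apart:
  assumes "e \<in> R" "f \<in> R" "e \<noteq> f"
  shows "b e < a f \<or> b f < a e" "b e < c f \<or> d f < a e" "d e < a f \<or> b f < c e" "d e < c f \<or> d f < c e"
proof -
  have no: "\<not> (t \<in> {a e..b e} \<union> {c e..d e} \<and> t \<in> {a f..b f} \<union> {c f..d f})" for t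
    using attach[OF assms(1)] attach[OF assms(2)] ribbons_disjoint[OF assms] by blast
  note o = order[OF assms(1)] order[OF assms(2)]
  show "b e < a f \<or> b f < a e" using no[of "max (a e) (a f)"] o by force
  show "b e < c f \<or> d f < a e" using no[of "max (a e) (c f)"] o by force
  show "d e < a f \<or> b f < c e" using no[of "max (c e) (a f)"] o by force
  show "d e < c f \<or> d f < c e" using no[of "max (c e) (c f)"] o by force
qed

lemma interval_family_ends: "interval_family (ends R)"
proof
  show "finite (ends R)" using finR by (simp add: ends_def)
  show "0 < fst p \<and> fst p < snd p \<and> snd p < 1" if "p \<in> ends R" for p
    using that order by (force simp: ends_def)
  show "snd p < fst q \<or> snd q < fst p" if pq: "p \<in> ends R" "q \<in> ends R" "p \<noteq> q" for p q
  proof -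
    obtain e where e: "e \<in> R" "p = (a e, b e) \<or> p = (c e, d e)" using pq(1) unfolding ends_def by blast
    obtain f where f: "f \<in> R" "q = (a f, b f) \<or> q = (c f, d f)" using pq(2) unfolding ends_def by blast
    show ?thesis
    proof (cases "e = f")
      case True
      then show ?thesis using e f pq(3) order[OF e(1)] by auto
    next
      case False
      then show ?thesis using e(2) f(2) ends_apart[OF e(1) f(1) False] by auto
    qed
  qed
qed

end

sublocale ribboned_disc \<subseteq> I: interval_family "ends R" by (rule interval_family_ends)

context ribboned_disc begin

lemma gaps_eq: "gaps = I.rest"
  unfolding gaps_def I.rest_def by (auto simp: ends_def ball_Un)

lemma ends_mem:
  assumes "e \<in> R" "S \<subseteq> R"
  shows "(a e, b e) \<in> ends S \<longleftrightarrow> e \<in> S" "(c e, d e) \<in> ends S \<longleftrightarrow> e \<in> S"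
proof -
  have "e = f" if "f \<in> S" "(a e, b e) = (a f, b f) \<or> (a e, b e) = (c f, d f) \<or> (c e, d e) = (a f, b f) \<or> (c e, d e) = (c f, d f)" for f
  proof (rule ccontr)
    assume ne: "e \<noteq> f"
    have f: "f \<in> R" using that assms by blast
    show False using that(2) ends_apart[OF assms(1) f ne] order[OF assms(1)] order[OF f] by force
  qed
  then show "(a e, b e) \<in> ends S \<longleftrightarrow> e \<in> S" "(c e, d e) \<in> ends S \<longleftrightarrow> e \<in> S" unfolding ends_def by blast+
qed

lemma ends_mono: "S \<subseteq> R \<Longrightarrow> ends S \<subseteq> ends R"
  unfolding ends_def by blast

text \<open>The colouring of the gaps with value \<open>x\<close> at the base point that changes exactly at the ends of
the ribbons in \<open>S\<close>.\<close>

definition colour :: "bool \<Rightarrow> 'a set set \<Rightarrow> real \<Rightarrow> bool" where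
  "colour x S t \<longleftrightarrow> x \<noteq> odd (card (I.before t \<inter> ends S))"

lemma finite_before: "finite (I.before t)"
  using I.fin by (simp add: I.before_def)

lemma colour_flip:
  assumes "p \<in> ends R" shows "colour x S (snd p) \<longleftrightarrow> colour x S (fst p) \<noteq> (p \<in> ends S)"
proof -
  have "I.before (snd p) \<inter> ends S = (if p \<in> ends S then insert p (I.before (fst p) \<inter> ends S) else I.before (fst p) \<inter> ends S)"
    using I.before_snd(1)[OF assms] by auto
  moreover have "card (insert p (I.before (fst p) \<inter> ends S)) = Suc (card (I.before (fst p) \<inter> ends S))"
    using I.before_snd(2)[OF assms] finite_before by (intro card_insert_disjoint) auto
  ultimately show ?thesis unfolding colour_def by auto
qed

lemma colour_flip_ribbon:
  assumes "e \<in> R" "S \<subseteq> R"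
  shows "colour x S (b e) \<longleftrightarrow> colour x S (a e) \<noteq> (e \<in> S)" "colour x S (d e) \<longleftrightarrow> colour x S (c e) \<noteq> (e \<in> S)"
  using colour_flip[of "(a e, b e)" x S] colour_flip[of "(c e, d e)" x S] ends_mem[OF assms] ends_mem[OF assms(1) subset_refl] assms(1)
  by auto

lemma colour_0: "colour x S 0 = x"
proof -
  have "I.before 0 = {}" using I.bounds unfolding I.before_def by force
  then show ?thesis by (simp add: colour_def)
qed

lemma inj_ends: "S \<subseteq> R \<Longrightarrow> inj_on (\<lambda>e. (a e, b e)) S" "S \<subseteq> R \<Longrightarrow> inj_on (\<lambda>e. (c e, d e)) S"
  "S \<subseteq> R \<Longrightarrow> T \<subseteq> R \<Longrightarrow> (\<lambda>e. (a e, b e)) ` S \<inter> (\<lambda>e. (c e, d e)) ` T = {}"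
proof -
  have *: "e = f" if "e \<in> R" "f \<in> R" "(a e, b e) = (a f, b f) \<or> (c e, d e) = (c f, d f)" for e f
    using that ends_apart[OF that(1,2)] order[OF that(1)] order[OF that(2)] by force
  have **: "(a e, b e) \<noteq> (c f, d f)" if "e \<in> R" "f \<in> R" for e f
    using that ends_apart[OF that(1,2)] order[OF that(1)] order[OF that(2)] by (cases "e = f") force+
  show "S \<subseteq> R \<Longrightarrow> inj_on (\<lambda>e. (a e, b e)) S" "S \<subseteq> R \<Longrightarrow> inj_on (\<lambda>e. (c e, d e)) S"
    using * by (auto intro!: inj_onI)
  show "S \<subseteq> R \<Longrightarrow> T \<subseteq> R \<Longrightarrow> (\<lambda>e. (a e, b e)) ` S \<inter> (\<lambda>e. (c e, d e)) ` T = {}" using ** by blast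
qed

text \<open>The colour returns to its initial value after one turn, because every ribbon has two ends.\<close>

lemma colour_1: 
  assumes "S \<subseteq> R" shows "colour x S 1 = x"
proof -
  have "I.before 1 = ends R" using I.bounds unfolding I.before_def by force
  then have "I.before 1 \<inter> ends S = ends S" using ends_mono[OF assms] by blast
  moreover have "finite S" using assms finR finite_subset by blast
  then have "card (ends S) = card S + card S" unfolding ends_def
    using card_image inj_ends(1)[OF assms] inj_ends(2)[OF assms] inj_ends(3)[OF assms assms] by (subst card_Un_disjoint) (auto simp: card_image)
  ultimately show ?thesis by (simp add: colour_def)
qed

text \<open>A ribbon that does not cross \<open>e\<close> has none or both of its ends between the ends of \<open>e\<close>, so
it does not affect the parity.\<close>

lemma colour_between:
  assumes e: "e \<in> R" and S: "S \<subseteq> R"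
  shows "colour x S (c e) \<longleftrightarrow> colour x S (b e) \<noteq> odd (card {f \<in> S. crossing e f})"
proof -
  \<comment> \<open>The ribbons whose first or second end lies between the ends of \<open>e\<close>; those that cross \<open>e\<close>
    form the symmetric difference.\<close>
  define F1 where "F1 = {f \<in> S. b e \<le> a f \<and> a f < c e}"
  define F2 where "F2 = {f \<in> S. b e \<le> c f \<and> c f < c e}"
  define M where "M = (\<lambda>e. (a e, b e)) ` F1 \<union> (\<lambda>e. (c e, d e)) ` F2"
  have finS: "finite S" using S finR finite_subset by blast
  have sub: "F1 \<subseteq> R" "F2 \<subseteq> R" "finite F1" "finite F2" using S finS by (auto simp: F1_def F2_def)
  have bef: "I.before t \<inter> ends S = {p \<in> ends S. fst p < t}" for t
    using ends_mono[OF S] unfolding I.before_def by blast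
  have Meq: "M = {p \<in> ends S. b e \<le> fst p \<and> fst p < c e}"
  proof (intro equalityI subsetI)
    fix p assume "p \<in> M"
    then show "p \<in> {p \<in> ends S. b e \<le> fst p \<and> fst p < c e}"
      unfolding M_def F1_def F2_def ends_def by (elim UnE imageE) simp_all
  next
    fix p assume p: "p \<in> {p \<in> ends S. b e \<le> fst p \<and> fst p < c e}"
    then consider f where "f \<in> S" "p = (a f, b f)" | f where "f \<in> S" "p = (c f, d f)" unfolding ends_def by blast
    then show "p \<in> M"
    proof cases
      case 1 then show ?thesis using p unfolding M_def F1_def by simp
    next
      case 2 then show ?thesis using p unfolding M_def F2_def by simp
    qed
  qed
  have "I.before (c e) \<inter> ends S = (I.before (b e) \<inter> ends S) \<union> M"
  proof -
    have "fst p < c e \<longleftrightarrow> fst p < b e \<or> b e \<le> fst p \<and> fst p < c e" for p :: "real \<times> real"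
      using order[OF e] by linarith
    then show ?thesis unfolding bef Meq by blast
  qed
  moreover have "(I.before (b e) \<inter> ends S) \<inter> M = {}" unfolding bef Meq by auto
  moreover have "finite M" using sub by (simp add: M_def)
  ultimately have "card (I.before (c e) \<inter> ends S) = card (I.before (b e) \<inter> ends S) + card M"
    using finite_before by (simp add: card_Un_disjoint)
  moreover have "card M = card F1 + card F2" unfolding M_def
    using sub inj_ends(1)[OF sub(1)] inj_ends(2)[OF sub(2)] inj_ends(3)[OF sub(1,2)]
    by (subst card_Un_disjoint) (auto simp: card_image)
  moreover have "(F1 - F2) \<union> (F2 - F1) = {f \<in> S. crossing e f}"
  proof -
    have "(f \<in> F1 \<and> f \<notin> F2 \<or> f \<in> F2 \<and> f \<notin> F1) \<longleftrightarrow> crossing e f" if f: "f \<in> S" for f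
    proof (cases "e = f")
      case True
      then show ?thesis using order[OF e] unfolding F1_def F2_def crossing_def by auto
    next
      case False
      have fR: "f \<in> R" using f S by blast
      have "f \<in> F1 \<longleftrightarrow> b e \<le> a f \<and> a f < c e" "f \<in> F2 \<longleftrightarrow> b e \<le> c f \<and> c f < c e"
        using f unfolding F1_def F2_def by blast+
      then show ?thesis using ends_apart[OF e fR False] order[OF e] order[OF fR] unfolding crossing_def by argo
    qed
    then show ?thesis unfolding F1_def F2_def by blast
  qed
  ultimately show ?thesis using odd_card_add[OF sub(3,4)] unfolding colour_def by auto
qed

text \<open>The supports of the vectors over GF(2) in the kernel of the adjacency matrix with twist signs.\<close>

definition kernel_sets :: "'a set set set" where
  "kernel_sets = {S \<in> Pow R. \<forall>e\<in>R. even (card {f \<in> S. crossing e f} + (if tw e \<and> e \<in> S then 1 else 0))}"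

text \<open>The times at which \<open>g\<close> passes the two corners of a side of a ribbon: at the bottom of the
square, and below at its top.\<close>

definition side_start :: "'a set \<Rightarrow> real \<Rightarrow> real" where "side_start e x = (if x = 0 then a e else b e)"
definition side_end :: "'a set \<Rightarrow> real \<Rightarrow> real" where "side_end e x = (if tw e = (x = 0) then c e else d e)"

text \<open>The two corners of a side get equal colours if and only if the kernel condition holds at the
ribbon; both sides give the same condition.\<close>

lemma colour_side_iff:
  assumes "e \<in> R" "S \<subseteq> R" "x = 0 \<or> x = 1"
  shows "colour y S (side_start e x) = colour y S (side_end e x) \<longleftrightarrow> even (card {f \<in> S. crossing e f} + (if tw e \<and> e \<in> S then 1 else 0))"
  using colour_flip_ribbon[OF assms(1,2), of y] colour_between[OF assms(1,2), of y] assms(3)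
  by (cases "tw e"; cases "e \<in> S"; auto simp: side_start_def side_end_def)

lemma side_corners:
  assumes "e \<in> R" "x = 0 \<or> x = 1"
  shows "h e (Complex x 0) = g (side_start e x)" "h e (Complex x 1) = g (side_end e x)"
  using corners[OF assms(1)] assms(2) by (auto simp: side_start_def side_end_def)

lemma side_mem_corners:
  assumes "e \<in> R" "x = 0 \<or> x = 1"
  shows "g (side_start e x) \<in> side e x" "g (side_end e x) \<in> side e x"
  using side_corners[OF assms, symmetric] by (auto simp: side_def)

lemma side_ends_gaps:
  assumes "e \<in> R" shows "side_start e x \<in> gaps" "side_end e x \<in> gaps"
proof -
  have "(a e, b e) \<in> ends R" "(c e, d e) \<in> ends R" using assms unfolding ends_def by auto
  then have "a e \<in> gaps" "b e \<in> gaps" "c e \<in> gaps" "d e \<in> gaps" unfolding gaps_eq using I.fst_snd_rest by force+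
  then show "side_start e x \<in> gaps" "side_end e x \<in> gaps" by (auto simp: side_start_def side_end_def)
qed

lemma side_inter_v:
  assumes "e \<in> R" "x = 0 \<or> x = 1" "z \<in> side e x" "z \<in> v"
  shows "z = g (side_start e x) \<or> z = g (side_end e x)"
proof -
  obtain y where y: "y \<in> {0..1}" "z = h e (Complex x y)" using assms(3) unfolding side_def by blast
  then have "y = 0 \<or> y = 1" using h_mem_v[OF assms(1), of "Complex x y"] assms(2,4) by (auto simp: mem_unit_square)
  then show ?thesis using y side_corners[OF assms(1,2)] by auto
qed

lemma side_path: "e \<in> R \<Longrightarrow> x = 0 \<or> x = 1 \<Longrightarrow> continuous_on {0..1} (\<lambda>y. h e (Complex x y))"
  by (rule continuous_on_compose2[OF h_cont]) (auto simp: Complex_eq mem_unit_square intro!: continuous_intros)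

lemma connected_side: "e \<in> R \<Longrightarrow> x = 0 \<or> x = 1 \<Longrightarrow> connected (side e x)"
  unfolding side_def by (intro connected_continuous_image side_path) auto

lemma compact_side: "e \<in> R \<Longrightarrow> x = 0 \<or> x = 1 \<Longrightarrow> compact (side e x)"
  unfolding side_def by (intro compact_continuous_image side_path) auto

lemma g_cont: "continuous_on {0..1} g" by (rule simple_loop_continuous[OF loop])

lemma gaps_01: "gaps \<subseteq> {0..1}" by (auto simp: gaps_def)

lemma closed_image_g:
  assumes "closed X" "X \<subseteq> {0..1}" shows "closed (g ` X)"
proof -
  have "X = {0..1} \<inter> X" using assms by auto
  then have "compact X" using compact_Int_closed[of "{0..1}" X] assms by simp
  then show ?thesis using assms by (intro compact_imp_closed compact_continuous_image continuous_on_subset[OF g_cont])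
qed

lemma g_gaps_colour:
  assumes "S \<subseteq> R" "t \<in> gaps" "s \<in> gaps" "g t = g s" shows "colour x S t = colour x S s"
proof -
  have "t = s \<or> t = 0 \<and> s = 1 \<or> t = 1 \<and> s = 0" using simple_loop_eqD[OF loop, of t s] assms gaps_01 by force
  then show ?thesis using colour_0 colour_1[OF assms(1)] by auto
qed

lemma closed_gaps_colour: "closed {t \<in> gaps. colour x S t = y}"
  unfolding gaps_eq colour_def by (rule I.closed_before)

text \<open>The part of the boundary that gets the colour \<open>y\<close>, where each side inherits the colour of its
starting corner.\<close>

definition colour_class :: "bool \<Rightarrow> 'a set set \<Rightarrow> bool \<Rightarrow> 'a set" where
  "colour_class x S y = g ` {t \<in> gaps. colour x S t = y} \<union> \<Union>{side e s | e s. e \<in> R \<and> (s = 0 \<or> s = 1) \<and> colour x S (side_start e s) = y}"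

lemma closed_colour_class: "closed (colour_class x S y)"
proof -
  have "{side e s | e s. e \<in> R \<and> (s = 0 \<or> s = 1) \<and> colour x S (side_start e s) = y} \<subseteq> (\<lambda>(e, s). side e s) ` (R \<times> {0, 1})" by auto
  then have "finite {side e s | e s. e \<in> R \<and> (s = 0 \<or> s = 1) \<and> colour x S (side_start e s) = y}"
    by (rule finite_subset) (use finR in simp)
  then have "closed (\<Union>{side e s | e s. e \<in> R \<and> (s = 0 \<or> s = 1) \<and> colour x S (side_start e s) = y})"
    by (rule closed_Union) (auto intro: compact_imp_closed compact_side)
  moreover have "closed (g ` {t \<in> gaps. colour x S t = y})" by (rule closed_image_g[OF closed_gaps_colour]) (use gaps_01 in auto)
  ultimately show ?thesis unfolding colour_class_def by (rule closed_Un[rotated])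
qed

lemma colour_class_union: "colour_class x S True \<union> colour_class x S False = surface_boundary Surf"
  proof (intro equalityI subsetI)
  fix z assume "z \<in> colour_class x S True \<union> colour_class x S False"
  then show "z \<in> surface_boundary Surf" unfolding surface_boundary_Surf colour_class_def by blast
next
  fix z assume "z \<in> surface_boundary Surf"
  then consider t where "t \<in> gaps" "z = g t" | e s where "e \<in> R" "s = 0 \<or> s = 1" "z \<in> side e s"
    unfolding surface_boundary_Surf by blast
  then have "\<exists>y. z \<in> colour_class x S y" unfolding colour_class_def by cases blast+
  then show "z \<in> colour_class x S True \<union> colour_class x S False" by (metis (full_types) UnI1 UnI2)
qed

text \<open>The kernel condition makes the colours of the gaps and of the sides agree at the corners.\<close>

lemma colour_class_disjoint:
  assumes S: "S \<in> kernel_sets" shows "colour_class x S True \<inter> colour_class x S False = {}"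
proof -
  have SR: "S \<subseteq> R" using S by (auto simp: kernel_sets_def)
  have bttp: "colour x S (side_start e s) = colour x S (side_end e s)" if "e \<in> R" "s = 0 \<or> s = 1" for e s
    using colour_side_iff[OF that(1) SR that(2)] S that(1) by (auto simp: kernel_sets_def)
  have gs: "colour x S t = colour x S (side_start e s)" if "t \<in> gaps" "e \<in> R" "s = 0 \<or> s = 1" "g t \<in> side e s" for t e s
  proof -
    have "g t \<in> v" using that(1) gaps_01 simple_loop_image[OF loop] surface_boundary_subset[of v] by blast
    then have "g t = g (side_start e s) \<or> g t = g (side_end e s)" using side_inter_v that by blast
    then show ?thesis using g_gaps_colour[OF SR that(1)] side_ends_gaps[OF that(2)] bttp[OF that(2,3)] by metis
  qed
  have ss: "e = f \<and> s = r" if A: "e \<in> R" "f \<in> R" "s = 0 \<or> s = 1" "r = 0 \<or> r = 1" "z \<in> side e s" "z \<in> side f r" for e f s r z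
  proof -
    have ef: "e = f" using ribbons_disjoint[OF A(1,2)] side_subset A by blast
    obtain y y' where y: "y \<in> {0..1}" "y' \<in> {0..1}" "z = h e (Complex s y)" "z = h e (Complex r y')" 
      using A(5,6) ef unfolding side_def by blast
    then have "Complex s y = Complex r y'" using h_eqD[OF A(1), of "Complex s y" "Complex r y'"] A(3,4) by (auto simp: mem_unit_square)
    then show ?thesis using ef by simp
  qed
  show ?thesis
  proof (rule ccontr)
    assume "\<not> ?thesis"
    then obtain z where z: "z \<in> colour_class x S True" "z \<in> colour_class x S False" by blast
    have split: "(\<exists>t\<in>gaps. z = g t \<and> colour x S t = y) \<or> (\<exists>e s. e \<in> R \<and> (s = 0 \<or> s = 1) \<and> z \<in> side e s \<and> colour x S (side_start e s) = y)"
      if "z \<in> colour_class x S y" for y using that unfolding colour_class_def by blast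
    from split[OF z(1)] show False
    proof (elim disjE bexE exE)
      fix t assume t: "t \<in> gaps" "z = g t \<and> colour x S t = True"
      from split[OF z(2)] show False
      proof (elim disjE bexE exE)
        fix s assume "s \<in> gaps" "z = g s \<and> colour x S s = False"
        then show False using g_gaps_colour[OF SR t(1), of s x] t by auto
      next
        fix e s assume "e \<in> R \<and> (s = 0 \<or> s = 1) \<and> z \<in> side e s \<and> colour x S (side_start e s) = False"
        then show False using gs[OF t(1), of e s] t by auto
      qed
    next
      fix e s assume es: "e \<in> R \<and> (s = 0 \<or> s = 1) \<and> z \<in> side e s \<and> colour x S (side_start e s) = True"
      from split[OF z(2)] show False
      proof (elim disjE bexE exE)
        fix t assume "t \<in> gaps" "z = g t \<and> colour x S t = False"
        then show False using gs[of t e s] es by auto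
      next
        fix f r assume "f \<in> R \<and> (r = 0 \<or> r = 1) \<and> z \<in> side f r \<and> colour x S (side_start f r) = False"
        then show False using ss[of e f s r z] es by auto
      qed
    qed
  qed
qed

definition clopens :: "'a set set" where
  "clopens = {U. openin (top_of_set (surface_boundary Surf)) U \<and> closedin (top_of_set (surface_boundary Surf)) U}"

text \<open>The colour of the base point, where \<open>U\<close> is the class of the colour \<open>True\<close>, and the
ribbons at whose first end the colour changes.\<close>

definition colour_data :: "'a set \<Rightarrow> bool \<times> 'a set set" where
  "colour_data U = (g 0 \<in> U, {e \<in> R. (g (a e) \<in> U) \<noteq> (g (b e) \<in> U)})"

lemma closed_boundary_Surf: "closed (surface_boundary Surf)"
  using colour_class_union[of True "{}"] closed_colour_class by (metis closed_Un)

lemma colour_class_data: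
  assumes S: "S \<in> kernel_sets" shows "colour_class x S True \<in> clopens" "colour_data (colour_class x S True) = (x, S)"
proof -
  have SR: "S \<subseteq> R" using S by (auto simp: kernel_sets_def)
  let ?X = "surface_boundary Surf" let ?U = "colour_class x S True" let ?V = "colour_class x S False"
  have UV: "?U \<union> ?V = ?X" "?U \<inter> ?V = {}" using colour_class_union colour_class_disjoint[OF S] by auto
  have "closedin (top_of_set ?X) ?U" "closedin (top_of_set ?X) ?V"
    using UV closed_colour_class by (auto intro!: closed_subset)
  moreover have "?U = ?X - ?V" using UV by blast
  ultimately show "?U \<in> clopens" unfolding clopens_def using openin_diff[of "top_of_set ?X" ?X ?V] by auto
  have mem: "g t \<in> ?U \<longleftrightarrow> colour x S t" if "t \<in> gaps" for t
  proof
    assume "colour x S t" then show "g t \<in> ?U" using that unfolding colour_class_def by blast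
  next
    assume U: "g t \<in> ?U"
    show "colour x S t"
    proof (rule ccontr)
      assume "\<not> colour x S t" then have "g t \<in> ?V" using that unfolding colour_class_def by blast
      then show False using U UV by blast
    qed
  qed
  have "0 \<in> gaps" using order by (force simp: gaps_def)
  then have "g 0 \<in> ?U \<longleftrightarrow> x" using mem colour_0 by blast
  moreover have "{e \<in> R. (g (a e) \<in> ?U) \<noteq> (g (b e) \<in> ?U)} = S"
  proof -
    have "(g (a e) \<in> ?U) \<noteq> (g (b e) \<in> ?U) \<longleftrightarrow> e \<in> S" if e: "e \<in> R" for e
      using mem[of "a e"] mem[of "b e"] side_ends_gaps[OF e, of 0] side_ends_gaps[OF e, of 1] colour_flip_ribbon(1)[OF e SR, of x]
      by (simp add: side_start_def) blast
    then show ?thesis using SR by blast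
  qed
  ultimately show "colour_data ?U = (x, S)" unfolding colour_data_def by simp
qed

lemma clopen_side:
  assumes U: "U \<in> clopens" and e: "e \<in> R" and x: "x = 0 \<or> x = 1"
    and z: "z \<in> side e x" "w \<in> side e x" "z \<in> U"
  shows "w \<in> U"
proof -
  have sub: "side e x \<subseteq> surface_boundary Surf" unfolding surface_boundary_Surf using e x by blast
  have "openin (top_of_set (side e x)) (side e x \<inter> U)" "closedin (top_of_set (side e x)) (side e x \<inter> U)"
    using U sub unfolding clopens_def openin_open closedin_closed by blast+
  then have "side e x \<inter> U = {} \<or> side e x \<inter> U = side e x" using connected_side[OF e x] connected_clopen by blast
  then show ?thesis using z by blast
qed

text \<open>A clopen subset of the boundary colours the gaps in the same way as its data, because the two
colourings agree at the base point and change at the same ribbon ends.\<close>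

lemma clopen_colour:
  assumes U: "U \<in> clopens" and S: "S = {e \<in> R. (g (a e) \<in> U) \<noteq> (g (b e) \<in> U)}" and t: "t \<in> gaps"
  shows "g t \<in> U \<longleftrightarrow> colour (g 0 \<in> U) S t"
proof -
  let ?X = "surface_boundary Surf"
  have SR: "S \<subseteq> R" using S by blast
  have "closed U" using U closed_boundary_Surf closedin_closed_trans unfolding clopens_def by blast
  have "closedin (top_of_set ?X) (?X - U)" using U closedin_diff[of "top_of_set ?X" ?X U] unfolding clopens_def by auto
  then have "closed (?X - U)" using closed_boundary_Surf closedin_closed_trans by blast
  have gX: "g t \<in> ?X" if "t \<in> gaps" for t unfolding surface_boundary_Surf using that by blast
  have cg: "closed gaps" unfolding gaps_eq by (rule I.closed_rest)
  have gc: "continuous_on gaps g" using continuous_on_subset[OF g_cont gaps_01] .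
  have "closed (gaps \<inter> g -` U)" by (rule continuous_closed_preimage[OF gc cg \<open>closed U\<close>])
  moreover have "closed (gaps \<inter> g -` (?X - U))" by (rule continuous_closed_preimage[OF gc cg \<open>closed (?X - U)\<close>])
  moreover have "{t \<in> gaps. (g t \<in> U) = y} = (if y then gaps \<inter> g -` U else gaps \<inter> g -` (?X - U))" for y using gX by auto
  ultimately have cU: "closed {t \<in> gaps. (g t \<in> U) = y}" for y by simp
  define P where "P t \<longleftrightarrow> (g t \<in> U) = colour (g 0 \<in> U) S t" for t
  have cP: "closed {t \<in> gaps. P t = y}" for y
  proof -
    have "{t \<in> gaps. P t = y} = ({t \<in> gaps. (g t \<in> U) = True} \<inter> {t \<in> gaps. colour (g 0 \<in> U) S t = y}) \<union>
       ({t \<in> gaps. (g t \<in> U) = False} \<inter> {t \<in> gaps. colour (g 0 \<in> U) S t = (\<not> y)})" unfolding P_def by auto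
    moreover have "closed (({t \<in> gaps. (g t \<in> U) = True} \<inter> {t \<in> gaps. colour (g 0 \<in> U) S t = y}) \<union>
       ({t \<in> gaps. (g t \<in> U) = False} \<inter> {t \<in> gaps. colour (g 0 \<in> U) S t = (\<not> y)}))"
      by (intro closed_Un closed_Int cU closed_gaps_colour)
    ultimately show ?thesis by simp
  qed
  have sidemem: "g (side_start e x) \<in> U \<longleftrightarrow> g (side_end e x) \<in> U" if "e \<in> R" "x = 0 \<or> x = 1" for e x
    using clopen_side[OF U that] side_mem_corners[OF that] by blast
  \<comment> \<open>The sides carry the change of colour from the first end of a ribbon to the second one.\<close>
  have cd: "(g (c e) \<in> U) \<noteq> (g (d e) \<in> U) \<longleftrightarrow> e \<in> S" if e: "e \<in> R" for e
    using sidemem[OF e, of 0] sidemem[OF e, of 1] e by (cases "tw e") (auto simp: side_start_def side_end_def S)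
  have "P t = P 0"
  proof (rule I.rest_constant)
    show "closed {t \<in> I.rest. P t}" "closed {t \<in> I.rest. \<not> P t}" using cP[of True] cP[of False] by (simp_all add: gaps_eq)
    show "t \<in> I.rest" using t by (simp add: gaps_eq)
    fix p assume p: "p \<in> ends R"
    then obtain e where e: "e \<in> R" "p = (a e, b e) \<or> p = (c e, d e)" unfolding ends_def by blast
    have ab: "(g (a e) \<in> U) \<noteq> (g (b e) \<in> U) \<longleftrightarrow> e \<in> S" using e(1) S by blast
    have "P (a e) = P (b e)" unfolding P_def using ab colour_flip_ribbon(1)[OF e(1) SR, of "g 0 \<in> U"] by argo
    moreover have "P (c e) = P (d e)" unfolding P_def using cd[OF e(1)] colour_flip_ribbon(2)[OF e(1) SR, of "g 0 \<in> U"] by argo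
    ultimately show "P (fst p) = P (snd p)" using e(2) by (elim disjE) simp_all
  qed
  then show ?thesis unfolding P_def by (simp add: colour_0)
qed

text \<open>Sides are connected, so they transport colours.\<close>

lemma data_kernel:
  assumes U: "U \<in> clopens" shows "snd (colour_data U) \<in> kernel_sets"
proof -
  define S where "S = {e \<in> R. (g (a e) \<in> U) \<noteq> (g (b e) \<in> U)}"
  have SR: "S \<subseteq> R" unfolding S_def by blast
  have "even (card {f \<in> S. crossing e f} + (if tw e \<and> e \<in> S then 1 else 0))" if e: "e \<in> R" for e
  proof -
    have "g (side_start e 0) \<in> U \<longleftrightarrow> g (side_end e 0) \<in> U" using clopen_side[OF U e, of 0] side_mem_corners[OF e, of 0] by blast
    then have "colour (g 0 \<in> U) S (side_start e 0) = colour (g 0 \<in> U) S (side_end e 0)" using clopen_colour[OF U S_def] side_ends_gaps[OF e] by blast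
    then show ?thesis using colour_side_iff[OF e SR, of 0] by blast
  qed
  then show ?thesis unfolding kernel_sets_def colour_data_def S_def[symmetric] using SR by simp
qed

lemma inj_data: "inj_on colour_data clopens"
proof (rule inj_onI)
  have main: "U \<subseteq> W" if U: "U \<in> clopens" and W: "W \<in> clopens" and eq: "colour_data U = colour_data W" for U W
  proof
    fix z assume z: "z \<in> U"
    have gap: "g t \<in> U \<longleftrightarrow> g t \<in> W" if "t \<in> gaps" for t
      using clopen_colour[OF U refl that] clopen_colour[OF W refl that] eq unfolding colour_data_def by simp
    have "z \<in> surface_boundary Surf" using U z openin_imp_subset unfolding clopens_def by blast
    then consider t where "t \<in> gaps" "z = g t" | e x where "e \<in> R" "x = 0 \<or> x = 1" "z \<in> side e x"
      unfolding surface_boundary_Surf by blast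
    then show "z \<in> W"
    proof cases
      case 1 then show ?thesis using gap z by blast
    next
      case 2
      have m: "g (side_start e x) \<in> side e x" by (rule side_mem_corners(1)[OF 2(1,2)])
      have "g (side_start e x) \<in> U" by (rule clopen_side[OF U 2 m z])
      then have "g (side_start e x) \<in> W" using gap side_ends_gaps(1)[OF 2(1)] by blast
      then show ?thesis using clopen_side[OF W 2(1,2) m 2(3)] by blast
    qed
  qed
  fix U W assume "U \<in> clopens" "W \<in> clopens" "colour_data U = colour_data W"
  then show "U = W" using main[of U W] main[of W U] by simp
qed

lemma data_image: "colour_data ` clopens = UNIV \<times> kernel_sets"
proof (intro equalityI subsetI)
  fix y :: "bool \<times> 'a set set" assume "y \<in> colour_data ` clopens" then show "y \<in> UNIV \<times> kernel_sets" using data_kernel by (metis imageE UNIV_I mem_Times_iff)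
next
  fix y :: "bool \<times> 'a set set" assume "y \<in> UNIV \<times> kernel_sets"
  then obtain x S where y: "y = (x, S)" "S \<in> kernel_sets" by blast
  then show "y \<in> colour_data ` clopens" using colour_class_data[OF y(2), of x] by (metis imageI)
qed

text \<open>Two-colourings of the faces correspond to a colour of the base point together with a vector of the
kernel.\<close>

theorem count_faces: "2 ^ card (components (surface_boundary Surf)) = 2 * card kernel_sets"
proof -
  have finK: "finite kernel_sets" unfolding kernel_sets_def using finR by simp
  have "finite (colour_data ` clopens)" unfolding data_image using finK by simp
  then have "finite clopens" using inj_data finite_imageD by blast
  then have "card clopens = 2 ^ card (components (surface_boundary Surf))" using clopen_card unfolding clopens_def by blast
  moreover have "card clopens = card (colour_data ` clopens)" using inj_data by (simp add: card_image)
  moreover have "\<dots> = 2 * card kernel_sets" unfolding data_image by (simp add: card_cartesian_product)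
  ultimately show ?thesis by simp
qed

end

section \<open>The number of vectors in the kernel of a matrix over GF(2)\<close>

text \<open>Coordinates with respect to a basis; for an infinite field and positive dimension both sides are 0.\<close>

lemma card_vectorspace:
  assumes V: "vectorspace K V" and fd: "vectorspace.fin_dim K V"
  shows "card (carrier V) = card (carrier K) ^ vectorspace.dim K V"
proof -
  interpret vectorspace K V by (rule V)
  obtain B where B: "finite B" "basis B" using finite_basis_exists[OF fd] by blast
  then have BV: "B \<subseteq> carrier V" by (simp add: basis_def)
  have crit: "\<exists>!a. a \<in> B \<rightarrow>\<^sub>E carrier K \<and> lincomb a B = v" if "v \<in> carrier V" for v
    using basis_criterion[OF B(1) BV] B(2) that by blast
  have cl: "lincomb a B \<in> carrier V" if "a \<in> B \<rightarrow>\<^sub>E carrier K" for a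
    using that BV by (intro lincomb_closed) auto
  have "bij_betw (\<lambda>a. lincomb a B) (B \<rightarrow>\<^sub>E carrier K) (carrier V)"
    unfolding bij_betw_def
  proof
    show "inj_on (\<lambda>a. lincomb a B) (B \<rightarrow>\<^sub>E carrier K)"
    proof (rule inj_onI)
      fix x y assume "x \<in> B \<rightarrow>\<^sub>E carrier K" "y \<in> B \<rightarrow>\<^sub>E carrier K" "lincomb x B = lincomb y B"
      then show "x = y" using crit[OF cl[of y]] by blast
    qed
    show "(\<lambda>a. lincomb a B) ` (B \<rightarrow>\<^sub>E carrier K) = carrier V"
    proof (intro equalityI subsetI)
      fix v assume "v \<in> carrier V"
      then show "v \<in> (\<lambda>a. lincomb a B) ` (B \<rightarrow>\<^sub>E carrier K)" using crit by blast
    qed (use cl in blast)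
  qed
  then have "card (carrier V) = card (B \<rightarrow>\<^sub>E carrier K)" using bij_betw_same_card by fastforce
  also have "\<dots> = card (carrier K) ^ card B" using B(1) by (simp add: card_PiE)
  finally show ?thesis using dim_basis[OF B] by simp
qed

lemma card_UNIV_bit: "card (UNIV :: bit set) = 2"
proof -
  have "(UNIV :: bit set) = {0, 1}" using bit_not_one_iff by blast
  then show ?thesis by (metis card_2_iff zero_neq_one)
qed

lemma card_col_space_bit:
  fixes A :: "bit mat"
  assumes A: "A \<in> carrier_mat n nc"
  shows "card {A *\<^sub>v x | x. x \<in> carrier_vec nc} = 2 ^ vec_space.rank n A"
proof -
  interpret vec_space "TYPE(bit)" n .
  let ?W = "span (set (cols A))"
  have sub: "set (cols A) \<subseteq> carrier_vec n" using cols_dim[of A] A by auto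
  have W: "vectorspace class_ring (vs ?W)" by (rule subspace_is_vs[OF span_is_subspace[OF sub]])
  have "card (carrier (vs ?W)) = card (carrier (class_ring :: bit ring)) ^ vectorspace.dim class_ring (vs ?W)"
    by (rule card_vectorspace[OF W fin_dim_span_cols[OF A]])
  moreover have "?W = {A *\<^sub>v x | x. x \<in> carrier_vec nc}"
  proof -
    have cl: "A *\<^sub>v x \<in> carrier_vec n" if "x \<in> carrier_vec nc" for x by (rule mult_mat_vec_carrier[OF A that])
    have "?W = {y \<in> carrier_vec n. \<exists>x\<in>carrier_vec nc. A *\<^sub>v x = y}"
      using col_space_eq[OF A] unfolding col_space_def carrier_matD(1)[OF A] carrier_matD(2)[OF A] .
    also have "\<dots> = {A *\<^sub>v x | x. x \<in> carrier_vec nc}"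
      using cl by (intro equalityI subsetI; elim CollectE conjE bexE exE) blast+
    finally show ?thesis .
  qed
  ultimately show ?thesis unfolding rank_def by (simp add: card_UNIV_bit)
qed

text \<open>Rank-nullity in counting form: all nonempty fibres of \<open>x \<mapsto> A x\<close> are translates of the kernel.\<close>

lemma rank_nullity_bit:
  fixes A :: "bit mat"
  assumes A: "A \<in> carrier_mat n nc" and fin: "finite (carrier_vec nc :: bit vec set)"
  shows "card (carrier_vec nc :: bit vec set) = 2 ^ vec_space.rank n A * card {x \<in> carrier_vec nc. A *\<^sub>v x = 0\<^sub>v n}"
proof -
  let ?C = "carrier_vec nc :: bit vec set" and ?f = "\<lambda>x. A *\<^sub>v x" and ?K = "{x \<in> carrier_vec nc. A *\<^sub>v x = 0\<^sub>v n}"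
  have fib: "card {x \<in> ?C. ?f x = y} = card ?K" if y: "y \<in> ?f ` ?C" for y
  proof -
    obtain x0 where x0: "x0 \<in> ?C" "y = ?f x0" using y by blast
    have "bij_betw (\<lambda>x. x + x0) ?K {x \<in> ?C. ?f x = y}"
    proof (rule bij_betw_byWitness[where f' = "\<lambda>x. x - x0"])
      show "\<forall>x\<in>?K. x + x0 - x0 = x" using x0(1) by (intro ballI eq_vecI) auto
      show "\<forall>x\<in>{x \<in> ?C. ?f x = y}. x - x0 + x0 = x" using x0(1) by (intro ballI eq_vecI) auto
      show "(\<lambda>x. x + x0) ` ?K \<subseteq> {x \<in> ?C. ?f x = y}"
        using x0 A by (auto simp: mult_add_distrib_mat_vec[OF A])
      show "(\<lambda>x. x - x0) ` {x \<in> ?C. ?f x = y} \<subseteq> ?K"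
        using x0 A by (auto simp: mult_minus_distrib_mat_vec[OF A])
    qed
    then show ?thesis by (rule bij_betw_same_card[symmetric])
  qed
  have "card ?C = (\<Sum>y\<in>?f ` ?C. card {x \<in> ?C. ?f x = y})"
    using sum.image_gen[OF fin, of "\<lambda>_. 1::nat" ?f] by simp
  also have "\<dots> = card (?f ` ?C) * card ?K" using fib by simp
  also have "?f ` ?C = {A *\<^sub>v x | x. x \<in> carrier_vec nc}" by blast
  finally show ?thesis using card_col_space_bit[OF A] by simp
qed

lemma of_nat_bit_eq_0: "(of_nat m :: bit) = 0 \<longleftrightarrow> even m"
  by (induction m) auto

text \<open>Vectors over GF(2) are identified with their supports.\<close>

lemma card_kernel_sets_rank:
  fixes es :: "'b list" and M :: "'b \<Rightarrow> 'b \<Rightarrow> bool"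
  assumes dist: "distinct es"
    and A: "A = Matrix.mat (length es) (length es) (\<lambda>(i, j). of_bool (M (es ! i) (es ! j)) :: bit)"
  shows "2 ^ length es = 2 ^ vec_space.rank (length es) A * card {S \<in> Pow (set es). \<forall>e\<in>set es. even (card {f \<in> S. M e f})}"
proof -
  let ?n = "length es"
  define ind where "ind S = Matrix.vec ?n (\<lambda>i. of_bool (es ! i \<in> S) :: bit)" for S
  have bij: "bij_betw ind (Pow (set es)) (carrier_vec ?n)"
  proof (rule bij_betw_byWitness[where f' = "\<lambda>x. {es ! i | i. i < ?n \<and> x $ i = 1}"])
    show "\<forall>S\<in>Pow (set es). {es ! i |i. i < ?n \<and> ind S $ i = 1} = S"
    proof
      fix S assume S: "S \<in> Pow (set es)"
      have i1: "ind S $ i = 1 \<longleftrightarrow> es ! i \<in> S" if "i < ?n" for i using that by (simp add: ind_def)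
      show "{es ! i |i. i < ?n \<and> ind S $ i = 1} = S"
      proof (intro equalityI subsetI)
        fix x assume x: "x \<in> S"
        then obtain i where "i < ?n" "es ! i = x" using S by (metis PowD in_set_conv_nth subsetD)
        then show "x \<in> {es ! i |i. i < ?n \<and> ind S $ i = 1}" using x i1 by blast
      qed (use i1 in auto)
    qed
    show "\<forall>x\<in>carrier_vec ?n. ind {es ! i |i. i < ?n \<and> x $ i = 1} = x"
    proof
      fix x :: "bit vec" assume x: "x \<in> carrier_vec ?n"
      show "ind {es ! i |i. i < ?n \<and> x $ i = 1} = x"
      proof (rule eq_vecI)
        fix i assume "i < dim_vec x"
        then have i: "i < ?n" using x by simp
        have "es ! i \<in> {es ! i |i. i < ?n \<and> x $ i = 1} \<longleftrightarrow> x $ i = 1"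
          using dist i by (auto simp: nth_eq_iff_index_eq)
        then show "ind {es ! i |i. i < ?n \<and> x $ i = 1} $ i = x $ i"
          using i by (cases "x $ i") (auto simp: ind_def)
      qed (use x in \<open>simp add: ind_def\<close>)
    qed
  qed (auto simp: ind_def)
  have AC: "A \<in> carrier_mat ?n ?n" unfolding A by simp
  have ker: "A *\<^sub>v ind S = 0\<^sub>v ?n \<longleftrightarrow> (\<forall>e\<in>set es. even (card {f \<in> S. M e f}))" if S: "S \<subseteq> set es" for S
  proof -
    have ent: "(A *\<^sub>v ind S) $ i = of_nat (card {f \<in> S. M (es ! i) f})" if i: "i < ?n" for i
    proof -
      have "(A *\<^sub>v ind S) $ i = (\<Sum>j<?n. of_bool (M (es ! i) (es ! j)) * of_bool (es ! j \<in> S))"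
        using i by (auto simp: A ind_def scalar_prod_def lessThan_atLeast0 intro!: sum.cong)
      also have "\<dots> = (\<Sum>j<?n. of_bool (es ! j \<in> {f \<in> S. M (es ! i) f}))"
        by (intro sum.cong) auto
      also have "\<dots> = (\<Sum>f\<in>set es. of_bool (f \<in> {f \<in> S. M (es ! i) f}))"
        by (rule sum.reindex_bij_betw) (use dist bij_betw_nth in \<open>auto simp: lessThan_def intro!: bij_betw_nth\<close>)
      also have "\<dots> = of_nat (card (set es \<inter> {f \<in> S. M (es ! i) f}))"
        by (simp add: Int_def)
      also have "set es \<inter> {f \<in> S. M (es ! i) f} = {f \<in> S. M (es ! i) f}" using S by blast
      finally show ?thesis .
    qed
    have "A *\<^sub>v ind S = 0\<^sub>v ?n \<longleftrightarrow> (\<forall>i<?n. (A *\<^sub>v ind S) $ i = 0)"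
      using AC by (auto simp: vec_eq_iff)
    also have "\<dots> \<longleftrightarrow> (\<forall>i<?n. even (card {f \<in> S. M (es ! i) f}))" using ent of_nat_bit_eq_0 by simp
    also have "\<dots> \<longleftrightarrow> (\<forall>e\<in>set es. even (card {f \<in> S. M e f}))" by (simp only: all_set_conv_all_nth)
    finally show ?thesis .
  qed
  have fin: "finite (carrier_vec ?n :: bit vec set)" using bij bij_betw_finite by blast
  have cardC: "card (carrier_vec ?n :: bit vec set) = 2 ^ ?n"
    using bij_betw_same_card[OF bij] by (simp add: card_Pow distinct_card[OF dist])
  have "bij_betw ind {S \<in> Pow (set es). \<forall>e\<in>set es. even (card {f \<in> S. M e f})} {x \<in> carrier_vec ?n. A *\<^sub>v x = 0\<^sub>v ?n}"
  proof (rule bij_betw_subset[OF bij])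
    show "ind ` {S \<in> Pow (set es). \<forall>e\<in>set es. even (card {f \<in> S. M e f})} = {x \<in> carrier_vec ?n. A *\<^sub>v x = 0\<^sub>v ?n}"
    proof (intro equalityI subsetI)
      fix x assume x: "x \<in> {x \<in> carrier_vec ?n. A *\<^sub>v x = 0\<^sub>v ?n}"
      then have "x \<in> ind ` Pow (set es)" using bij by (simp add: bij_betw_def)
      then obtain S where "S \<subseteq> set es" "x = ind S" by blast
      then show "x \<in> ind ` {S \<in> Pow (set es). \<forall>e\<in>set es. even (card {f \<in> S. M e f})}" using x ker by blast
    next
      fix x assume "x \<in> ind ` {S \<in> Pow (set es). \<forall>e\<in>set es. even (card {f \<in> S. M e f})}"
      then obtain S where S: "S \<subseteq> set es" "x = ind S" "\<forall>e\<in>set es. even (card {f \<in> S. M e f})" by blast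
      then show "x \<in> {x \<in> carrier_vec ?n. A *\<^sub>v x = 0\<^sub>v ?n}" using ker[OF S(1)] by (simp add: ind_def)
    qed
  qed blast
  then have "card {x \<in> carrier_vec ?n. A *\<^sub>v x = 0\<^sub>v ?n} = card {S \<in> Pow (set es). \<forall>e\<in>set es. even (card {f \<in> S. M e f})}"
    by (rule bij_betw_same_card[symmetric])
  then show ?thesis using rank_nullity_bit[OF AC fin] cardC by simp
qed

section \<open>Interlaced loops\<close>

context ribboned_disc begin

lemma end_mem: "e \<in> R \<Longrightarrow> t \<in> {a e..b e} \<union> {c e..d e} \<Longrightarrow> g t \<in> e"
  using attach[of e] by blast

lemma crossing_irrefl: "e \<in> R \<Longrightarrow> \<not> crossing e e"
  by (simp add: crossing_def)

text \<open>If the first end met by \<open>g\<close> belongs to \<open>f\<close> then the reversed loop meets \<open>e\<close> first.\<close>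

lemma crossing_interlaced:
  assumes e: "e \<in> R" and f: "f \<in> R" and v: "the_vdisc B = v" and cr: "crossing e f"
  shows "interlaced B e f"
proof -
  have ne: "e \<noteq> f" using cr by (auto simp: crossing_def)
  note o = order[OF e] order[OF f]
  have ge: "g (a e) \<in> e" "g (c e) \<in> e" using end_mem[OF e] o by auto
  have gf: "g (a f) \<in> f" "g (c f) \<in> f" using end_mem[OF f] o by auto
  from cr consider "a e < a f" "a f < c e" "c e < c f" | "a f < a e" "a e < c f" "c f < c e" unfolding crossing_def by blast
  then show ?thesis
  proof cases
    case 1
    have "0 \<le> a e \<and> a e < a f \<and> a f < c e \<and> c e < c f \<and> c f < 1 \<and> g (a e) \<in> e \<and> g (a f) \<in> f \<and> g (c e) \<in> e \<and> g (c f) \<in> f"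
      using 1 o ge gf by auto
    then show ?thesis unfolding interlaced_def v using ne loop[unfolded simple_loop_def] by blast
  next
    case 2
    let ?g = "reversepath g"
    have "0 \<le> 1 - c e \<and> 1 - c e < 1 - c f \<and> 1 - c f < 1 - a e \<and> 1 - a e < 1 - a f \<and> 1 - a f < 1 \<and>
       ?g (1 - c e) \<in> e \<and> ?g (1 - c f) \<in> f \<and> ?g (1 - a e) \<in> e \<and> ?g (1 - a f) \<in> f"
      using 2 o ge gf by (auto simp: reversepath_def)
    then show ?thesis unfolding interlaced_def v using ne simple_loop_reversepath[OF loop, unfolded simple_loop_def] by blast
  qed
qed

text \<open>If the ends of \<open>e\<close> and \<open>f\<close> do not alternate along \<open>g\<close>, then some arc \<open>C\<close> of the
circle joins the two ends of \<open>f\<close> and avoids \<open>e\<close>. But a loop that meets \<open>e\<close>, \<open>f\<close>,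
\<open>e\<close>, \<open>f\<close> in this order separates the two visits to \<open>f\<close> by those to \<open>e\<close>.\<close>

lemma interlaced_crossing:
  assumes e: "e \<in> R" and f: "f \<in> R" and v: "the_vdisc B = v" and il: "interlaced B e f"
  shows "crossing e f"
proof (rule ccontr)
  assume nc: "\<not> crossing e f"
  obtain g' t1 t2 t3 t4 where ne: "e \<noteq> f" and g': "simple_loop g' (surface_boundary v)"
    and t: "0 \<le> t1" "t1 < t2" "t2 < t3" "t3 < t4" "t4 < 1" and m: "g' t1 \<in> e" "g' t2 \<in> f" "g' t3 \<in> e" "g' t4 \<in> f"
    using il unfolding interlaced_def v simple_loop_def by blast
  note o = order[OF e] order[OF f]
  note ap = ends_apart[OF e f ne]
  \<comment> \<open>If both ends of \<open>f\<close> lie on the same side of the ends of \<open>e\<close>, use the part of the loop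
    between them, otherwise the part through the base point.\<close>
  define C where "C = (if (a e < a f \<and> a f < c e \<or> a f < a e \<and> c f < a e \<or> c e < a f) then g ` {a f..d f} else g ` ({0..b f} \<union> {c f..1}))"
  have conn: "connected C"
  proof -
    have "connected (g ` {a f..d f})" using o by (intro connected_continuous_image continuous_on_subset[OF g_cont]) auto
    moreover have "connected (g ` {0..b f} \<union> g ` {c f..1})"
    proof (rule connected_Un)
      show "connected (g ` {0..b f})" "connected (g ` {c f..1})"
        using o by (auto intro!: connected_continuous_image continuous_on_subset[OF g_cont])
      have "g 0 \<in> g ` {0..b f}" "g 1 \<in> g ` {c f..1}" using o by auto
      then show "g ` {0..b f} \<inter> g ` {c f..1} \<noteq> {}" using simple_loop_closed[OF loop] by auto
    qed
    ultimately show ?thesis by (simp add: C_def image_Un)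
  qed
  have Csub: "C \<subseteq> surface_boundary v" unfolding C_def simple_loop_image[OF loop, symmetric] using o by auto
  have fC: "f \<inter> surface_boundary v \<subseteq> C"
  proof -
    have "f \<inter> surface_boundary v \<subseteq> g ` ({a f..b f} \<union> {c f..d f})" using attach[OF f] surface_boundary_subset[of v] by (auto simp: image_Un)
    also have "\<dots> \<subseteq> C" unfolding C_def using o by auto
    finally show ?thesis .
  qed
  have Ce: "C \<inter> e = {}"
  proof -
    have no: "g s \<notin> e" if s: "s \<in> {0..1}" "s \<notin> {a e..b e} \<union> {c e..d e}" for s
    proof
      assume "g s \<in> e"
      moreover have "g s \<in> v" using s(1) simple_loop_image[OF loop] surface_boundary_subset[of v] by blast
      ultimately have "g s \<in> g ` {a e..b e} \<union> g ` {c e..d e}" using attach[OF e] by blast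
      then obtain u where u: "u \<in> {a e..b e} \<union> {c e..d e}" "g s = g u" by blast
      then have "s = u" using g_eqD[of s u] s(1) o by auto
      then show False using u s by blast
    qed
    show ?thesis
    proof (cases "a e < a f \<and> a f < c e \<or> a f < a e \<and> c f < a e \<or> c e < a f")
      case True
      have "s \<notin> {a e..b e} \<union> {c e..d e}" if "s \<in> {a f..d f}" for s
        using True that nc ap o unfolding crossing_def atLeastAtMost_iff Un_iff by argo
      moreover have "{a f..d f} \<subseteq> {0..1}" using o by auto
      moreover have "C = g ` {a f..d f}" using True by (simp add: C_def)
      ultimately show ?thesis using no by blast
    next
      case False
      have "s \<notin> {a e..b e} \<union> {c e..d e}" if "s \<in> {0..b f} \<union> {c f..1}" for s
        using False that nc ap o unfolding crossing_def atLeastAtMost_iff Un_iff by argo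
      moreover have "{0..b f} \<union> {c f..1} \<subseteq> {0..1}" using o by auto
      moreover have "C = g ` ({0..b f} \<union> {c f..1})" using False by (simp only: C_def if_False)
      ultimately show ?thesis using no by blast
    qed
  qed
  have g'c: "continuous_on {0..1} g'" by (rule simple_loop_continuous[OF g'])
  \<comment> \<open>The two parts into which the first and the third time cut the circle.\<close>
  define A1 where "A1 = g' ` {t1..t3}"
  define A2 where "A2 = g' ` ({0..t1} \<union> {t3..1})"
  have cl: "closed (g' ` X)" if "compact X" "X \<subseteq> {0..1}" for X
    using that by (intro compact_imp_closed compact_continuous_image continuous_on_subset[OF g'c])
  have c1: "closed A1" unfolding A1_def by (rule cl) (use t in auto)
  have c2: "closed A2" unfolding A2_def by (rule cl) (use t in auto)
  have cov: "C \<subseteq> A1 \<union> A2"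
  proof -
    have "{0..1} \<subseteq> {t1..t3} \<union> ({0..t1} \<union> {t3..1})" by auto
    then have "g' ` {0..1} \<subseteq> A1 \<union> A2" unfolding A1_def A2_def image_Un[symmetric] by (rule image_mono)
    then show ?thesis using Csub simple_loop_image[OF g'] by blast
  qed
  have int: "A1 \<inter> A2 \<inter> C = {}"
  proof -
    have "z \<in> e" if z: "z \<in> A1" "z \<in> A2" for z
    proof -
      obtain s u where su: "s \<in> {t1..t3}" "z = g' s" "u \<in> {0..t1} \<union> {t3..1}" "z = g' u" using z unfolding A1_def A2_def by blast
      then have "s = u \<or> s = 0 \<and> u = 1 \<or> s = 1 \<and> u = 0" using simple_loop_eqD[OF g', of s u] t by auto
      then have "s = t1 \<or> s = t3" using su t by auto
      then show ?thesis using su m by auto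
    qed
    then show ?thesis using Ce by blast
  qed
  have gv: "g' s \<in> surface_boundary v" if "s \<in> {0..1}" for s using that simple_loop_image[OF g'] by blast
  have "g' t2 \<in> A1 \<inter> C" using fC m gv[of t2] t unfolding A1_def by auto
  moreover have "g' t4 \<in> A2 \<inter> C" using fC m gv[of t4] t unfolding A2_def by auto
  ultimately show False using connected_closedD[OF conn int cov c1 c2] by blast
qed

lemma interlaced_iff_crossing:
  "e \<in> R \<Longrightarrow> f \<in> R \<Longrightarrow> the_vdisc B = v \<Longrightarrow> interlaced B e f \<longleftrightarrow> crossing e f"
  using crossing_interlaced interlaced_crossing by blast

end

section \<open>The faces of a bouquet\<close>

text \<open>The coordinates of one ribbon: its ends are intervals of times that avoid the base point, the
earlier one is put at the bottom of the square, and the twist records the direction of the other.\<close>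

lemma ribboned_disc_single:
  fixes v e :: "'a::t2_space set"
  assumes v: "closed_disc v" and e: "closed_disc e" and g: "simple_loop g (surface_boundary v)" "g 0 \<notin> e"
    and comps: "components (v \<inter> e) = {s, s'}" "s \<noteq> s'"
    and arcs: "\<And>u. u \<in> {s, s'} \<Longrightarrow> u homeomorphic {0..1::real} \<and> u \<subseteq> surface_boundary v \<inter> surface_boundary e"
  shows "\<exists>a b c d h k tw. 0 < a \<and> a < b \<and> b < c \<and> c < d \<and> d < 1 \<and> homeomorphism unit_square e h k \<and>
    v \<inter> e = g ` {a..b} \<union> g ` {c..d} \<and> (\<forall>x\<in>{0..1}. h (Complex x 0) = segpath g a b x) \<and>
    (\<forall>x\<in>{0..1}. h (Complex x 1) = (if tw then segpath g c d x else segpath g d c x))"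
proof -
  have disj: "s \<inter> s' = {}" using comps components_nonoverlap[of s "v \<inter> e" s'] by blast
  have un: "v \<inter> e = s \<union> s'" using Union_components[of "v \<inter> e"] comps(1) by auto
  have sub: "s \<subseteq> e" "s' \<subseteq> e" using un by auto
  have I: "\<exists>a b. 0 < a \<and> a < b \<and> b < 1 \<and> u = g ` {a..b}" if u: "u \<in> {s, s'}" for u
  proof -
    obtain p where p: "arc p" "path_image p = u" using homeomorphic_interval_arc arcs[OF u] by blast
    have "g 0 \<notin> path_image p" using g(2) p(2) u sub by blast
    moreover have "path_image p \<subseteq> surface_boundary v" using p(2) arcs[OF u] by blast
    ultimately show ?thesis using arc_in_loop[OF g(1) p(1)] p(2) by blast
  qed
  \<comment> \<open>Order the two ends by the time at which the loop meets them.\<close>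
  obtain a1 b1 where 1: "0 < a1" "a1 < b1" "b1 < 1" "s = g ` {a1..b1}" using I[of s] by blast
  obtain a2 b2 where 2: "0 < a2" "a2 < b2" "b2 < 1" "s' = g ` {a2..b2}" using I[of s'] by blast
  have "b1 < a2 \<or> b2 < a1"
  proof (rule ccontr)
    assume "\<not> ?thesis"
    then have "max a1 a2 \<in> {a1..b1}" "max a1 a2 \<in> {a2..b2}" using 1 2 by auto
    then show False using disj 1(4) 2(4) by blast
  qed
  then have "\<exists>a b c d. 0 < a \<and> a < b \<and> b < c \<and> c < d \<and> d < 1 \<and> {s, s'} = {g ` {a..b}, g ` {c..d}}"
  proof
    assume "b1 < a2"
    then show ?thesis using 1 2 by (intro exI[of _ a1] exI[of _ b1] exI[of _ a2] exI[of _ b2]) auto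
  next
    assume "b2 < a1"
    then show ?thesis using 1 2 by (intro exI[of _ a2] exI[of _ b2] exI[of _ a1] exI[of _ b1]) auto
  qed
  then obtain a b c d where abcd: "0 < a" "a < b" "b < c" "c < d" "d < 1" "{s, s'} = {g ` {a..b}, g ` {c..d}}"
    by (elim exE conjE) (rule that)
  define p where "p = segpath g a b"
  define q where "q = segpath g d c"
  have p: "arc p" "path_image p = g ` {a..b}"
    using arc_segpath[OF g(1), of a b] segpath_image[of a b g] abcd by (auto simp: p_def path_image_def)
  have "q = reversepath (segpath g c d)" unfolding q_def reversepath_def by (rule ext) (rule segpath_rev)
  then have q: "arc q" "path_image q = g ` {c..d}"
    using arc_segpath[OF g(1), of c d] segpath_image[of c d g] abcd by (auto simp: arc_reversepath) (auto simp: path_image_def)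
  have mem: "g ` {a..b} \<in> {s, s'}" "g ` {c..d} \<in> {s, s'}" using abcd(6) by auto
  have "g ` {a..b} \<inter> g ` {c..d} = {}" 
  proof -
    have "g ` {a..b} \<noteq> g ` {c..d}" using abcd(6) comps(2) by (metis doubleton_eq_iff)
    then show ?thesis using disj mem by blast
  qed
  then have pq: "path_image p \<inter> path_image q = {}" unfolding p(2) q(2) .
  have pe: "path_image p \<subseteq> surface_boundary e" "path_image q \<subseteq> surface_boundary e"
    unfolding p(2) q(2) using arcs[OF mem(1)] arcs[OF mem(2)] by blast+
  from disc_as_square_two_arcs[OF e p(1) pe(1) q(1) pe(2) pq]
  obtain h k where h: "homeomorphism unit_square e h k" "\<forall>x\<in>{0..1}. h (Complex x 0) = p x"
     "(\<forall>x\<in>{0..1}. h (Complex x 1) = q x) \<or> (\<forall>x\<in>{0..1}. h (Complex x 1) = q (1 - x))"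
    by (elim exE conjE) (rule that)
  define tw where "tw \<longleftrightarrow> \<not> (\<forall>x\<in>{0..1}. h (Complex x 1) = q x)"
  have top: "\<forall>x\<in>{0..1}. h (Complex x 1) = (if tw then segpath g c d x else segpath g d c x)"
    using h(3) segpath_rev[of g d c] unfolding tw_def q_def by auto
  have att: "v \<inter> e = g ` {a..b} \<union> g ` {c..d}" 
  proof -
    have "\<Union>{s, s'} = \<Union>{g ` {a..b}, g ` {c..d}}" by (simp only: abcd(6))
    then show ?thesis unfolding un by simp
  qed
  have bot: "\<forall>x\<in>{0..1}. h (Complex x 0) = segpath g a b x" using h(2) unfolding p_def .
  show ?thesis
    by (intro exI[of _ a] exI[of _ b] exI[of _ c] exI[of _ d] exI[of _ h] exI[of _ k] exI[of _ tw] conjI)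
      (fact abcd h(1) att bot top)+
qed

text \<open>The base point of the loop is chosen outside all ribbon ends.\<close>

lemma bouquet_ribboned_disc:
  fixes B :: "'a::t2_space ribbon_structure"
  assumes B: "ribbon_graph B" and v: "vdiscs B = {v}"
  shows "\<exists>g a b c d h k tw. ribboned_disc v (ribbons B) g a b c d h k tw"
proof -
  let ?R = "ribbons B"
  have disc: "closed_disc v" "\<And>e. e \<in> ?R \<Longrightarrow> closed_disc e" and fin: "finite ?R" and disj: "disjoint ?R"
    using B v unfolding ribbon_graph_def by auto
  have arcs: "\<And>e s. e \<in> ?R \<Longrightarrow> s \<in> components (v \<inter> e) \<Longrightarrow> s homeomorphic {0..1::real} \<and> s \<subseteq> surface_boundary v \<inter> surface_boundary e"
    using B v unfolding ribbon_graph_def by blast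
  have "\<And>e. e \<in> ?R \<Longrightarrow> card (components (v \<inter> e)) = 2"
    using B v unfolding ribbon_graph_def ribbon_ends_def by simp
  then have two: "\<exists>s s'. components (v \<inter> e) = {s, s'} \<and> s \<noteq> s'" if "e \<in> ?R" for e
    using that by (metis card_2_iff)
  define \<S> where "\<S> = (\<Union>e\<in>?R. components (v \<inter> e))"
  have "finite (components (v \<inter> e))" if "e \<in> ?R" for e using two[OF that] by auto
  then have fS: "finite \<S>" unfolding \<S>_def using fin by blast
  have "disjoint \<S>" unfolding disjoint_def
  proof (intro ballI impI)
    fix s s' assume s: "s \<in> \<S>" "s' \<in> \<S>" "s \<noteq> s'"
    then obtain e e' where e: "e \<in> ?R" "s \<in> components (v \<inter> e)" "e' \<in> ?R" "s' \<in> components (v \<inter> e')" unfolding \<S>_def by blast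
    show "s \<inter> s' = {}"
    proof (cases "e = e'")
      case True
      then show ?thesis using e s components_nonoverlap by blast
    next
      case False
      then have "e \<inter> e' = {}" using disj e unfolding disjoint_def by blast
      then show ?thesis using e in_components_subset by blast
    qed
  qed
  then have "surface_boundary v \<noteq> \<Union>\<S>"
    by (rule arcs_not_cover_boundary[OF disc(1) fS]) (use arcs in \<open>auto simp: \<S>_def\<close>)
  moreover have "\<Union>\<S> \<subseteq> surface_boundary v" unfolding \<S>_def using arcs by blast
  ultimately obtain x where x: "x \<in> surface_boundary v" "x \<notin> \<Union>\<S>" by blast
  obtain g where g: "simple_loop g (surface_boundary v)" "g 0 = x" using closed_disc_boundary_loop[OF disc(1) x(1)] by blast
  have x0: "g 0 \<notin> e" if e: "e \<in> ?R" for e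
  proof
    assume "g 0 \<in> e"
    then have "x \<in> v \<inter> e" using x(1) g(2) surface_boundary_subset[of v] by blast
    then have "x \<in> \<Union>(components (v \<inter> e))" by simp
    then show False using x(2) e unfolding \<S>_def by blast
  qed
  define Q where "Q e a b c d h k tw \<longleftrightarrow> 0 < a \<and> a < b \<and> b < c \<and> c < d \<and> d < 1 \<and> homeomorphism unit_square e h k \<and>
    v \<inter> e = g ` {a..b} \<union> g ` {c..d} \<and> (\<forall>x\<in>{0..1}. h (Complex x 0) = segpath g a b x) \<and>
    (\<forall>x\<in>{0..1}. h (Complex x 1) = (if tw then segpath g c d x else segpath g d c x))" for e a b c d h k tw
  have "\<forall>e\<in>?R. \<exists>t. case t of (a, b, c, d, h, k, tw) \<Rightarrow> Q e a b c d h k tw"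
  proof
    fix e assume e: "e \<in> ?R"
    obtain s s' where s: "components (v \<inter> e) = {s, s'}" "s \<noteq> s'" using two[OF e] by blast
    have "\<exists>a b c d h k tw. Q e a b c d h k tw" unfolding Q_def
      by (rule ribboned_disc_single[OF disc(1) disc(2)[OF e] g(1) x0[OF e] s]) (use arcs[OF e] s in auto)
    then show "\<exists>t. case t of (a, b, c, d, h, k, tw) \<Rightarrow> Q e a b c d h k tw" by auto
  qed
  then obtain F where F: "\<forall>e\<in>?R. case F e of (a, b, c, d, h, k, tw) \<Rightarrow> Q e a b c d h k tw" by (rule bchoice[THEN exE])
  define a where "a e = fst (F e)" for e
  define b where "b e = fst (snd (F e))" for e
  define c where "c e = fst (snd (snd (F e)))" for e
  define d where "d e = fst (snd (snd (snd (F e))))" for e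
  define h where "h e = fst (snd (snd (snd (snd (F e)))))" for e
  define k where "k e = fst (snd (snd (snd (snd (snd (F e))))))" for e
  define tw where "tw e = snd (snd (snd (snd (snd (snd (F e))))))" for e
  have Q: "Q e (a e) (b e) (c e) (d e) (h e) (k e) (tw e)" if "e \<in> ?R" for e
    using F that unfolding a_def b_def c_def d_def h_def k_def tw_def by (simp add: case_prod_beta)
  have "ribboned_disc v ?R g a b c d h k tw"
    by unfold_locales (use disc(1) g(1) fin disj Q in \<open>simp_all add: Q_def\<close>)
  then show ?thesis by blast
qed

text \<open>The core of the theorem: it combines the count of the two-colourings of the faces with the count
of the kernel of the matrix, whose entries have been identified by the preceding results.\<close>

theorem bouquet_faces_rank:
  fixes B :: "'a::t2_space ribbon_structure"
  assumes B: "ribbon_graph B" and v: "vdiscs B = {v}" and es: "distinct es" "set es = ribbons B"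
  shows "card (faces B) + vec_space.rank (length es) (adj_SI B es) = length es + 1"
proof -
  obtain g a b c d h k tw where "ribboned_disc v (ribbons B) g a b c d h k tw" using bouquet_ribboned_disc[OF B v] by blast
  then interpret ribboned_disc v "ribbons B" g a b c d h k tw .
  have tv: "the_vdisc B = v" unfolding the_vdisc_def v by simp
  have S: "Surf = surface B" unfolding Surf_def surface_def v by simp
  define M where "M e f \<longleftrightarrow> (if e = f then tw e else crossing e f)" for e f
  have "adj_SI B es = Matrix.mat (length es) (length es) (\<lambda>(i, j). of_bool (M (es ! i) (es ! j)))"
  proof (rule eq_matI)
    fix i j assume "i < dim_row (Matrix.mat (length es) (length es) (\<lambda>(i, j). of_bool (M (es ! i) (es ! j)) :: bit))"
      "j < dim_col (Matrix.mat (length es) (length es) (\<lambda>(i, j). of_bool (M (es ! i) (es ! j)) :: bit))"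
    then have ij: "i < length es" "j < length es" by auto
    then have m: "es ! i \<in> ribbons B" "es ! j \<in> ribbons B" using es(2) nth_mem by blast+
    have "twisted B (es ! i) \<longleftrightarrow> tw (es ! i)" unfolding twisted_def tv by (rule homeomorphic_moebius_iff[OF m(1)])
    moreover have "interlaced B (es ! i) (es ! j) \<longleftrightarrow> crossing (es ! i) (es ! j)" by (rule interlaced_iff_crossing[OF m tv])
    ultimately show "adj_SI B es $$ (i, j) = Matrix.mat (length es) (length es) (\<lambda>(i, j). of_bool (M (es ! i) (es ! j))) $$ (i, j)"
      using ij es(1) by (cases "i = j") (simp_all add: adj_SI_def M_def nth_eq_iff_index_eq)
  qed (simp_all add: adj_SI_def)
  then have "2 ^ length es = 2 ^ vec_space.rank (length es) (adj_SI B es) * card {S \<in> Pow (set es). \<forall>e\<in>set es. even (card {f \<in> S. M e f})}"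
    by (rule card_kernel_sets_rank[OF es(1)])
  moreover have "{S \<in> Pow (set es). \<forall>e\<in>set es. even (card {f \<in> S. M e f})} = kernel_sets"
  proof -
    have "card {f \<in> S. M e f} = card {f \<in> S. crossing e f} + (if tw e \<and> e \<in> S then 1 else 0)" if S: "S \<subseteq> ribbons B" and e: "e \<in> ribbons B" for S e
    proof -
      have "finite S" using S finR finite_subset by blast
      have "{f \<in> S. M e f} = (if tw e \<and> e \<in> S then insert e {f \<in> S. crossing e f} else {f \<in> S. crossing e f})"
        using crossing_irrefl[OF e] by (auto simp: M_def)
      then show ?thesis using crossing_irrefl[OF e] \<open>finite S\<close> by simp
    qed
    then show ?thesis unfolding kernel_sets_def es(2) by auto
  qed
  ultimately have "2 ^ (length es + 1) = 2 ^ vec_space.rank (length es) (adj_SI B es) * (2 ^ card (faces B) :: nat)"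
    using count_faces unfolding S faces_def by simp
  then have "(2::nat) ^ (length es + 1) = 2 ^ (vec_space.rank (length es) (adj_SI B es) + card (faces B))" by (simp add: power_add)
  then have "length es + 1 = vec_space.rank (length es) (adj_SI B es) + card (faces B)" by (rule power_inject_exp[THEN iffD1, rotated]) simp
  then show ?thesis by simp
qed

section \<open>Contracting an edge\<close>

lemma components_Un_closed:
  assumes A: "closed A" and B: "closed B" and AB: "A \<inter> B = {}"
  shows "components (A \<union> B) = components A \<union> components B"
proof -
  have side: "C \<subseteq> A \<or> C \<subseteq> B" if "connected C" "C \<subseteq> A \<union> B" for C
    using connected_closedD[OF that(1) _ that(2) A B] AB that(2) by blast
  have "components X \<subseteq> components (X \<union> Y)" if XY: "X \<inter> Y = {}" "\<And>C. connected C \<Longrightarrow> C \<subseteq> X \<union> Y \<Longrightarrow> C \<subseteq> X \<or> C \<subseteq> Y" for X Y :: "'a set"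
  proof
    fix C assume C: "C \<in> components X"
    then have m: "C \<noteq> {}" "C \<subseteq> X" "connected C" "\<And>D. D \<noteq> {} \<Longrightarrow> C \<subseteq> D \<Longrightarrow> D \<subseteq> X \<Longrightarrow> connected D \<Longrightarrow> D = C"
      using in_components_maximal[of C X] by auto
    show "C \<in> components (X \<union> Y)" unfolding in_components_maximal
    proof (intro conjI allI impI)
      fix D assume D: "D \<noteq> {} \<and> C \<subseteq> D \<and> D \<subseteq> X \<union> Y \<and> connected D"
      then have "D \<subseteq> X" using XY(2)[of D] XY(1) m(1,2) by blast
      then show "D = C" using m(4)[of D] D by blast
    qed (use m in auto)
  qed
  from this[of A B] this[of B A] have "components A \<union> components B \<subseteq> components (A \<union> B)"
    using AB side by (simp add: Un_commute Int_commute) blast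
  moreover have "components (A \<union> B) \<subseteq> components A \<union> components B"
  proof
    fix C assume C: "C \<in> components (A \<union> B)"
    then have m: "C \<noteq> {}" "C \<subseteq> A \<union> B" "connected C" "\<And>D. D \<noteq> {} \<Longrightarrow> C \<subseteq> D \<Longrightarrow> D \<subseteq> A \<union> B \<Longrightarrow> connected D \<Longrightarrow> D = C"
      using in_components_maximal[of C "A \<union> B"] by auto
    have "C \<subseteq> A \<or> C \<subseteq> B" using side m by blast
    then show "C \<in> components A \<union> components B"
    proof
      assume "C \<subseteq> A" then have "C \<in> components A" unfolding in_components_maximal using m by blast
      then show ?thesis by blast
    next
      assume "C \<subseteq> B" then have "C \<in> components B" unfolding in_components_maximal using m by blast
      then show ?thesis by blast
    qed
  qed
  ultimately show ?thesis by blast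
qed

lemma ribbon_graphD:
  assumes "ribbon_graph G"
  shows "finite (vdiscs G)" "finite (ribbons G)" "\<And>v. v \<in> vdiscs G \<Longrightarrow> closed_disc v" "\<And>e. e \<in> ribbons G \<Longrightarrow> closed_disc e"
    "\<And>v w. v \<in> vdiscs G \<Longrightarrow> w \<in> vdiscs G \<Longrightarrow> v \<noteq> w \<Longrightarrow> v \<inter> w = {}"
    "\<And>e f. e \<in> ribbons G \<Longrightarrow> f \<in> ribbons G \<Longrightarrow> e \<noteq> f \<Longrightarrow> e \<inter> f = {}"
    "\<And>v e s. v \<in> vdiscs G \<Longrightarrow> e \<in> ribbons G \<Longrightarrow> s \<in> components (v \<inter> e) \<Longrightarrow> s homeomorphic {0..1::real}"
    "\<And>v e s. v \<in> vdiscs G \<Longrightarrow> e \<in> ribbons G \<Longrightarrow> s \<in> components (v \<inter> e) \<Longrightarrow> s \<subseteq> surface_boundary v \<inter> surface_boundary e"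
    "\<And>e. e \<in> ribbons G \<Longrightarrow> card (ribbon_ends G e) = 2"
proof -
  note * = assms[unfolded ribbon_graph_def]
  note 1 = *[THEN conjunct1] *[THEN conjunct2, THEN conjunct1] *[THEN conjunct2, THEN conjunct2, THEN conjunct1]
    *[THEN conjunct2, THEN conjunct2, THEN conjunct2, THEN conjunct1]
    *[THEN conjunct2, THEN conjunct2, THEN conjunct2, THEN conjunct2, THEN conjunct1]
  note 23 = *[THEN conjunct2, THEN conjunct2, THEN conjunct2, THEN conjunct2, THEN conjunct2]
  note 2 = 23[THEN conjunct1] and 3 = 23[THEN conjunct2]
  show "finite (vdiscs G)" "finite (ribbons G)" by (fact 1)+
  show "\<And>v. v \<in> vdiscs G \<Longrightarrow> closed_disc v" "\<And>e. e \<in> ribbons G \<Longrightarrow> closed_disc e" using 1(3) by blast+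
  show "\<And>v w. v \<in> vdiscs G \<Longrightarrow> w \<in> vdiscs G \<Longrightarrow> v \<noteq> w \<Longrightarrow> v \<inter> w = {}" using 1(4) unfolding disjoint_def by blast
  show "\<And>e f. e \<in> ribbons G \<Longrightarrow> f \<in> ribbons G \<Longrightarrow> e \<noteq> f \<Longrightarrow> e \<inter> f = {}" using 1(5) unfolding disjoint_def by blast
  show "\<And>v e s. v \<in> vdiscs G \<Longrightarrow> e \<in> ribbons G \<Longrightarrow> s \<in> components (v \<inter> e) \<Longrightarrow> s homeomorphic {0..1::real}"
    by (rule 2[rule_format, THEN conjunct1])
  show "\<And>v e s. v \<in> vdiscs G \<Longrightarrow> e \<in> ribbons G \<Longrightarrow> s \<in> components (v \<inter> e) \<Longrightarrow> s \<subseteq> surface_boundary v \<inter> surface_boundary e"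
    by (rule 2[rule_format, THEN conjunct2])
  show "\<And>e. e \<in> ribbons G \<Longrightarrow> card (ribbon_ends G e) = 2" by (rule 3[rule_format])
qed

lemma ribbon_ends_incident:
  assumes G: "ribbon_graph G" and e: "e \<in> ribbons G"
  shows "ribbon_ends G e = (\<Union>v\<in>incident_vdiscs G e. components (v \<inter> e))"
proof -
  have "components (v \<inter> e) = {}" if "v \<in> vdiscs G" "v \<notin> incident_vdiscs G e" for v
    using that by (simp add: incident_vdiscs_def)
  then show ?thesis unfolding ribbon_ends_def incident_vdiscs_def by blast
qed

lemma ends_at_distinct_vdiscs:
  assumes G: "ribbon_graph G" and e: "e \<in> ribbons G" and vw: "v \<in> vdiscs G" "w \<in> vdiscs G" "v \<noteq> w"
  shows "components (v \<inter> e) \<inter> components (w \<inter> e) = {}"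
proof (rule ccontr)
  assume "\<not> ?thesis"
  then obtain s where s: "s \<in> components (v \<inter> e)" "s \<in> components (w \<inter> e)" by blast
  then have "s \<subseteq> v \<inter> w" "s \<noteq> {}" using in_components_subset in_components_nonempty by blast+
  then show False using ribbon_graphD(5)[OF G vw] by blast
qed

text \<open>Every incident vertex-disc contains at least one of the two ends; \<open>u = w\<close> means that the
ribbon is a loop.\<close>

lemma incident_vdiscs_pair:
  assumes G: "ribbon_graph G" and e: "e \<in> ribbons G"
  shows "\<exists>u w. u \<in> vdiscs G \<and> w \<in> vdiscs G \<and> incident_vdiscs G e = {u, w}"
proof -
  let ?I = "incident_vdiscs G e"
  have sub: "?I \<subseteq> vdiscs G" by (auto simp: incident_vdiscs_def)
  have fin: "finite ?I" using sub ribbon_graphD(1)[OF G] finite_subset by blast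
  have c2: "card (\<Union>v\<in>?I. components (v \<inter> e)) = 2"
    using ribbon_graphD(9)[OF G e] ribbon_ends_incident[OF G e] by simp
  then have finU: "finite (\<Union>v\<in>?I. components (v \<inter> e))" by (metis card.infinite zero_neq_numeral)
  have finC: "finite (components (v \<inter> e))" if "v \<in> ?I" for v using finU that by (meson UN_upper finite_subset)
  have "card (\<Union>v\<in>?I. components (v \<inter> e)) = (\<Sum>v\<in>?I. card (components (v \<inter> e)))"
    using fin finC sub ends_at_distinct_vdiscs[OF G e] by (intro card_UN_disjoint) blast+
  moreover have "1 \<le> card (components (v \<inter> e))" if "v \<in> ?I" for v
  proof -
    have "components (v \<inter> e) \<noteq> {}" using that by (simp add: incident_vdiscs_def)
    then show ?thesis using finC[OF that] by (simp add: Suc_le_eq card_gt_0_iff)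
  qed
  then have "(\<Sum>v\<in>?I. 1) \<le> (\<Sum>v\<in>?I. card (components (v \<inter> e)))" by (rule sum_mono)
  ultimately have "card ?I \<le> 2" using c2 by simp
  moreover have "card ?I \<noteq> 0" using c2 fin by auto
  ultimately have "card ?I = 1 \<or> card ?I = 2" by linarith
  then obtain u w where "?I = {u, w}" by (metis card_1_singletonE card_2_iff insert_absorb2)
  then show ?thesis using sub by blast
qed

lemma ribbon_graph_spanning_subgraph:
  assumes "ribbon_graph G" "T \<subseteq> ribbons G"
  shows "ribbon_graph (spanning_subgraph G T)"
proof -
  note D = ribbon_graphD[OF assms(1)]
  have T: "e \<in> ribbons G" if "e \<in> T" for e using assms(2) that by blast
  have ends: "ribbon_ends \<lparr>vdiscs = vdiscs G, ribbons = T\<rparr> e = ribbon_ends G e" for e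
    by (simp add: ribbon_ends_def)
  show ?thesis unfolding ribbon_graph_def spanning_subgraph_def ribbon_structure.simps ends
  proof (intro conjI ballI)
    show "finite T" using assms(2) D(2) by (rule finite_subset)
    show "disjoint (vdiscs G)" using D(5) unfolding disjoint_def by blast
    show "disjoint T" using D(6) T unfolding disjoint_def by blast
    fix v e s assume vs: "v \<in> vdiscs G" "e \<in> T" "s \<in> components (v \<inter> e)"
    show "s homeomorphic {0..1::real}" by (rule D(7)[OF vs(1) T[OF vs(2)] vs(3)])
    show "s \<subseteq> surface_boundary v \<inter> surface_boundary e" by (rule D(8)[OF vs(1) T[OF vs(2)] vs(3)])
  qed (use D(1,3,4,9) T in blast)+
qed

lemma contract_eq:
  assumes "incident_vdiscs G e = {u, w}"
  shows "contract e G = \<lparr>vdiscs = insert (e \<union> (u \<union> w)) (vdiscs G - {u, w}), ribbons = ribbons G - {e}\<rparr>"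
  unfolding contract_def assms by simp

text \<open>The new vertex-disc arises by gluing twice along an arc, and it has the same ribbon ends as \<open>u\<close>
and \<open>w\<close> together, because other ribbons do not touch the contracted one.\<close>

lemma ribbon_graph_contract:
  fixes G :: "'a::t2_space ribbon_structure"
  assumes G: "ribbon_graph G" and e: "e \<in> ribbons G"
    and uw: "u \<in> vdiscs G" "w \<in> vdiscs G" "u \<noteq> w" "incident_vdiscs G e = {u, w}"
  shows "ribbon_graph (contract e G)"
proof -
  note D = ribbon_graphD[OF G]
  have cl: "closed x" if "x \<in> vdiscs G \<or> x \<in> ribbons G" for x using that D(3,4) closed_disc_closed by blast
  have inc: "v \<inter> e = {}" if "v \<in> vdiscs G" "v \<noteq> u" "v \<noteq> w" for v
    using uw(4) that unfolding incident_vdiscs_def by blast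
  have ine: "u \<inter> e \<noteq> {}" "w \<inter> e \<noteq> {}" using uw(4) unfolding incident_vdiscs_def by blast+
  have "card (components (u \<inter> e) \<union> components (w \<inter> e)) = 2"
    using D(9)[OF e] ribbon_ends_incident[OF G e] uw(4) by simp
  moreover have "components (u \<inter> e) \<inter> components (w \<inter> e) = {}" by (rule ends_at_distinct_vdiscs[OF G e uw(1-3)])
  moreover have "finite (components (u \<inter> e) \<union> components (w \<inter> e))" using calculation(1) by (metis card.infinite zero_neq_numeral)
  ultimately have "card (components (u \<inter> e)) + card (components (w \<inter> e)) = 2"
    "card (components (u \<inter> e)) \<noteq> 0" "card (components (w \<inter> e)) \<noteq> 0"
    using ine by (auto simp: card_Un_disjoint)
  then have one: "card (components (u \<inter> e)) = 1" "card (components (w \<inter> e)) = 1" by linarith+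
  have "components X = {X}" if X: "card (components X) = 1" for X :: "'a set"
  proof -
    obtain s where s: "components X = {s}" using X by (rule card_1_singletonE)
    then have "X = s" using Union_components[of X] by simp
    then show ?thesis using s by simp
  qed
  then have cu: "components (u \<inter> e) = {u \<inter> e}" "components (w \<inter> e) = {w \<inter> e}" using one by auto
  have "u \<inter> e homeomorphic {0..1::real}" using D(7)[OF uw(1) e, of "u \<inter> e"] cu by simp
  then obtain p where p: "arc p" "path_image p = u \<inter> e" using homeomorphic_interval_arc by blast
  have "w \<inter> e homeomorphic {0..1::real}" using D(7)[OF uw(2) e, of "w \<inter> e"] cu by simp
  then obtain q where q: "arc q" "path_image q = w \<inter> e" using homeomorphic_interval_arc by blast
  have bu: "u \<inter> e \<subseteq> surface_boundary u \<inter> surface_boundary e" using D(8)[OF uw(1) e, of "u \<inter> e"] cu by simp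
  have bw: "w \<inter> e \<subseteq> surface_boundary w \<inter> surface_boundary e" using D(8)[OF uw(2) e, of "w \<inter> e"] cu by simp
  have uw0: "u \<inter> w = {}" using D(5) uw by blast
  have A: "closed_disc (e \<union> u)"
    using glue_discs(1)[OF D(4)[OF e] D(3)[OF uw(1)] p(1)] bu p(2) by (simp add: Int_commute)
  have "path_image q \<subseteq> surface_boundary (e \<union> u)"
  proof
    fix x assume "x \<in> path_image q"
    then have x: "x \<in> e" "x \<notin> u" "x \<in> surface_boundary e" using q(2) bw uw0 by auto
    then show "x \<in> surface_boundary (e \<union> u)" using surface_boundary_away[of u x e] cl uw(1) by blast
  qed
  moreover have "(e \<union> u) \<inter> w = path_image q" using q(2) uw0 by blast
  ultimately have "closed_disc (e \<union> u \<union> w)" using glue_discs(1)[OF A D(3)[OF uw(2)] q(1)] bw q(2) by simp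
  then have disc: "closed_disc (e \<union> (u \<union> w))" by (simp add: Un_assoc)
  let ?D = "e \<union> (u \<union> w)"
  have Dv: "?D \<inter> v = {}" if v: "v \<in> vdiscs G" "v \<noteq> u" "v \<noteq> w" for v
    using inc[OF v] D(5)[OF v(1) uw(1) v(2)] D(5)[OF v(1) uw(2) v(3)] by blast
  have comp: "components (?D \<inter> f) = components (u \<inter> f) \<union> components (w \<inter> f)" if f: "f \<in> ribbons G" "f \<noteq> e" for f
  proof -
    have "?D \<inter> f = (u \<inter> f) \<union> (w \<inter> f)" using D(6)[OF f(1) e f(2)] by blast
    moreover have "components ((u \<inter> f) \<union> (w \<inter> f)) = components (u \<inter> f) \<union> components (w \<inter> f)"
      by (rule components_Un_closed) (use cl uw f uw0 in auto)
    ultimately show ?thesis by simp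
  qed
  have bdy: "s \<subseteq> surface_boundary ?D" if f: "f \<in> ribbons G" "f \<noteq> e" and s: "s \<in> components (?D \<inter> f)" for f s
  proof
    fix x assume x: "x \<in> s"
    have fe: "f \<inter> e = {}" using D(6)[OF f(1) e f(2)] .
    have "s \<in> components (u \<inter> f) \<or> s \<in> components (w \<inter> f)" using s comp[OF f] by blast
    then show "x \<in> surface_boundary ?D"
    proof
      assume s: "s \<in> components (u \<inter> f)"
      have "s \<subseteq> surface_boundary u" "s \<subseteq> u \<inter> f" using D(8)[OF uw(1) f(1) s] in_components_subset[OF s] by auto
      then have "x \<in> u" "x \<notin> e \<union> w" "x \<in> surface_boundary u" using x fe uw0 by auto
      moreover have "closed (e \<union> w)" using cl uw e by blast
      moreover have "?D = u \<union> (e \<union> w)" by blast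
      ultimately show ?thesis using surface_boundary_away[of "e \<union> w" x u] by simp
    next
      assume s: "s \<in> components (w \<inter> f)"
      have "s \<subseteq> surface_boundary w" "s \<subseteq> w \<inter> f" using D(8)[OF uw(2) f(1) s] in_components_subset[OF s] by auto
      then have "x \<in> w" "x \<notin> e \<union> u" "x \<in> surface_boundary w" using x fe uw0 by auto
      moreover have "closed (e \<union> u)" using cl uw e by blast
      moreover have "?D = w \<union> (e \<union> u)" by blast
      ultimately show ?thesis using surface_boundary_away[of "e \<union> u" x w] by simp
    qed
  qed
  show ?thesis unfolding contract_eq[OF uw(4)] ribbon_graph_def ribbon_structure.simps
  proof (intro conjI ballI)
    show "finite (insert ?D (vdiscs G - {u, w}))" "finite (ribbons G - {e})" using D(1,2) by auto
    show "closed_disc x" if "x \<in> insert ?D (vdiscs G - {u, w}) \<union> (ribbons G - {e})" for x using that disc D(3,4) by blast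
    show "disjoint (ribbons G - {e})" using D(6) unfolding disjoint_def by blast
    show "disjoint (insert ?D (vdiscs G - {u, w}))" unfolding disjoint_def
    proof (intro ballI impI)
      fix x y assume xy: "x \<in> insert ?D (vdiscs G - {u, w})" "y \<in> insert ?D (vdiscs G - {u, w})" "x \<noteq> y"
      show "x \<inter> y = {}"
      proof (cases "x = ?D")
        case True
        then have "y \<in> vdiscs G" "y \<noteq> u" "y \<noteq> w" using xy by auto
        then show ?thesis unfolding True by (rule Dv)
      next
        case False
        then have x: "x \<in> vdiscs G" "x \<noteq> u" "x \<noteq> w" using xy by auto
        show ?thesis
        proof (cases "y = ?D")
          case True then show ?thesis using Dv[OF x] by blast
        next
          case False then show ?thesis using D(5)[OF x(1)] xy by blast
        qed
      qed
    qed
    fix v f s assume v: "v \<in> insert ?D (vdiscs G - {u, w})" and f: "f \<in> ribbons G - {e}" and s: "s \<in> components (v \<inter> f)"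
    have ff: "f \<in> ribbons G" "f \<noteq> e" using f by auto
    show "s homeomorphic {0..1::real}" "s \<subseteq> surface_boundary v \<inter> surface_boundary f"
    proof -
      have "s homeomorphic {0..1::real} \<and> s \<subseteq> surface_boundary v \<inter> surface_boundary f"
      proof (cases "v = ?D")
        case False
        then show ?thesis using D(7,8)[OF _ ff(1), of v s] v s by blast
      next
        case True
        then have s': "s \<in> components (?D \<inter> f)" using s by simp
        then have "s \<in> components (u \<inter> f) \<or> s \<in> components (w \<inter> f)" using comp[OF ff] by blast
        then have "s homeomorphic {0..1::real} \<and> s \<subseteq> surface_boundary f"
          using D(7)[OF uw(1) ff(1), of s] D(8)[OF uw(1) ff(1), of s] D(7)[OF uw(2) ff(1), of s] D(8)[OF uw(2) ff(1), of s]
          by (elim disjE) simp_all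
        then show ?thesis using bdy[OF ff s'] True by blast
      qed
      then show "s homeomorphic {0..1::real}" "s \<subseteq> surface_boundary v \<inter> surface_boundary f" by auto
    qed
  next
    fix f assume f: "f \<in> ribbons G - {e}"
    then have ff: "f \<in> ribbons G" "f \<noteq> e" by auto
    have "ribbon_ends \<lparr>vdiscs = insert ?D (vdiscs G - {u, w}), ribbons = ribbons G - {e}\<rparr> f = ribbon_ends G f"
      unfolding ribbon_ends_def ribbon_structure.simps using comp[OF ff] uw(1,2) by auto
    then show "card (ribbon_ends \<lparr>vdiscs = insert ?D (vdiscs G - {u, w}), ribbons = ribbons G - {e}\<rparr> f) = 2"
      using D(9)[OF ff(1)] by simp
  qed
qed

lemma contract_card_vdiscs:
  fixes G :: "'a::t2_space ribbon_structure"
  assumes G: "ribbon_graph G" and uw: "u \<in> vdiscs G" "w \<in> vdiscs G" "u \<noteq> w" "incident_vdiscs G e = {u, w}"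
  shows "card (vdiscs G) = Suc (card (vdiscs (contract e G)))"
proof -
  note D = ribbon_graphD[OF G]
  have "e \<union> (u \<union> w) \<notin> vdiscs G - {u, w}"
  proof
    assume "e \<union> (u \<union> w) \<in> vdiscs G - {u, w}"
    then have "(e \<union> (u \<union> w)) \<inter> u = {}" using D(5) uw(1) by blast
    then show False using closed_disc_nonempty[OF D(3)[OF uw(1)]] by blast
  qed
  then have "card (vdiscs (contract e G)) = Suc (card (vdiscs G - {u, w}))"
    unfolding contract_eq[OF uw(4)] using D(1) by simp
  moreover have "card (vdiscs G - {u, w}) = card (vdiscs G) - 2" using uw D(1) by (simp add: card_Diff_subset)
  moreover have "card {u, w} \<le> card (vdiscs G)" using uw D(1) by (intro card_mono) auto
  ultimately show ?thesis using uw(3) by simp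
qed

lemma contract_surface:
  assumes "incident_vdiscs G e = {u, w}" "u \<in> vdiscs G" "w \<in> vdiscs G" "e \<in> T"
  shows "\<Union>(vdiscs (contract e G)) \<union> \<Union>(T - {e} - S) = \<Union>(vdiscs G) \<union> (\<Union>(T - S) \<union> e)"
  unfolding contract_eq[OF assms(1)] ribbon_structure.simps using assms(2-4) by blast

section \<open>Contracting a spanning tree\<close>

text \<open>Used for a loop \<open>e\<close> attached to the vertex-disc \<open>u\<close>: removing it keeps the surface
connected.\<close>

lemma connected_remove_handle:
  assumes conn: "connected (X \<union> e)" and cl: "closed X" "closed e" and u: "connected u" "u \<subseteq> X" "e \<inter> X \<subseteq> u"
  shows "connected X"
  unfolding connected_closed_set[OF cl(1)]
proof
  assume "\<exists>A B. closed A \<and> closed B \<and> A \<noteq> {} \<and> B \<noteq> {} \<and> A \<union> B = X \<and> A \<inter> B = {}"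
  then obtain A B where AB: "closed A" "closed B" "A \<noteq> {}" "B \<noteq> {}" "A \<union> B = X" "A \<inter> B = {}" by blast
  have main: False if "closed A" "closed B" "A \<noteq> {}" "B \<noteq> {}" "A \<union> B = X" "A \<inter> B = {}" "u \<inter> B = {}" for A B
  proof -
    have "closed (A \<union> e)" using that cl by blast
    moreover have "(A \<union> e) \<inter> B \<inter> (X \<union> e) = {}" using that u by blast
    moreover have "X \<union> e \<subseteq> (A \<union> e) \<union> B" using that by blast
    ultimately show False using connected_closedD[OF conn _ _ _ that(2)] that by blast
  qed
  have "u \<inter> A = {} \<or> u \<inter> B = {}" using connected_closedD[OF u(1) _ _ AB(1,2)] AB(5,6) u(2) by blast
  then show False using main[of A B] main[of B A] AB by blast
qed

text \<open>Otherwise the vertex-discs that can be reached from \<open>u\<close>, together with their ribbons, and the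
remaining pieces of the surface form two disjoint nonempty closed sets.\<close>

lemma connected_surface_path:
  fixes H :: "'a::t2_space ribbon_structure"
  assumes H: "ribbon_graph H" and conn: "connected (surface H)" and uw: "u \<in> vdiscs H" "w \<in> vdiscs H"
  shows "(\<lambda>x y. \<exists>f\<in>ribbons H. incident_vdiscs H f = {x, y})\<^sup>*\<^sup>* u w"
proof (rule ccontr)
  let ?r = "\<lambda>x y. \<exists>f\<in>ribbons H. incident_vdiscs H f = {x, y}"
  assume nr: "\<not> ?r\<^sup>*\<^sup>* u w"
  note D = ribbon_graphD[OF H]
  define S where "S = {x \<in> vdiscs H. ?r\<^sup>*\<^sup>* u x}"
  define E where "E = {f \<in> ribbons H. incident_vdiscs H f \<inter> S \<noteq> {}}"
  have ES: "incident_vdiscs H f \<subseteq> S" if f: "f \<in> E" for f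
  proof -
    obtain x y where xy: "x \<in> vdiscs H" "y \<in> vdiscs H" "incident_vdiscs H f = {x, y}"
      using incident_vdiscs_pair[OF H] f unfolding E_def by blast
    have "?r x y" "?r y x" using xy f unfolding E_def by (auto simp: insert_commute)
    have "?r\<^sup>*\<^sup>* u y" if "?r\<^sup>*\<^sup>* u x" by (rule rtranclp.rtrancl_into_rtrancl[OF that \<open>?r x y\<close>])
    moreover have "?r\<^sup>*\<^sup>* u x" if "?r\<^sup>*\<^sup>* u y" by (rule rtranclp.rtrancl_into_rtrancl[OF that \<open>?r y x\<close>])
    ultimately have "x \<in> S \<longleftrightarrow> y \<in> S" using xy unfolding S_def by blast
    moreover have "{x, y} \<inter> S \<noteq> {}" using f unfolding E_def mem_Collect_eq xy(3) by (rule conjunct2)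
    ultimately show ?thesis unfolding xy(3) by blast
  qed
  define A where "A = \<Union>S \<union> \<Union>E"
  define B where "B = \<Union>(vdiscs H - S) \<union> \<Union>(ribbons H - E)"
  have cl: "closed x" if "x \<in> vdiscs H \<or> x \<in> ribbons H" for x using that D(3,4) closed_disc_closed by blast
  have fin: "finite S" "finite E" using D(1,2) unfolding S_def E_def by auto
  have "closed A" unfolding A_def using fin cl unfolding S_def E_def by (intro closed_Un closed_Union) auto
  moreover have "closed B" unfolding B_def using D(1,2) cl by (intro closed_Un closed_Union) auto
  moreover have "A \<inter> B = {}"
  proof -
    have vv: "v \<inter> x = {}" if "v \<in> S" "x \<in> vdiscs H - S" for v x using that D(5) unfolding S_def by blast
    have vf: "v \<inter> f = {}" if "v \<in> S" "f \<in> ribbons H - E" for v f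
      using that unfolding E_def S_def incident_vdiscs_def by blast
    have fv: "f \<inter> v = {}" if "f \<in> E" "v \<in> vdiscs H - S" for v f
      using that ES[OF that(1)] unfolding incident_vdiscs_def by blast
    have ff: "f \<inter> x = {}" if "f \<in> E" "x \<in> ribbons H - E" for f x using that D(6) unfolding E_def by blast
    show ?thesis
    proof (rule equals0I)
      fix z assume "z \<in> A \<inter> B"
      then consider x where "x \<in> S" "z \<in> x" "z \<in> B" | x where "x \<in> E" "z \<in> x" "z \<in> B" unfolding A_def by blast
      then show False
      proof cases
        case 1
        then consider y where "y \<in> vdiscs H - S" "z \<in> y" | y where "y \<in> ribbons H - E" "z \<in> y" unfolding B_def by blast
        then show ?thesis using vv[OF 1(1)] vf[OF 1(1)] 1(2) by cases blast+
      next
        case 2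
        then consider y where "y \<in> vdiscs H - S" "z \<in> y" | y where "y \<in> ribbons H - E" "z \<in> y" unfolding B_def by blast
        then show ?thesis using fv[OF 2(1)] ff[OF 2(1)] 2(2) by cases blast+
      qed
    qed
  qed
  moreover have "surface H \<subseteq> A \<union> B" unfolding surface_def A_def B_def by blast
  ultimately have "A \<inter> surface H = {} \<or> B \<inter> surface H = {}" using connected_closedD[OF conn, of A B] by blast
  moreover have "u \<subseteq> A \<inter> surface H" using uw unfolding A_def S_def surface_def by auto
  moreover have "w \<subseteq> B \<inter> surface H" using uw nr unfolding B_def S_def surface_def by auto
  ultimately show False using closed_disc_nonempty D(3) uw by blast
qed

text \<open>A path that joins the two vertex-discs of \<open>f\<close> without using \<open>f\<close> would close up to a cycle.
If \<open>f\<close> is a loop then the path is empty and the cycle has length 1.\<close>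

lemma acyclic_minimally_connected:
  fixes G :: "'a::t2_space ribbon_structure"
  assumes G: "ribbon_graph G" and T: "T \<subseteq> ribbons G"
    and acyclic: "\<not> (\<exists>vs es. is_cycle (spanning_subgraph G T) vs es)" and f: "f \<in> T"
  shows "\<not> connected (surface (spanning_subgraph G (T - {f})))"
proof
  let ?H = "spanning_subgraph G (T - {f})"
  assume conn: "connected (surface ?H)"
  have H: "ribbon_graph ?H" by (rule ribbon_graph_spanning_subgraph[OF G]) (use T in blast)
  have inc: "incident_vdiscs ?H x = incident_vdiscs G x" "incident_vdiscs (spanning_subgraph G T) x = incident_vdiscs G x" for x
    by (simp_all add: incident_vdiscs_def spanning_subgraph_def)
  have "f \<in> ribbons G" using f T by blast
  then obtain u w where uw: "u \<in> vdiscs G" "w \<in> vdiscs G" "incident_vdiscs G f = {u, w}"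
    using incident_vdiscs_pair[OF G] by blast
  define r where "r x y \<longleftrightarrow> (\<exists>e\<in>T - {f}. incident_vdiscs G e = {x, y})" for x y
  have "r\<^sup>*\<^sup>* u w" using connected_surface_path[OF H conn, of u w] uw(1,2) inc(1) 
    unfolding r_def by (simp add: spanning_subgraph_def)
  then obtain xs0 where "rtrancl_path r u xs0 w" using rtranclp_eq_rtrancl_path[of r u w] by auto
  then obtain xs where xs: "rtrancl_path r u xs w" "distinct (u # xs)" by (rule rtrancl_path_distinct)
  define n where "n = length xs"
  define vs where "vs = u # xs"
  have "r (vs ! i) (vs ! Suc i)" if "i < n" for i
    using rtrancl_path_nth[OF xs(1)] that by (simp add: vs_def n_def)
  then have "\<forall>i\<in>{..<n}. \<exists>e. e \<in> T - {f} \<and> incident_vdiscs G e = {vs ! i, vs ! Suc i}" unfolding r_def by blast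
  then obtain F where F: "\<forall>i\<in>{..<n}. F i \<in> T - {f} \<and> incident_vdiscs G (F i) = {vs ! i, vs ! Suc i}" by (rule bchoice[THEN exE])
  define es where "es = map F [0..<n] @ [f]"
  have lv: "length vs = Suc n" by (simp add: vs_def n_def)
  have last: "vs ! n = w"
  proof (cases "xs = []")
    case True then show ?thesis using xs(1) by (auto simp: vs_def n_def elim: rtrancl_path.cases)
  next
    case False then show ?thesis using rtrancl_path_last[OF xs(1) False] by (simp add: vs_def n_def last_conv_nth nth_Cons')
  qed
  have dv: "distinct vs" using xs(2) by (simp add: vs_def)
  have "inj_on F {0..<n}"
  proof -
    have "F i \<noteq> F j" if "i < j" "j < n" for i j
    proof
      assume "F i = F j"
      then have "{vs ! i, vs ! Suc i} = {vs ! j, vs ! Suc j}" using F that by (metis lessThan_iff order.strict_trans)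
      then have "vs ! i = vs ! j \<or> vs ! i = vs ! Suc j" by blast
      then show False using dv that lv by (auto simp: nth_eq_iff_index_eq)
    qed
    then show ?thesis by (intro inj_onI) (metis atLeastLessThan_iff linorder_neqE_nat)
  qed
  then have de: "distinct es" using F by (auto simp: es_def distinct_map)
  have "is_cycle (spanning_subgraph G T) vs es" unfolding is_cycle_def
  proof (intro conjI allI impI)
    show "es \<noteq> []" "length vs = length es" by (auto simp: es_def lv)
    show "distinct vs" "distinct es" by (fact dv, fact de)
    show "set es \<subseteq> ribbons (spanning_subgraph G T)" using F f by (auto simp: es_def spanning_subgraph_def)
    have sub: "incident_vdiscs G e \<subseteq> vdiscs G" for e by (auto simp: incident_vdiscs_def)
    show "set vs \<subseteq> vdiscs (spanning_subgraph G T)"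
    proof
      fix x assume "x \<in> set vs"
      then obtain i where i: "i < Suc n" "x = vs ! i" using lv by (metis in_set_conv_nth)
      show "x \<in> vdiscs (spanning_subgraph G T)"
      proof (cases "i = n")
        case True then show ?thesis using i last uw by (simp add: spanning_subgraph_def)
      next
        case False
        then have "i \<in> {..<n}" using i by simp
        then have "x \<in> incident_vdiscs G (F i)" using F i by blast
        then show ?thesis using sub by (auto simp: spanning_subgraph_def)
      qed
    qed
    fix i assume i: "i < length es"
    show "incident_vdiscs (spanning_subgraph G T) (es ! i) = {vs ! i, vs ! (Suc i mod length es)}"
    proof (cases "i < n")
      case True
      then show ?thesis using F inc(2) by (simp add: es_def nth_append)
    next
      case False
      then have "i = n" using i by (simp add: es_def)
      then show ?thesis using uw(3) inc(2) last by (simp add: es_def nth_append vs_def insert_commute)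
    qed
  qed
  then show False using acyclic by blast
qed

text \<open>Acyclicity enters as minimal connectedness: no edge of the tree can be removed without disconnecting
the surface of the tree. This condition only speaks of the underlying sets, which do not change
under contraction, and it forbids loops by \<open>connected_remove_handle\<close>; so the next edge can
always be contracted properly.\<close>

lemma aux_bouquet_contracts:
  fixes G :: "'a::t2_space ribbon_structure"
  assumes "ribbon_graph G" "vdiscs G \<noteq> {}" "distinct ts" "set ts \<subseteq> ribbons G"
    and "connected (\<Union>(vdiscs G) \<union> \<Union>(set ts))"
    and "\<And>f. f \<in> set ts \<Longrightarrow> \<not> connected (\<Union>(vdiscs G) \<union> \<Union>(set ts - {f}))"
  shows "ribbon_graph (aux_bouquet G ts) \<and> surface (aux_bouquet G ts) = surface G \<and>
    ribbons (aux_bouquet G ts) = ribbons G - set ts \<and> (\<exists>v. vdiscs (aux_bouquet G ts) = {v}) \<and> card (vdiscs G) = Suc (length ts)"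
  using assms
proof (induction ts arbitrary: G)
  case Nil
  note D = ribbon_graphD[OF Nil.prems(1)]
  obtain v where v: "v \<in> vdiscs G" using Nil.prems(2) by blast
  have cl: "closed x" if "x \<in> vdiscs G" for x using that D(3) closed_disc_closed by blast
  have "vdiscs G = {v}"
  proof (rule ccontr)
    assume "vdiscs G \<noteq> {v}"
    then obtain x where x: "x \<in> vdiscs G" "x \<noteq> v" using v by blast
    have "closed (\<Union>(vdiscs G - {v}))" using D(1) cl by auto
    moreover have "v \<inter> \<Union>(vdiscs G - {v}) = {}" using D(5) v by blast
    moreover have "\<Union>(vdiscs G) \<subseteq> v \<union> \<Union>(vdiscs G - {v})" by blast
    moreover have "connected (\<Union>(vdiscs G))" using Nil.prems(5) by simp
    ultimately have "v \<inter> \<Union>(vdiscs G) = {} \<or> \<Union>(vdiscs G - {v}) \<inter> \<Union>(vdiscs G) = {}"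
      using connected_closedD[of "\<Union>(vdiscs G)" v "\<Union>(vdiscs G - {v})"] cl[OF v] by blast
    then show False using v x closed_disc_nonempty D(3) by blast
  qed
  then show ?case using Nil.prems(1) by (simp add: aux_bouquet_def)
next
  case (Cons e ts)
  let ?T = "set (e # ts)"
  note G = Cons.prems(1)
  note D = ribbon_graphD[OF G]
  have e: "e \<in> ribbons G" "e \<notin> set ts" using Cons.prems(3,4) by auto
  have cl: "closed x" if "x \<in> vdiscs G \<or> x \<in> ribbons G" for x using that D(3,4) closed_disc_closed by blast
  obtain u w where uw: "u \<in> vdiscs G" "w \<in> vdiscs G" "incident_vdiscs G e = {u, w}" using incident_vdiscs_pair[OF G e(1)] by blast
  have "u \<noteq> w"
  proof
    assume eq: "u = w"
    let ?X = "\<Union>(vdiscs G) \<union> \<Union>(set ts)"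
    have "connected ?X"
    proof (rule connected_remove_handle)
      have "?X \<union> e = \<Union>(vdiscs G) \<union> \<Union>?T" by auto
      then show "connected (?X \<union> e)" using Cons.prems(5) by simp
      show "closed ?X" using D(1) cl Cons.prems(4) by (intro closed_Un closed_Union) auto
      show "closed e" using cl e by blast
      show "connected u" using closed_disc_connected D(3) uw(1) by blast
      show "u \<subseteq> ?X" using uw(1) by blast
      have "e \<inter> v \<subseteq> u" if "v \<in> vdiscs G" for v using that uw(3) eq unfolding incident_vdiscs_def by blast
      moreover have "e \<inter> f = {}" if "f \<in> set ts" for f using D(6)[OF e(1), of f] that e(2) Cons.prems(4) by auto
      ultimately show "e \<inter> ?X \<subseteq> u" by blast
    qed
    moreover have "?T - {e} = set ts" using e(2) by auto
    ultimately show False using Cons.prems(6)[of e] by simp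
  qed
  note ne = this
  let ?G = "contract e G"
  have G': "ribbon_graph ?G" by (rule ribbon_graph_contract[OF G e(1) uw(1,2) ne uw(3)])
  have rG': "ribbons ?G = ribbons G - {e}" by (simp add: contract_def)
  have surf: "\<Union>(vdiscs ?G) \<union> \<Union>(?T - {e} - S) = \<Union>(vdiscs G) \<union> (\<Union>(?T - S) \<union> e)" for S
    by (rule contract_surface[OF uw(3,1,2)]) simp
  have Te: "?T - {e} = set ts" using e(2) by auto
  have "ribbon_graph (aux_bouquet ?G ts) \<and> surface (aux_bouquet ?G ts) = surface ?G \<and>
    ribbons (aux_bouquet ?G ts) = ribbons ?G - set ts \<and> (\<exists>v. vdiscs (aux_bouquet ?G ts) = {v}) \<and> card (vdiscs ?G) = Suc (length ts)"
  proof (rule Cons.IH[OF G'])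
    show "vdiscs ?G \<noteq> {}" by (simp add: contract_def)
    show "distinct ts" using Cons.prems(3) by simp
    show "set ts \<subseteq> ribbons ?G" using Cons.prems(4) e(2) rG' by auto
    have "\<Union>(vdiscs ?G) \<union> \<Union>(set ts) = \<Union>(vdiscs G) \<union> \<Union>?T" using surf[of "{}"] Te by auto
    then show "connected (\<Union>(vdiscs ?G) \<union> \<Union>(set ts))" using Cons.prems(5) by simp
    fix f assume f: "f \<in> set ts"
    have "e \<in> ?T - {f}" using f e(2) by auto
    then have "\<Union>(vdiscs ?G) \<union> \<Union>(set ts - {f}) = \<Union>(vdiscs G) \<union> \<Union>(?T - {f})" using surf[of "{f}"] Te by auto
    then show "\<not> connected (\<Union>(vdiscs ?G) \<union> \<Union>(set ts - {f}))" using Cons.prems(6)[of f] f by simp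
  qed
  moreover have "surface ?G = surface G" 
    unfolding surface_def rG' using contract_surface[OF uw(3,1,2) e(1), of "{}"] e(1) by auto
  moreover have "card (vdiscs G) = Suc (card (vdiscs ?G))" by (rule contract_card_vdiscs[OF G uw(1,2) ne uw(3)])
  moreover have "aux_bouquet G (e # ts) = aux_bouquet ?G ts" by (simp add: aux_bouquet_def)
  ultimately show ?case using rG' by auto
qed

theorem theorem1p1:
  fixes G :: "'a::t2_space ribbon_structure"
    and T :: "'a set set"
    and ts es :: "'a set list"
  assumes "connected_ribbon_graph G"
    and "spanning_tree G T"
    and "distinct ts" and "set ts = T"
    and "distinct es" and "set es = ribbons (aux_bouquet G ts)"
  shows "euler_genus G = int (vec_space.rank (length es) (adj_SI (aux_bouquet G ts) es))"
proof -
  let ?B = "aux_bouquet G ts"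
  have G: "ribbon_graph G" and c1: "num_components G = 1" using assms(1) unfolding connected_ribbon_graph_def by auto
  have T: "T \<subseteq> ribbons G" and cT: "num_components (spanning_subgraph G T) = 1"
    and ac: "\<not> (\<exists>vs es. is_cycle (spanning_subgraph G T) vs es)"
    using assms(2) unfolding spanning_tree_def connected_ribbon_graph_def by auto
  have sT: "surface (spanning_subgraph G S) = \<Union>(vdiscs G) \<union> \<Union>S" for S by (simp add: surface_def spanning_subgraph_def)
  have "\<exists>C. components (surface (spanning_subgraph G T)) = {C}" using cT unfolding num_components_def by (metis card_1_singletonE)
  then have conn: "connected (\<Union>(vdiscs G) \<union> \<Union>T)" "\<Union>(vdiscs G) \<union> \<Union>T \<noteq> {}"
    unfolding sT components_eq_sing_exists by auto
  have ne: "vdiscs G \<noteq> {}"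
  proof
    assume e: "vdiscs G = {}"
    then obtain f where "f \<in> ribbons G" using conn(2) T by auto
    then show False using incident_vdiscs_pair[OF G] e by blast
  qed
  have min: "\<not> connected (\<Union>(vdiscs G) \<union> \<Union>(set ts - {f}))" if "f \<in> set ts" for f
    using acyclic_minimally_connected[OF G T ac, of f] that unfolding assms(4) sT by blast
  have "ribbon_graph ?B \<and> surface ?B = surface G \<and> ribbons ?B = ribbons G - set ts \<and> (\<exists>v. vdiscs ?B = {v}) \<and> card (vdiscs G) = Suc (length ts)"
    by (rule aux_bouquet_contracts[OF G ne assms(3)]) (use T assms(4) conn(1) min in auto)
  then obtain v where B: "ribbon_graph ?B" "surface ?B = surface G" "ribbons ?B = ribbons G - set ts" "vdiscs ?B = {v}"
     "card (vdiscs G) = Suc (length ts)" by blast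
  have "card (faces ?B) + vec_space.rank (length es) (adj_SI ?B es) = length es + 1"
    by (rule bouquet_faces_rank[OF B(1,4) assms(5,6)])
  moreover have "faces ?B = faces G" unfolding faces_def B(2) ..
  moreover have "card (ribbons G) = length es + length ts"
  proof -
    have "finite (ribbons G)" using ribbon_graphD(2)[OF G] .
    then have "card (ribbons G) = card (ribbons G - set ts) + card (set ts)"
      using T assms(4) by (metis add.commute card_Diff_subset card_mono finite_subset le_add_diff_inverse)
    then show ?thesis using distinct_card[OF assms(3)] distinct_card[OF assms(5)] assms(6) B(3) by simp
  qed
  ultimately show ?thesis unfolding euler_genus_def euler_char_def c1 using B(5) by simp
qed

end
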